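(* Let $T=(\pi,\lambda)$ be a self-similar IET of hyperbolic periodic type on $[0,1)$ with self-similarity matrix $M$, and let $\nu_\omega$ be a $\phi_\omega$-conformal measure for $T$, where $\omega\in\mathbb R^{\mathcal A}$ is of central-stable type. Then $$\dim_H(\nu_\omega)=\frac{\mathcal H(T,\omega)}{\rho_T}\in(0,1),$$ where $$\mathcal H(T,\omega)=\rho_c-\sum_{\alpha\in\mathcal A}\ \sum_{0\le i<q^{(N)}_\alpha}\theta^c_{\beta(\alpha,i)}\,e^{-\rho_c}\,\ell^c_\alpha\, e^{S_i\phi_{\omega_c}|_{I^{(N)}_\alpha}}\Big(S_i\phi_{\omega_c}\big|_{I^{(N)}_\alpha}\Big).$$
   Context: **IETs.** Let $\mathcal A$ be a finite alphabet with $d\ge 2$ letters. A permutation is a pair $\pi=(\pi_t,\pi_b)$ of bijections $\mathcal A\to\{1,\dots,d\}$, always assumed irreducible: $\pi_t^{-1}\{1,\dots,k\}\ne\pi_b^{-1}\{1,\dots,k\}$ for $1\le k<d$. For $\lambda\in\mathbb R_{>0}^{\mathcal A}$, the IET $T=(\pi,\lambda)$ is the bijection of $I=[0,\sum_\alpha\lambda_\alpha)$ which translates each interval of the partition of $I$ into left-closed right-open intervals $I_\alpha$ of lengths $\lambda_\alpha$ (ordered from left to right according to $\pi_t$), the images $T(I_\alpha)$ being ordered according to $\pi_b$. **Rauzy–Veech induction.** Put $\alpha(\varepsilon)=\pi_\varepsilon^{-1}(d)$, $\varepsilon\in\{t,b\}$. If $|I_{\alpha(t)}|>|T(I_{\alpha(b)})|$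 (top type, winner $\alpha(t)$), set $I^{(1)}=I\setminus T(I_{\alpha(b)})$, $I^{(1)}_{\alpha(t)}=I_{\alpha(t)}\setminus T(I_{\alpha(b)})$ and $I^{(1)}_\alpha=I_\alpha$ for the other letters. If $|I_{\alpha(t)}|<|T(I_{\alpha(b)})|$ (bottom type, winner $\alpha(b)$), set $I^{(1)}=I\setminus I_{\alpha(t)}$, $I^{(1)}_{\alpha(t)}=T^{-1}(I_{\alpha(t)})$, $I^{(1)}_{\alpha(b)}=I_{\alpha(b)}\setminus T^{-1}(I_{\alpha(t)})$ and $I^{(1)}_\alpha=I_\alpha$ for the other letters. The first return map of $T$ to $I^{(1)}$ is an IET exchanging the $I^{(1)}_\alpha$. Iterating (assumed possible forever) one gets intervals $I^{(n)}$, $I^{(n)}_\alpha$, permutations $\pi^{(n)}$ and return times $q^{(n)}_\alpha$ such that the first return map of $T$ to $I^{(n)}$ equals $T^{q^{(n)}_\alpha}$ on $I^{(n)}_\alpha$. The combinatorial rotation number $\gamma(T)$ is the infinite sequence of pairs ($\pi^{(n)}$, type of step $n$), $n\ge0$; it is $\infty$-complete if every letter is a winner infinitely often. **Hyperbolic periodic type.** An IET $T=(\pi,\lambda)$ on $[0,1)$ is self-similar if $\gamma(T)$ is $\infty$-complete and periodic. For a period $N$, the self-similarity matrix is $M$, $M_{\alpha\beta}=\#\{0\le k<q^{(N)}_\alpha: T^kI^{(N)}_\alpha\subset I_\beta\}$; then $\lambda M=e^{\rho_T}\lambda$, where $\rho_T>0$ is the logarithm of the Perron–Frobenius eigenvalue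 of $M$. Let $\Omega_\pi$ be the matrix with $(\Omega_\pi)_{\alpha\beta}=1$ if $\pi_b(\alpha)>\pi_b(\beta),\pi_t(\alpha)<\pi_t(\beta)$; $-1$ if $\pi_b(\alpha)<\pi_b(\beta),\pi_t(\alpha)>\pi_t(\beta)$; $0$ otherwise; put $\kappa-1=\dim\ker\Omega_\pi$ and $2g=d-(\kappa-1)$. $T$ is of hyperbolic periodic type if it is self-similar and $M$ has $g$ simple real eigenvalues of modulus $>1$ and $g$ simple real eigenvalues of modulus $<1$, all with pairwise distinct moduli, and eigenvalue $1$ with $\kappa-1$ independent fixed vectors; so $\mathbb R^{\mathcal A}$ has a basis of right eigenvectors of $M$: $g$ expanding, $g$ contracting, $\kappa-1$ fixed. Convention: $N$ is replaced by a multiple so that all entries and all eigenvalues of $M$ are positive. **Types.** A vector $\omega$ with $\langle\omega,\lambda\rangle=0$ is of central-stable type if in its decomposition in the eigenbasis of $M$ at least one fixed but no expanding eigenvector occurs; then $\omega=\omega_c+\omega_s$ with $M\omega_c=\omega_c\ne0$ and $\omega_s$ a combination of contracting eigenvectors. **Conformal measures.** For $v\in\mathbb R^{\mathcal A}$, $\phi_v:[0,1)\to\mathbb R$ equals $v_\alpha$ on $I_\alpha$. A Borel probability $\nu$ on $[0,1)$ is $\phi_v$-conformal for $T$ if $T_*\nu\sim\nu$ and $\frac{d(T^{-1})_*\nu}{d\nu}=e^{\phi_v}$. **Notation in the formula.** $S_i\phi(x)=\sum_{0\le k<i}\phi(T^kx)$, which for $\phi=\phi_v$ and $0\le i\le q^{(N)}_\alpha$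 is constant on $I^{(N)}_\alpha$. $\beta(\alpha,i)$ is the unique letter with $T^iI^{(N)}_\alpha\subset I_{\beta(\alpha,i)}$. $M(v)$ is the positive matrix $M(v)_{\alpha\beta}=\sum_{0\le k<q^{(N)}_\alpha,\ \beta(\alpha,k)=\beta}e^{S_k\phi_v|_{I^{(N)}_\alpha}}$; $\rho_c$ is the logarithm of the Perron–Frobenius eigenvalue of $M(\omega_c)$, and $\ell^c,\theta^c\in\mathbb R^{\mathcal A}_{>0}$ are the left and right Perron–Frobenius eigenvectors of $M(\omega_c)$ normalized by $\sum_\alpha\ell^c_\alpha=1$, $\langle\ell^c,\theta^c\rangle=1$. **Dimension.** For a Borel probability $\mu$ on $\mathbb R$, $\dim_H(\mu)=\inf\{\dim_H(E): E\text{ Borel},\ \mu(E)=1\}$. *)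

theory Defs
  imports "HOL-Analysis.Analysis" "HOL-Computational_Algebra.Polynomial"
begin

section \<open>Interval exchange transformations\<close>

record ('a::finite) iet =
  pi_t :: "'a \<Rightarrow> nat"
  pi_b :: "'a \<Rightarrow> nat"
  len  :: "real ^ 'a"

text \<open>The alphabet is the finite type \<^typ>\<open>'a\<close>.\<close>

definition irreducible_perm :: "('a::finite \<Rightarrow> nat) \<Rightarrow> ('a \<Rightarrow> nat) \<Rightarrow> bool" where
  "irreducible_perm p q \<longleftrightarrow>
     bij_betw p UNIV {1..CARD('a)} \<and> bij_betw q UNIV {1..CARD('a)} \<and>
     (\<forall>k. 1 \<le> k \<and> k < CARD('a) \<longrightarrow> p -` {1..k} \<noteq> q -` {1..k})"

definition is_iet :: "'a::finite iet \<Rightarrow> bool" where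
  "is_iet T \<longleftrightarrow> CARD('a) \<ge> 2 \<and> irreducible_perm (pi_t T) (pi_b T) \<and> (\<forall>a. len T $ a > 0)"

definition iet_dom :: "'a::finite iet \<Rightarrow> real set" where
  "iet_dom T = {0 ..< (\<Sum>a\<in>UNIV. len T $ a)}"

definition left_t :: "'a::finite iet \<Rightarrow> 'a \<Rightarrow> real" where
  "left_t T a = (\<Sum>b | pi_t T b < pi_t T a. len T $ b)"

definition left_b :: "'a::finite iet \<Rightarrow> 'a \<Rightarrow> real" where
  "left_b T a = (\<Sum>b | pi_b T b < pi_b T a. len T $ b)"

definition iet_interval :: "'a::finite iet \<Rightarrow> 'a \<Rightarrow> real set" where
  "iet_interval T a = {left_t T a ..< left_t T a + len T $ a}"

text \<open>The function equal to \<open>v $ a\<close> on the interval with label \<open>a\<close>, and \<open>0\<close> outside the domain.\<close>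

definition step_fun :: "'a::finite iet \<Rightarrow> real ^ 'a \<Rightarrow> real \<Rightarrow> real" where
  "step_fun T v x = (\<Sum>a\<in>UNIV. v $ a * indicator (iet_interval T a) x)"

text \<open>The map is extended by the identity outside \<^term>\<open>iet_dom T\<close>, so that it is a bijection of
  the real line.\<close>

definition iet_map :: "'a::finite iet \<Rightarrow> real \<Rightarrow> real" where
  "iet_map T x = x + step_fun T (\<chi> a. left_b T a - left_t T a) x"

section \<open>Rauzy--Veech induction\<close>

definition return_time :: "('b \<Rightarrow> 'b) \<Rightarrow> 'b set \<Rightarrow> 'b \<Rightarrow> nat" where
  "return_time f A x = (LEAST n. 0 < n \<and> (f ^^ n) x \<in> A)"

definition first_return :: "('b \<Rightarrow> 'b) \<Rightarrow> 'b set \<Rightarrow> 'b \<Rightarrow> 'b" where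
  "first_return f A x = (f ^^ return_time f A x) x"

definition last_t :: "'a::finite iet \<Rightarrow> 'a" where
  "last_t T = inv (pi_t T) CARD('a)"

definition last_b :: "'a::finite iet \<Rightarrow> 'a" where
  "last_b T = inv (pi_b T) CARD('a)"

datatype rv_type = Top_Type | Bottom_Type

definition rv_defined :: "'a::finite iet \<Rightarrow> bool" where
  "rv_defined T \<longleftrightarrow> len T $ last_t T \<noteq> len T $ last_b T"

definition rv_type_of :: "'a::finite iet \<Rightarrow> rv_type" where
  "rv_type_of T = (if len T $ last_t T > len T $ last_b T then Top_Type else Bottom_Type)"

definition rv_winner :: "'a::finite iet \<Rightarrow> 'a" where
  "rv_winner T = (case rv_type_of T of Top_Type \<Rightarrow> last_t T | Bottom_Type \<Rightarrow> last_b T)"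

definition iet_preimage :: "'a::finite iet \<Rightarrow> real set \<Rightarrow> real set" where
  "iet_preimage T A = {x \<in> iet_dom T. iet_map T x \<in> A}"

definition rv_dom :: "'a::finite iet \<Rightarrow> real set" where
  "rv_dom T = (case rv_type_of T of
      Top_Type \<Rightarrow> iet_dom T - iet_map T ` iet_interval T (last_b T)
    | Bottom_Type \<Rightarrow> iet_dom T - iet_interval T (last_t T))"

definition rv_interval :: "'a::finite iet \<Rightarrow> 'a \<Rightarrow> real set" where
  "rv_interval T a = (case rv_type_of T of
      Top_Type \<Rightarrow>
        (if a = last_t T then iet_interval T a - iet_map T ` iet_interval T (last_b T)
         else iet_interval T a)
    | Bottom_Type \<Rightarrow>
        (if a = last_t T then iet_preimage T (iet_interval T (last_t T))
         else if a = last_b T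
         then iet_interval T a - iet_preimage T (iet_interval T (last_t T))
         else iet_interval T a))"

text \<open>When \<^term>\<open>rv_defined T\<close> holds, \<open>T'\<close> is determined by \<open>T\<close>: the intervals give \<open>pi_t\<close> and
  the lengths, the first return map gives \<open>pi_b\<close>.\<close>

definition rv_step :: "'a::finite iet \<Rightarrow> 'a iet \<Rightarrow> bool" where
  "rv_step T T' \<longleftrightarrow>
     rv_defined T \<and> is_iet T' \<and> iet_dom T' = rv_dom T \<and>
     (\<forall>a. iet_interval T' a = rv_interval T a) \<and>
     (\<forall>x\<in>rv_dom T. iet_map T' x = first_return (iet_map T) (rv_dom T) x)"

primrec rv_iter :: "'a::finite iet \<Rightarrow> nat \<Rightarrow> 'a iet" where
  "rv_iter T 0 = T"
| "rv_iter T (Suc n) = (THE T'. rv_step (rv_iter T n) T')"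

definition rv_infinite :: "'a::finite iet \<Rightarrow> bool" where
  "rv_infinite T \<longleftrightarrow> (\<forall>n. rv_defined (rv_iter T n))"

definition rotation_number :: "'a::finite iet \<Rightarrow> nat \<Rightarrow> (('a \<Rightarrow> nat) \<times> ('a \<Rightarrow> nat)) \<times> rv_type" where
  "rotation_number T n =
     ((pi_t (rv_iter T n), pi_b (rv_iter T n)), rv_type_of (rv_iter T n))"

definition infinity_complete :: "'a::finite iet \<Rightarrow> bool" where
  "infinity_complete T \<longleftrightarrow> (\<forall>a. \<exists>\<^sub>\<infinity>n. rv_winner (rv_iter T n) = a)"

definition rv_period :: "'a::finite iet \<Rightarrow> nat \<Rightarrow> bool" where
  "rv_period T N \<longleftrightarrow> 0 < N \<and> (\<forall>n. rotation_number T (n + N) = rotation_number T n)"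

definition self_similar :: "'a::finite iet \<Rightarrow> bool" where
  "self_similar T \<longleftrightarrow>
     is_iet T \<and> iet_dom T = {0..<1} \<and> rv_infinite T \<and> infinity_complete T \<and> (\<exists>N. rv_period T N)"

text \<open>The common return time to \<open>I\<^sup>(\<^sup>N\<^sup>)\<close>, under the map \<open>T\<close>, of the points of the interval with
  label \<open>a\<close> of the \<open>N\<close>-th induced transformation.\<close>

definition rv_time :: "'a::finite iet \<Rightarrow> nat \<Rightarrow> 'a \<Rightarrow> nat" where
  "rv_time T N a = (THE q. \<forall>x \<in> iet_interval (rv_iter T N) a.
     return_time (iet_map T) (iet_dom (rv_iter T N)) x = q)"

definition tower_letter :: "'a::finite iet \<Rightarrow> nat \<Rightarrow> 'a \<Rightarrow> nat \<Rightarrow> 'a" where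
  "tower_letter T N a i =
     (THE b. (iet_map T ^^ i) ` iet_interval (rv_iter T N) a \<subseteq> iet_interval T b)"

definition self_sim_matrix :: "'a::finite iet \<Rightarrow> nat \<Rightarrow> real ^ 'a ^ 'a" where
  "self_sim_matrix T N = (\<chi> a b. real (card {k. k < rv_time T N a \<and>
     (iet_map T ^^ k) ` iet_interval (rv_iter T N) a \<subseteq> iet_interval T b}))"

section \<open>Eigenvalues and Perron--Frobenius data\<close>

definition mat_eigenvalue :: "'b::field ^ 'n ^ 'n \<Rightarrow> 'b \<Rightarrow> bool" where
  "mat_eigenvalue A c \<longleftrightarrow> (\<exists>v. v \<noteq> 0 \<and> A *v v = c *s v)"

definition mat_charpoly :: "'b::field ^ 'n ^ 'n \<Rightarrow> 'b poly" where
  "mat_charpoly A = det (mat [:0, 1:] - (\<chi> i j. [:A $ i $ j:]))"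

definition simple_eigenvalue :: "'b::field ^ 'n ^ 'n \<Rightarrow> 'b \<Rightarrow> bool" where
  "simple_eigenvalue A c \<longleftrightarrow> mat_eigenvalue A c \<and> order c (mat_charpoly A) = 1"

text \<open>For a matrix with positive entries: the real eigenvalue equal to the spectral radius.\<close>

definition pf_eigenvalue :: "real ^ 'n ^ 'n \<Rightarrow> real" where
  "pf_eigenvalue A = (THE r. mat_eigenvalue A r \<and>
     (\<forall>z. mat_eigenvalue (\<chi> i j. complex_of_real (A $ i $ j)) z \<longrightarrow> cmod z \<le> r))"

text \<open>The pair (left, right) of positive eigenvectors, normalized by total mass \<open>1\<close> of the left one
  and inner product \<open>1\<close>.\<close>

definition pf_vectors :: "real ^ 'n ^ 'n \<Rightarrow> (real ^ 'n) \<times> (real ^ 'n)" where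
  "pf_vectors A = (THE (l, th).
     (\<forall>a. l $ a > 0) \<and> (\<forall>a. th $ a > 0) \<and>
     l v* A = pf_eigenvalue A *s l \<and> A *v th = pf_eigenvalue A *s th \<and>
     (\<Sum>a\<in>UNIV. l $ a) = 1 \<and> l \<bullet> th = 1)"

section \<open>Hyperbolic periodic type and central-stable vectors\<close>

definition Omega :: "'a::finite iet \<Rightarrow> real ^ 'a ^ 'a" where
  "Omega T = (\<chi> a b.
     if pi_b T a > pi_b T b \<and> pi_t T a < pi_t T b then 1
     else if pi_b T a < pi_b T b \<and> pi_t T a > pi_t T b then -1 else 0)"

text \<open>This is \<open>\<kappa> - 1\<close>.\<close>

definition null_dim :: "'a::finite iet \<Rightarrow> nat" where
  "null_dim T = dim {v. Omega T *v v = 0}"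

text \<open>The division is exact because \<^term>\<open>Omega T\<close> is antisymmetric.\<close>

definition genus :: "'a::finite iet \<Rightarrow> nat" where
  "genus T = (CARD('a) - null_dim T) div 2"

definition hyperbolic_spectrum :: "'a::finite iet \<Rightarrow> real ^ 'a ^ 'a \<Rightarrow> bool" where
  "hyperbolic_spectrum T M \<longleftrightarrow>
     (let E = {c. mat_eigenvalue M c \<and> \<bar>c\<bar> > 1}; C = {c. mat_eigenvalue M c \<and> \<bar>c\<bar> < 1} in
        card E = genus T \<and> card C = genus T \<and>
        (\<forall>c \<in> E \<union> C. simple_eigenvalue M c) \<and> inj_on abs (E \<union> C) \<and>
        dim {v. M *v v = v} = null_dim T)"

text \<open>The last two conditions are the normalization of the period \<open>N\<close>, which can always be achieved
  by passing to a multiple. All eigenvalues are real, since those described by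
  \<^const>\<open>hyperbolic_spectrum\<close> have total multiplicity \<open>2 g + \<kappa> - 1 = d\<close>.\<close>

definition hyperbolic_periodic_type :: "'a::finite iet \<Rightarrow> nat \<Rightarrow> bool" where
  "hyperbolic_periodic_type T N \<longleftrightarrow>
     self_similar T \<and> rv_period T N \<and> hyperbolic_spectrum T (self_sim_matrix T N) \<and>
     (\<forall>a b. self_sim_matrix T N $ a $ b > 0) \<and>
     (\<forall>c. mat_eigenvalue (self_sim_matrix T N) c \<longrightarrow> c > 0)"

text \<open>\<open>wu\<close>, \<open>wc\<close>, \<open>ws\<close> are the parts of \<open>w\<close> carried by the expanding, fixed and contracting
  vectors of an eigenbasis of \<open>M\<close>.\<close>

definition spectral_decomp ::
    "real ^ 'n ^ 'n \<Rightarrow> real ^ 'n \<Rightarrow> real ^ 'n \<Rightarrow> real ^ 'n \<Rightarrow> real ^ 'n \<Rightarrow> bool" where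
  "spectral_decomp M w wu wc ws \<longleftrightarrow>
     w = wu + wc + ws \<and>
     wu \<in> span {v. \<exists>c. \<bar>c\<bar> > 1 \<and> M *v v = c *s v} \<and>
     M *v wc = wc \<and>
     ws \<in> span {v. \<exists>c. \<bar>c\<bar> < 1 \<and> M *v v = c *s v}"

definition central_stable_type :: "'a::finite iet \<Rightarrow> nat \<Rightarrow> real ^ 'a \<Rightarrow> bool" where
  "central_stable_type T N w \<longleftrightarrow>
     w \<bullet> len T = 0 \<and>
     (\<exists>wu wc ws. spectral_decomp (self_sim_matrix T N) w wu wc ws \<and> wu = 0 \<and> wc \<noteq> 0)"

definition central_part :: "real ^ 'n ^ 'n \<Rightarrow> real ^ 'n \<Rightarrow> real ^ 'n" where
  "central_part M w = (THE wc. \<exists>wu ws. spectral_decomp M w wu wc ws)"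

section \<open>Conformal measures\<close>

definition conformal_measure :: "'a::finite iet \<Rightarrow> real ^ 'a \<Rightarrow> real measure \<Rightarrow> bool" where
  "conformal_measure T v \<nu> \<longleftrightarrow>
     sets \<nu> = sets borel \<and> emeasure \<nu> UNIV = 1 \<and> emeasure \<nu> {0..<1} = 1 \<and>
     absolutely_continuous \<nu> (distr \<nu> borel (iet_map T)) \<and>
     absolutely_continuous (distr \<nu> borel (iet_map T)) \<nu> \<and>
     distr \<nu> borel (inv (iet_map T)) = density \<nu> (\<lambda>x. ennreal (exp (step_fun T v x)))"

section \<open>Hausdorff dimension\<close>

text \<open>The case distinction makes the gauge of a nonempty set \<open>1\<close> for \<open>s = 0\<close> (in contrast to
  \<open>0 powr 0 = 0\<close>); boundedness of the covering sets is required below because \<^const>\<open>diameter\<close> is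
  meaningless for unbounded sets.\<close>

definition diam_gauge :: "real \<Rightarrow> 'b::metric_space set \<Rightarrow> ennreal" where
  "diam_gauge s U =
     (if U = {} then 0 else if s = 0 then 1 else ennreal (diameter U powr s))"

definition hausdorff_content :: "real \<Rightarrow> real \<Rightarrow> 'b::metric_space set \<Rightarrow> ennreal" where
  "hausdorff_content s \<delta> E =
     (INF U \<in> {U :: nat \<Rightarrow> 'b set. E \<subseteq> (\<Union>i. U i) \<and> (\<forall>i. bounded (U i) \<and> diameter (U i) \<le> \<delta>)}.
        \<Sum>i. diam_gauge s (U i))"

definition hausdorff_measure :: "real \<Rightarrow> 'b::metric_space set \<Rightarrow> ennreal" where
  "hausdorff_measure s E = (SUP \<delta> \<in> {0<..}. hausdorff_content s \<delta> E)"

definition hausdorff_dim :: "'b::metric_space set \<Rightarrow> ereal" where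
  "hausdorff_dim E = Inf (ereal ` {s. 0 \<le> s \<and> hausdorff_measure s E = 0})"

definition hausdorff_dim_measure :: "real measure \<Rightarrow> ereal" where
  "hausdorff_dim_measure \<mu> = (INF E \<in> {E. E \<in> sets borel \<and> emeasure \<mu> E = 1}. hausdorff_dim E)"

section \<open>The entropy-like quantity\<close>

definition birkhoff_sum :: "('b \<Rightarrow> 'b) \<Rightarrow> nat \<Rightarrow> ('b \<Rightarrow> real) \<Rightarrow> 'b \<Rightarrow> real" where
  "birkhoff_sum f i \<phi> x = (\<Sum>k<i. \<phi> ((f ^^ k) x))"

text \<open>The constant value of the \<open>i\<close>-th Birkhoff sum of \<^term>\<open>step_fun T v\<close> on the interval with
  label \<open>a\<close> of the \<open>N\<close>-th induced transformation, for \<open>i \<le> rv_time T N a\<close>.\<close>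

definition tower_sum :: "'a::finite iet \<Rightarrow> nat \<Rightarrow> real ^ 'a \<Rightarrow> 'a \<Rightarrow> nat \<Rightarrow> real" where
  "tower_sum T N v a i = (THE c. \<forall>x \<in> iet_interval (rv_iter T N) a.
     birkhoff_sum (iet_map T) i (step_fun T v) x = c)"

definition twisted_matrix :: "'a::finite iet \<Rightarrow> nat \<Rightarrow> real ^ 'a \<Rightarrow> real ^ 'a ^ 'a" where
  "twisted_matrix T N v = (\<chi> a b.
     \<Sum>k | k < rv_time T N a \<and> tower_letter T N a k = b. exp (tower_sum T N v a k))"

definition rho_T :: "'a::finite iet \<Rightarrow> nat \<Rightarrow> real" where
  "rho_T T N = ln (pf_eigenvalue (self_sim_matrix T N))"

definition entropy_H :: "'a::finite iet \<Rightarrow> nat \<Rightarrow> real ^ 'a \<Rightarrow> real" where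
  "entropy_H T N w =
     (let wc = central_part (self_sim_matrix T N) w;
          A = twisted_matrix T N wc;
          \<rho>c = ln (pf_eigenvalue A);
          l = fst (pf_vectors A);
          th = snd (pf_vectors A)
      in \<rho>c - (\<Sum>a\<in>UNIV. \<Sum>i<rv_time T N a.
            th $ tower_letter T N a i * exp (- \<rho>c) * l $ a *
            exp (tower_sum T N wc a i) * tower_sum T N wc a i))"

end

theory Submission
  imports Defs
begin

text \<open>
  One period of Rauzy--Veech induction is encoded by a word \<open>W a\<close> for each letter, the itinerary of
  the \<open>a\<close>-th induced interval; iterating the substitution \<open>W\<close> gives, at level \<open>n\<close>, a partition of the
  domain into intervals of length comparable to \<open>exp (- n \<rho>\<^sub>T)\<close>. By conformality the measure of such a
  cylinder is a Birkhoff weight times the measure of an induced interval, so the sum of the \<open>s\<close>-th powers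
  of the measures of the level-\<open>n\<close> cylinders is governed by the matrices twisted by \<open>s M\<^sup>k \<omega>\<close>, which
  converge to the matrix twisted by \<open>s \<omega>\<^sub>c\<close>. First-order perturbation of the Perron--Frobenius eigenvalue
  at \<open>s = 1\<close> shows that these sums grow like \<open>exp (n ((1 - s) H + o(s - 1)))\<close>. A Chernoff bound then says
  that up to exponentially small mass all cylinders have measure about \<open>exp (- n H)\<close>, whence the
  dimension is \<open>H / \<rho>\<^sub>T\<close>. Finally \<open>H\<close> is the entropy of a Markov chain on the letters, and
  \<open>0 < H < \<rho>\<^sub>T\<close> follows from Gibbs' inequality, whose equality case would force \<open>\<omega>\<^sub>c = 0\<close>.
\<close>

section \<open>Perron--Frobenius theory of positive matrices\<close>

text \<open>The obstacle is that \<omega> itself is not fixed by \<open>M\<close>: the twisted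
  matrices change with the level and only converge, so no eigenvector gives exact weights. Growth
  bounds for the measures therefore carry an arbitrarily small exponential loss, and only upper
  bounds on the sums of \<open>s\<close>-th powers are used: \<open>s\<close> just below 1 controls
  very light cylinders, \<open>s\<close> just above 1 very heavy ones. The Perron eigenvalue is
  never differentiated. Instead \<open>th + (s - 1) g\<close>, with \<open>g\<close> solving a
  Fredholm equation, is an approximate eigenvector, and a positive \<open>x\<close> with
  \<open>A x <= c x\<close> bounds the growth of products of matrices close to \<open>A\<close>.
  Lengths are the same problem for the vector 0, where all matrices coincide and the bounds are
  sharp up to constants. The definite descriptions in the definitions (induced exchange, return
  times, Perron data, central part) are evaluated through uniqueness. The equality case of
  \<open>H < \<rho>\<^sub>T\<close> needs dynamics: induced domains shrink to their common left
  endpoint 0, so all iterated words eventually share their first letter.\<close>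

lemma matrix_vector_component: "((A::real^'n^'m) *v x) $ i = (\<Sum>j\<in>UNIV. A $ i $ j * x $ j)"
  by (simp add: matrix_vector_mult_def)

lemma matrix_vector_pos:
  fixes A :: "real^'n^'m"
  assumes "\<And>i j. 0 < A $ i $ j" "\<And>j. 0 \<le> x $ j" "x \<noteq> 0"
  shows "0 < (A *v x) $ i"
proof -
  obtain j where "x $ j \<noteq> 0" using assms(3) by (auto simp: vec_eq_iff)
  then have "0 < x $ j" using assms(2)[of j] by simp
  then show ?thesis unfolding matrix_vector_component
    using assms by (intro sum_pos2[of _ j]) (auto intro!: mult_nonneg_nonneg simp: less_imp_le)
qed

text \<open>Brouwer's theorem for the normalized map on the standard simplex. The fixed point is
  strictly positive because \<open>A\<close> sends every nonzero nonnegative vector to a positive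
  one.\<close>

lemma pf_right_exists:
  fixes A :: "real^'n^'n"
  assumes pos: "\<And>i j. 0 < A $ i $ j"
  shows "\<exists>r x. 0 < r \<and> (\<forall>i. 0 < x $ i) \<and> A *v x = r *s x"
proof -
  define S :: "(real^'n) set" where "S = {x. (\<forall>i. 0 \<le> x $ i) \<and> (\<Sum>i\<in>UNIV. x $ i) = 1}"
  define f where "f x = (1 / (\<Sum>i\<in>UNIV. (A *v x) $ i)) *\<^sub>R (A *v x)" for x
  have le1: "x $ i \<le> 1" if "x \<in> S" for x i
    using that member_le_sum[of i UNIV "\<lambda>i. x $ i"] by (auto simp: S_def)
  have bd: "bounded S"
  proof (rule boundedI)
    fix x assume x: "x \<in> S"
    have "norm x \<le> (\<Sum>i\<in>UNIV. \<bar>x $ i\<bar>)" by (rule norm_le_l1_cart)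
    also have "\<dots> = 1" using x by (simp add: S_def)
    finally show "norm x \<le> 1" .
  qed
  have cl: "closed S"
  proof -
    have "S = (\<Inter>i. {x. 0 \<le> x $ i}) \<inter> {x. (\<Sum>i\<in>UNIV. x $ i) = 1}" by (auto simp: S_def)
    then show ?thesis
      by (auto intro!: closed_Int closed_INT closed_Collect_le closed_Collect_eq continuous_intros)
  qed
  have nz: "x \<noteq> 0" if "x \<in> S" for x using that by (auto simp: S_def)
  have Apos: "0 < (A *v x) $ i" if "x \<in> S" for x i
    using matrix_vector_pos[OF pos, of x i] nz[OF that] that by (auto simp: S_def)
  have spos: "0 < (\<Sum>i\<in>UNIV. (A *v x) $ i)" if "x \<in> S" for x
    using Apos[OF that] by (intro sum_pos) auto
  have cv: "convex S"
  proof (rule convexI)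
    fix x y :: "real^'n" and u v :: real
    assume "x \<in> S" "y \<in> S" "0 \<le> u" "0 \<le> v" "u + v = 1"
    then show "u *\<^sub>R x + v *\<^sub>R y \<in> S"
      by (auto simp: S_def sum.distrib sum_distrib_left[symmetric])
  qed
  have ne: "S \<noteq> {}"
  proof -
    have "(\<chi> i. 1 / real CARD('n)) \<in> S" by (auto simp: S_def)
    then show ?thesis by blast
  qed
  have cont: "continuous_on S f"
  proof -
    have "continuous_on S (\<lambda>x. A *v x)"
      by (intro linear_continuous_on_compose[OF continuous_on_id, unfolded id_def]) auto
    then show ?thesis unfolding f_def using spos
      by (intro continuous_intros) force+
  qed
  have maps: "f \<in> S \<rightarrow> S"
  proof
    fix x assume x: "x \<in> S"
    then show "f x \<in> S"
      using Apos[OF x] spos[OF x] by (auto simp: S_def f_def sum_divide_distrib[symmetric] less_imp_le)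
  qed
  obtain x where x: "x \<in> S" "f x = x"
    using brouwer[of S f] bd cl cv ne cont maps compact_eq_bounded_closed by blast
  define r where "r = (\<Sum>i\<in>UNIV. (A *v x) $ i)"
  have r: "0 < r" using spos[OF x(1)] by (simp add: r_def)
  have eq: "A *v x = r *s x"
  proof -
    have "r *\<^sub>R f x = A *v x" using r by (simp add: f_def r_def[symmetric])
    then show ?thesis by (simp add: x(2) scalar_mult_eq_scaleR)
  qed
  have "0 < x $ i" for i using Apos[OF x(1), of i] r eq by (simp add: zero_less_mult_iff)
  then show ?thesis using r eq by blast
qed

text \<open>The left vector is a right eigenvector of the transpose. Evaluating the pairing of
  \<open>y\<close> with \<open>A *v x\<close> in both ways shows that the two eigenvalues
  agree.\<close>

lemma pf_triple_exists:
  fixes A :: "real^'n^'n"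
  assumes pos: "\<And>i j. 0 < A $ i $ j"
  shows "\<exists>r l th. 0 < r \<and> (\<forall>i. 0 < l $ i) \<and> (\<forall>i. 0 < th $ i) \<and>
     l v* A = r *s l \<and> A *v th = r *s th \<and> (\<Sum>i\<in>UNIV. l $ i) = 1 \<and> l \<bullet> th = 1"
proof -
  obtain r x where x: "0 < r" "\<And>i. 0 < x $ i" "A *v x = r *s x"
    using pf_right_exists[OF pos] by blast
  obtain r' y where y: "0 < r'" "\<And>i. 0 < y $ i" "transpose A *v y = r' *s y"
    using pf_right_exists[of "transpose A"] pos by (auto simp: transpose_def)
  have yA: "y v* A = r' *s y" using y(3) by simp
  have yx: "0 < y \<bullet> x" unfolding inner_vec_def using x y by (intro sum_pos) auto
  have "(y v* A) \<bullet> x = y \<bullet> (A *v x)" by (rule dot_lmul_matrix)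
  then have "r' * (y \<bullet> x) = r * (y \<bullet> x)" by (simp add: yA x(3) scalar_mult_eq_scaleR)
  then have rr: "r' = r" using yx by simp
  define s where "s = (\<Sum>i\<in>UNIV. y $ i)"
  have s: "0 < s" unfolding s_def using y by (intro sum_pos) auto
  define l where "l = (1 / s) *\<^sub>R y"
  define th where "th = (s / (y \<bullet> x)) *\<^sub>R x"
  have lA: "l v* A = r *s l"
    using yA rr by (simp add: l_def scalar_mult_eq_scaleR vec_eq_iff vector_matrix_mult_def
       sum_divide_distrib[symmetric])
  have At: "A *v th = r *s th"
    using x(3) by (simp add: th_def scalar_mult_eq_scaleR matrix_vector_mult_scaleR)
  have "(\<Sum>i\<in>UNIV. l $ i) = 1" using s by (simp add: l_def s_def sum_divide_distrib[symmetric])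
  moreover have "l \<bullet> th = 1" using s yx by (simp add: l_def th_def)
  ultimately show ?thesis using x y s yx lA At
    by (intro exI[of _ r] exI[of _ l] exI[of _ th]) (auto simp: l_def th_def)
qed

text \<open>Subtract from \<open>x\<close> the largest multiple of \<open>th\<close> lying below it.
  The remainder is nonnegative with a zero coordinate; were it nonzero, \<open>A\<close> would make
  that coordinate positive.\<close>

lemma pf_right_unique:
  fixes A :: "real^'n^'n"
  assumes pos: "\<And>i j. 0 < A $ i $ j"
    and th: "\<And>i. 0 < th $ i" "A *v th = r *s th" and x: "A *v x = r *s x"
  shows "\<exists>c. x = c *\<^sub>R th"
proof -
  define c where "c = Min (range (\<lambda>i. x $ i / th $ i))"
  have "c \<in> range (\<lambda>i. x $ i / th $ i)" unfolding c_def by (intro Min_in) auto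
  then obtain i where i: "c = x $ i / th $ i" by auto
  have cle: "c \<le> x $ j / th $ j" for j unfolding c_def by (intro Min_le) auto
  have cth: "c * th $ j \<le> x $ j" for j using th(1)[of j] cle[of j] by (simp add: pos_le_divide_eq)
  define y where "y = x - c *\<^sub>R th"
  have y0: "0 \<le> y $ j" for j using cth by (simp add: y_def)
  have yi: "y $ i = 0" using th(1)[of i] by (simp add: y_def i)
  have "A *v y = r *\<^sub>R y"
    by (simp add: y_def matrix_vector_mult_diff_distrib matrix_vector_mult_scaleR x th
        scalar_mult_eq_scaleR algebra_simps)
  then have "(A *v y) $ i = 0" using yi by simp
  then have "y = 0" using matrix_vector_pos[OF pos, of y i] y0 by fastforce
  then show ?thesis by (auto simp: y_def)
qed

text \<open>The triangle inequality gives \<open>cmod z * u <= A u\<close> for the vector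
  \<open>u\<close> of moduli; pairing with the positive left eigenvector compares
  \<open>cmod z\<close> with \<open>r\<close>.\<close>

lemma pf_eigenvalue_bound:
  fixes A :: "real^'n^'n"
  assumes pos: "\<And>i j. 0 < A $ i $ j"
    and l: "\<And>i. 0 < l $ i" "l v* A = r *s l"
    and z: "mat_eigenvalue (\<chi> i j. complex_of_real (A $ i $ j)) z"
  shows "cmod z \<le> r"
proof -
  obtain v where v: "v \<noteq> 0" "(\<chi> i j. complex_of_real (A $ i $ j)) *v v = z *s v"
    using z by (auto simp: mat_eigenvalue_def)
  define u :: "real^'n" where "u = (\<chi> i. cmod (v $ i))"
  have le: "cmod z * u $ i \<le> (A *v u) $ i" for i
  proof -
    have "cmod z * u $ i = cmod ((z *s v) $ i)" by (simp add: u_def norm_mult)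
    also have "(z *s v) $ i = (\<Sum>j\<in>UNIV. complex_of_real (A $ i $ j) * v $ j)"
      unfolding v(2)[symmetric] by (simp add: matrix_vector_mult_def)
    also have "cmod \<dots> \<le> (\<Sum>j\<in>UNIV. cmod (complex_of_real (A $ i $ j) * v $ j))"
      by (rule norm_sum)
    also have "\<dots> = (A *v u) $ i"
      using pos by (simp add: matrix_vector_component u_def norm_mult less_imp_le)
    finally show ?thesis .
  qed
  have "cmod z * (l \<bullet> u) = (\<Sum>i\<in>UNIV. l $ i * (cmod z * u $ i))"
    by (simp add: inner_vec_def sum_distrib_left mult_ac)
  also have "\<dots> \<le> (\<Sum>i\<in>UNIV. l $ i * (A *v u) $ i)"
    using l(1) le by (intro sum_mono mult_left_mono) (auto intro: less_imp_le)
  also have "\<dots> = l \<bullet> (A *v u)" by (simp add: inner_vec_def)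
  also have "\<dots> = r * (l \<bullet> u)" by (simp add: dot_lmul_matrix[symmetric] l scalar_mult_eq_scaleR)
  finally have *: "cmod z * (l \<bullet> u) \<le> r * (l \<bullet> u)" .
  obtain j where "v $ j \<noteq> 0" using v(1) by (auto simp: vec_eq_iff)
  then have "0 < l \<bullet> u" unfolding inner_vec_def
    using l(1) by (intro sum_pos2[of _ j]) (auto simp: u_def less_imp_le)
  then show ?thesis using * by simp
qed

lemma pf_eigenvalue_eqI:
  fixes A :: "real^'n^'n"
  assumes pos: "\<And>i j. 0 < A $ i $ j"
    and l: "\<And>i. 0 < l $ i" "l v* A = r *s l"
    and th: "\<And>i. 0 < th $ i" "A *v th = r *s th"
  shows "pf_eigenvalue A = r"
  unfolding pf_eigenvalue_def
proof (rule the_equality)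
  have th0: "th \<noteq> 0" using th(1) by (metis less_irrefl zero_index)
  have e: "mat_eigenvalue A r"
    unfolding mat_eigenvalue_def using th(2) th0 by (intro exI[of _ th] conjI)
  show "mat_eigenvalue A r \<and>
     (\<forall>z. mat_eigenvalue (\<chi> i j. complex_of_real (A $ i $ j)) z \<longrightarrow> cmod z \<le> r)"
    by (intro conjI allI impI e) (rule pf_eigenvalue_bound[OF pos l])
  have cplx: "mat_eigenvalue (\<chi> i j. complex_of_real (A $ i $ j)) (complex_of_real s)"
    if ev: "mat_eigenvalue A s" for s
  proof -
    obtain v where v: "v \<noteq> 0" "A *v v = s *s v" using ev unfolding mat_eigenvalue_def by blast
    have "(\<Sum>j\<in>UNIV. complex_of_real (A $ i $ j) * complex_of_real (v $ j)) = 
       complex_of_real s * complex_of_real (v $ i)" for i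
      using arg_cong[OF v(2), of "\<lambda>w. complex_of_real (w $ i)"] by (simp add: matrix_vector_component)
    then show ?thesis using v(1) unfolding mat_eigenvalue_def
      by (intro exI[of _ "\<chi> i. complex_of_real (v $ i)"])
         (auto simp: vec_eq_iff matrix_vector_mult_def)
  qed
  fix s assume s: "mat_eigenvalue A s \<and>
     (\<forall>z. mat_eigenvalue (\<chi> i j. complex_of_real (A $ i $ j)) z \<longrightarrow> cmod z \<le> s)"
  have "\<bar>r\<bar> \<le> s" using s cplx[OF e] by (metis norm_of_real)
  moreover have "\<bar>s\<bar> \<le> r" using pf_eigenvalue_bound[OF pos l cplx[of s]] s by simp
  ultimately show "s = r" by linarith
qed

lemma pf_spec:
  fixes A :: "real^'n^'n"
  assumes pos: "\<And>i j. 0 < A $ i $ j"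
  defines "r \<equiv> pf_eigenvalue A" and "l \<equiv> fst (pf_vectors A)" and "th \<equiv> snd (pf_vectors A)"
  shows "0 < r" "\<And>i. 0 < l $ i" "\<And>i. 0 < th $ i" "l v* A = r *s l" "A *v th = r *s th"
    "(\<Sum>i\<in>UNIV. l $ i) = 1" "l \<bullet> th = 1"
proof -
  obtain r' l' th' where p: "0 < r'" "\<And>i. 0 < l' $ i" "\<And>i. 0 < th' $ i"
    "l' v* A = r' *s l'" "A *v th' = r' *s th'" "(\<Sum>i\<in>UNIV. l' $ i) = 1" "l' \<bullet> th' = 1"
    using pf_triple_exists[OF pos] by blast
  have r: "r = r'" unfolding r_def by (rule pf_eigenvalue_eqI[OF pos p(2,4,3,5)])
  have "pf_vectors A = (l', th')" unfolding pf_vectors_def r_def[symmetric]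
  proof (rule the_equality)
    show "case (l', th') of (l, th) \<Rightarrow> (\<forall>a. 0 < l $ a) \<and> (\<forall>a. 0 < th $ a) \<and> l v* A = r *s l \<and>
      A *v th = r *s th \<and> sum (($) l) UNIV = 1 \<and> l \<bullet> th = 1"
      using p r by simp
    fix y assume y: "case y of (l, th) \<Rightarrow> (\<forall>a. 0 < l $ a) \<and> (\<forall>a. 0 < th $ a) \<and> l v* A = r *s l \<and>
      A *v th = r *s th \<and> sum (($) l) UNIV = 1 \<and> l \<bullet> th = 1"
    obtain a b where ab: "y = (a, b)" by (cases y)
    have "\<exists>c. b = c *\<^sub>R th'"
      using y ab by (intro pf_right_unique[OF pos p(3) p(5)]) (simp add: r)
    then obtain c where c: "b = c *\<^sub>R th'" by blast
    have "\<exists>c. a = c *\<^sub>R l'"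
      using y ab p by (intro pf_right_unique[of "transpose A" l' r']) (simp_all add: transpose_def[of A] pos r
        flip: transpose_matrix_vector)
    then obtain c' where c': "a = c' *\<^sub>R l'" by blast
    have "c' = 1" using y ab p(6) by (simp add: c' sum_distrib_left[symmetric])
    moreover then have "c = 1" using y ab p(7) c c' by simp
    ultimately show "y = (l', th')" using ab c c' by simp
  qed
  then show "0 < r" "\<And>i. 0 < l $ i" "\<And>i. 0 < th $ i" "l v* A = r *s l" "A *v th = r *s th"
    "(\<Sum>i\<in>UNIV. l $ i) = 1" "l \<bullet> th = 1"
    using p r by (simp_all add: l_def th_def)
qed

text \<open>The operator \<open>r - A\<close> is made injective by adding the rank-one map
  \<open>(l \<bullet> v) th\<close>. Pairing with \<open>l\<close> is preserved by the sum, so for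
  \<open>y\<close> orthogonal to \<open>l\<close> the solution is orthogonal to \<open>l\<close> too
  and the added term vanishes.\<close>

lemma pf_fredholm:
  fixes A :: "real^'n^'n"
  assumes pos: "\<And>i j. 0 < A $ i $ j"
    and l: "l v* A = r *s l"
    and th: "\<And>i. 0 < th $ i" "A *v th = r *s th" and lth: "l \<bullet> th = 1"
    and y: "l \<bullet> y = 0"
  shows "\<exists>g. r *\<^sub>R g - A *v g = y"
proof -
  define B where "B v = r *\<^sub>R v - A *v v + (l \<bullet> v) *\<^sub>R th" for v
  have lin: "linear B"
    unfolding B_def by (intro linearI) (simp_all add: algebra_simps matrix_vector_mult_scaleR
      inner_add_right matrix_vector_right_distrib)
  have lB: "l \<bullet> B v = l \<bullet> v" for v
    by (simp add: B_def inner_add_right inner_diff_right dot_lmul_matrix[symmetric] l lth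
        scalar_mult_eq_scaleR)
  have "inj B"
  proof (subst linear_injective_0[OF lin], intro allI impI)
    fix v assume v: "B v = 0"
    then have "l \<bullet> v = 0" using lB[of v] by simp
    then have "A *v v = r *s v" using v by (simp add: B_def scalar_mult_eq_scaleR)
    then obtain c where c: "v = c *\<^sub>R th" using pf_right_unique[OF pos th] by blast
    then show "v = 0" using \<open>l \<bullet> v = 0\<close> lth by simp
  qed
  then have "surj B" using lin by (simp add: linear_injective_imp_surjective)
  then obtain g where g: "B g = y" by (metis surjD)
  then have "l \<bullet> g = 0" using lB[of g] y by simp
  then show ?thesis using g by (auto simp: B_def)
qed

section \<open>Isolating the fixed component of a vector\<close>

text \<open>Polynomials in \<open>M\<close> without the factor \<open>M - 1\<close> kill the non-fixed parts but act as a
  nonzero scalar on fixed vectors.\<close>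

definition fixed_filter :: "real^'n^'n \<Rightarrow> (real^'n^'n) set" where
  "fixed_filter M = {L. (\<forall>B. B ** M = M ** B \<longrightarrow> L ** B = B ** L) \<and>
     (\<exists>k. k \<noteq> 0 \<and> (\<forall>w. M *v w = w \<longrightarrow> L *v w = k *\<^sub>R w))}"

lemma fixed_filter_mult:
  assumes "L \<in> fixed_filter M" "K \<in> fixed_filter M" shows "L ** K \<in> fixed_filter M"
proof -
  obtain k where k: "k \<noteq> 0" "\<And>w. M *v w = w \<Longrightarrow> L *v w = k *\<^sub>R w"
    using assms(1) by (auto simp: fixed_filter_def)
  obtain k' where k': "k' \<noteq> 0" "\<And>w. M *v w = w \<Longrightarrow> K *v w = k' *\<^sub>R w"
    using assms(2) by (auto simp: fixed_filter_def)
  have "(L ** K) ** B = B ** (L ** K)" if "B ** M = M ** B" for B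
  proof -
    have "L ** B = B ** L" "K ** B = B ** K" using assms that by (auto simp: fixed_filter_def)
    then show ?thesis by (metis matrix_mul_assoc)
  qed
  moreover have "(L ** K) *v w = (k' * k) *\<^sub>R w" if "M *v w = w" for w
    using k k' that by (simp add: matrix_vector_mul_assoc[symmetric] matrix_vector_mult_scaleR)
  ultimately show ?thesis using k k' unfolding fixed_filter_def
    by (auto intro!: exI[of _ "k' * k"])
qed

text \<open>The set is phrased through the bicommutant of \<open>M\<close> instead of through
  polynomials: \<open>K\<close> commutes with \<open>M\<close>, so \<open>L\<close> commutes with
  \<open>K\<close>.\<close>

lemma fixed_filter_commute:
  assumes "L \<in> fixed_filter M" "K \<in> fixed_filter M" shows "L ** K = K ** L"
proof -
  have "K ** M = M ** K" using assms(2) unfolding fixed_filter_def by blast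
  then show ?thesis using assms(1) unfolding fixed_filter_def by blast
qed

text \<open>Each eigenvector for \<open>c\<close> is killed by \<open>M - c\<close>, which acts on
  fixed vectors as \<open>1 - c\<close>, nonzero. Products of such factors handle linear
  combinations.\<close>

lemma fixed_filter_kills:
  fixes M :: "real^'n^'n"
  assumes "v \<in> span {v. \<exists>c. c \<noteq> 1 \<and> M *v v = c *s v}"
  shows "\<exists>L\<in>fixed_filter M. L *v v = 0"
  using assms
proof (induction rule: span_induct_alt)
  case base
  have "mat 1 \<in> fixed_filter M" by (auto simp: fixed_filter_def intro!: exI[of _ "1::real"])
  then show ?case by (intro bexI[of _ "mat 1"]) auto
next
  case (step a x y)
  obtain L where L: "L \<in> fixed_filter M" "L *v y = 0" using step by blast
  obtain c where c: "c \<noteq> 1" "M *v x = c *s x" using step by blast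
  define K where "K = M - c *\<^sub>R mat 1"
  have K: "K *v w = M *v w - c *\<^sub>R w" for w
    by (simp add: K_def matrix_vector_mult_diff_rdistrib scaleR_matrix_vector_assoc[symmetric])
  have comm: "K ** B = B ** K" if "B ** M = M ** B" for B
  proof -
    have "K ** B *v w = B ** K *v w" for w
      using that by (simp add: matrix_vector_mul_assoc[symmetric] K matrix_vector_mult_diff_distrib
          matrix_vector_mult_scaleR) (simp add: matrix_vector_mul_assoc)
    then show ?thesis by (simp add: matrix_eq)
  qed
  have KF: "K \<in> fixed_filter M" unfolding fixed_filter_def using comm c
    by (auto simp: K intro!: exI[of _ "1 - c"] simp: algebra_simps)
  have "K *v x = 0" using c by (simp add: K scalar_mult_eq_scaleR)
  moreover have "(L ** K) *v w = L *v (K *v w)" "(L ** K) *v w = K *v (L *v w)" for w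
    using fixed_filter_commute[OF L(1) KF] by (simp_all add: matrix_vector_mul_assoc)
  ultimately have "(L ** K) *v (a *\<^sub>R x + y) = 0"
    using L(2) by (simp add: matrix_vector_right_distrib matrix_vector_mult_scaleR)
       (metis matrix_vector_mult_0_right)
  then show ?case using fixed_filter_mult[OF L(1) KF] by blast
qed

text \<open>Two candidates differ by a fixed vector that also lies in the span of the non-fixed
  eigenvectors. A filter kills it and at the same time multiplies it by a nonzero scalar.\<close>

lemma central_part_eq:
  fixes M :: "real^'n^'n"
  assumes "spectral_decomp M w wu wc ws"
  shows "central_part M w = wc"
  unfolding central_part_def
proof (rule the_equality)
  show "\<exists>wu ws. spectral_decomp M w wu wc ws" using assms by blast
  fix c assume "\<exists>wu ws. spectral_decomp M w wu c ws"
  then obtain u s where us: "spectral_decomp M w u c s" by blast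
  let ?S = "span {v. \<exists>c. c \<noteq> 1 \<and> M *v v = c *s v}"
  have "span {v. \<exists>c. \<bar>c\<bar> > 1 \<and> M *v v = c *s v} \<subseteq> ?S"
    by (intro span_mono Collect_mono) (metis abs_1 less_irrefl)
  moreover have "span {v. \<exists>c. \<bar>c\<bar> < 1 \<and> M *v v = c *s v} \<subseteq> ?S"
    by (intro span_mono Collect_mono) (metis abs_1 less_irrefl)
  ultimately have "(wu - u) + (ws - s) \<in> ?S"
    using assms us unfolding spectral_decomp_def by (intro span_add span_diff) auto
  moreover have e: "(wu - u) + (ws - s) = c - wc"
  proof -
    have "wu + wc + ws = u + c + s" using assms us by (simp add: spectral_decomp_def)
    then show ?thesis by (simp add: algebra_simps) 
  qed
  ultimately obtain L where L: "L \<in> fixed_filter M" "L *v (c - wc) = 0"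
    using fixed_filter_kills[of "c - wc" M] by auto
  have "M *v (c - wc) = c - wc"
    using assms us by (simp add: spectral_decomp_def matrix_vector_mult_diff_distrib)
  with L have "c - wc = 0" unfolding fixed_filter_def by auto
  then show "c = wc" by simp
qed

lemma contracting_tendsto_0:
  fixes M :: "real^'n^'n"
  assumes "v \<in> span {v. \<exists>c. \<bar>c\<bar> < 1 \<and> M *v v = c *s v}"
  shows "(\<lambda>n. (((*v) M) ^^ n) v) \<longlonglongrightarrow> 0"
proof -
  have lin: "linear (((*v) M) ^^ n)" for n
  proof (induction n)
    case 0 then show ?case by (simp add: id_def linear_id[unfolded id_def] linear_ident)
  next
    case (Suc n)
    then show ?case
      unfolding funpow.simps by (rule linear_compose[OF _ matrix_vector_mul_linear])
  qed
  show ?thesis using assms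
  proof (induction rule: span_induct_alt)
    case base
    then show ?case by (simp add: linear_0[OF lin])
  next
    case (step a x y)
    then obtain c where c: "\<bar>c\<bar> < 1" "M *v x = c *\<^sub>R x" by (auto simp: scalar_mult_eq_scaleR)
    have p: "(((*v) M) ^^ n) x = c ^ n *\<^sub>R x" for n
      by (induction n) (auto simp: c matrix_vector_mult_scaleR mult_ac)
    have "(\<lambda>n. c ^ n) \<longlonglongrightarrow> 0" using c(1) by (intro LIMSEQ_power_zero) auto
    then have "(\<lambda>n. a *\<^sub>R c ^ n *\<^sub>R x + (((*v) M) ^^ n) y) \<longlonglongrightarrow> a *\<^sub>R 0 *\<^sub>R x + 0"
      by (intro tendsto_add tendsto_scaleR tendsto_const step)
    then show ?case by (simp add: linear_add[OF lin] linear_scale[OF lin] p)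
  qed
qed

section \<open>Ordered interval partitions, treated uniformly for the top and bottom rows\<close>

section \<open>Interval partitions ordered by a permutation\<close>

text \<open>Common form of \<open>left_t\<close> and \<open>left_b\<close>. Lengths are a function,
  not a vector, so that an induction step can be written as a function update.\<close>

definition left_end :: "('a::finite \<Rightarrow> nat) \<Rightarrow> ('a \<Rightarrow> real) \<Rightarrow> 'a \<Rightarrow> real" where
  "left_end p L a = (\<Sum>b | p b < p a. L b)"

lemma left_end_mono:
  assumes "p a < p b" "\<And>c. 0 < L c"
  shows "left_end p L a + L a \<le> left_end p L b"
proof -
  have "left_end p L a + L a = (\<Sum>c\<in>insert a {c. p c < p a}. L c)" by (simp add: left_end_def)
  also have "\<dots> \<le> (\<Sum>c | p c < p b. L c)"
    using assms by (intro sum_mono2) (auto simp: less_imp_le)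
  finally show ?thesis by (simp add: left_end_def)
qed

lemma left_end_nonneg:
  assumes "\<And>c. 0 < L c" shows "0 \<le> left_end p L a"
  unfolding left_end_def using assms by (intro sum_nonneg) (simp add: less_imp_le)

lemma left_end_le_total:
  assumes "\<And>c. 0 < L c" shows "left_end p L a + L a \<le> sum L UNIV"
proof -
  have "left_end p L a + L a = (\<Sum>c\<in>insert a {c. p c < p a}. L c)" by (simp add: left_end_def)
  also have "\<dots> \<le> sum L UNIV"
    using assms by (intro sum_mono2) (auto simp: less_imp_le)
  finally show ?thesis .
qed

lemma left_end_last:
  assumes "inj p" "\<And>b. p b \<le> p a" shows "left_end p L a + L a = sum L UNIV"
proof -
  have "UNIV = insert a {c. p c < p a}"
    using assms by (auto simp: order.strict_iff_order dest: injD)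
  then have "sum L UNIV = sum L (insert a {c. p c < p a})" by simp
  then show ?thesis by (simp add: left_end_def)
qed

lemma left_end_less_iff:
  assumes "inj p" "\<And>c. 0 < L c"
  shows "left_end p L a < left_end p L b \<longleftrightarrow> p a < p b"
proof -
  have "left_end p L a < left_end p L b" if "p a < p b" for a b
    using left_end_mono[OF that, of L] assms(2)[of a] assms(2) by fastforce
  then show ?thesis
    by (metis assms(1) injD less_asym less_irrefl linorder_neqE_nat)
qed

lemma left_end_unique:
  assumes "inj p" "\<And>c. 0 < L c"
    and "x \<in> {left_end p L a ..< left_end p L a + L a}" "x \<in> {left_end p L b ..< left_end p L b + L b}"
  shows "a = b"
proof (rule ccontr)
  assume "a \<noteq> b"
  then have "p a < p b \<or> p b < p a" using assms(1) by (meson injD linorder_neqE_nat)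
  then show False using left_end_mono[of p a b L] left_end_mono[of p b a L] assms by fastforce
qed

lemma left_end_cover:
  assumes p: "inj p" and L: "\<And>c. 0 < L c" and x: "0 \<le> x" "x < sum L UNIV"
  shows "\<exists>a. x \<in> {left_end p L a ..< left_end p L a + L a}"
proof -
  obtain a0 where a0: "\<And>b. p a0 \<le> p b" using ex_has_least_nat[of "\<lambda>_. True" undefined p] by auto
  have l0: "left_end p L a0 = 0" using a0 by (simp add: left_end_def not_less[symmetric])
  \<comment> \<open>The wanted letter is the one of highest rank among those starting at or before
    \<open>x\<close>: its successor would otherwise start at or before \<open>x\<close> as
    well.\<close>
  define S where "S = {a. left_end p L a \<le> x}"
  have S: "finite S" "a0 \<in> S" using l0 x by (auto simp: S_def)
  define m where "m = Max (p ` S)"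
  have "m \<in> p ` S" unfolding m_def using S by (intro Max_in) auto
  then obtain a where a: "a \<in> S" "p a = m" by auto
  have am: "p b \<le> p a" if "b \<in> S" for b unfolding a m_def using S that by auto
  have "x < left_end p L a + L a"
  proof (rule ccontr)
    assume n: "\<not> x < left_end p L a + L a"
    then have "\<not> (\<forall>b. p b \<le> p a)" using left_end_last[OF p, of a L] x by force
    then obtain b0 where "p a < p b0" by (auto simp: not_le)
    then obtain b where b: "p a < p b" "\<And>c. p a < p c \<Longrightarrow> p b \<le> p c"
      using ex_has_least_nat[of "\<lambda>c. p a < p c" b0 p] by auto
    have "{c. p c < p b} = insert a {c. p c < p a}"
      using b injD[OF p] by (auto, metis le_antisym linorder_not_less)
    then have "left_end p L b = left_end p L a + L a" by (simp add: left_end_def)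
    then have "b \<in> S" using n by (simp add: S_def)
    then show False using am b by fastforce
  qed
  then show ?thesis using a by (auto simp: S_def)
qed

lemma rank_eq:
  assumes "bij_betw p UNIV {1..CARD('a::finite)}"
  shows "p (a::'a) = Suc (card {b. p b < p a})"
proof -
  have inj: "inj p" using assms by (rule bij_betw_imp_inj_on)
  have r: "range p = {1..CARD('a)}" using assms by (rule bij_betw_imp_surj_on)
  have "p ` {b. p b < p a} = {1..<p a}"
  proof
    show "p ` {b. p b < p a} \<subseteq> {1..<p a}" using r by force
    show "{1..<p a} \<subseteq> p ` {b. p b < p a}"
    proof
      fix k assume k: "k \<in> {1..<p a}"
      have "p a \<le> CARD('a)" using r by (metis atLeastAtMost_iff rangeI)
      then have "k \<in> range p" using k r by auto
      then show "k \<in> p ` {b. p b < p a}" using k by auto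
    qed
  qed
  then have "card {b. p b < p a} = p a - 1"
    using card_image[of p "{b. p b < p a}"] inj by (simp add: inj_on_subset)
  moreover have "1 \<le> p a" using r by (metis atLeastAtMost_iff rangeI)
  ultimately show ?thesis by simp
qed

text \<open>Left ends determine the order of the letters, and by \<open>rank_eq\<close> the order
  determines the numbering. This recovers the permutations from the intervals and the map.\<close>

lemma left_end_determines:
  fixes p q :: "'a::finite \<Rightarrow> nat"
  assumes "bij_betw p UNIV {1..CARD('a)}" "bij_betw q UNIV {1..CARD('a)}"
    and L: "\<And>c. 0 < L c" and "\<And>a. left_end p L a = left_end q L a"
  shows "p = q"
proof
  fix a
  have "{b. p b < p a} = {b. q b < q a}"
    using left_end_less_iff[of p L] left_end_less_iff[of q L] assms bij_betw_imp_inj_on by metis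
  then show "p a = q a" using rank_eq[OF assms(1)] rank_eq[OF assms(2)] by metis
qed

section \<open>Elementary properties of interval exchanges\<close>

definition img_interval :: "'a::finite iet \<Rightarrow> 'a \<Rightarrow> real set" where
  "img_interval T a = {left_b T a ..< left_b T a + len T $ a}"

lemma left_t_left_end: "left_t T a = left_end (pi_t T) (($) (len T)) a"
  by (simp add: left_t_def left_end_def)

lemma left_b_left_end: "left_b T a = left_end (pi_b T) (($) (len T)) a"
  by (simp add: left_b_def left_end_def)

lemma is_iet_D:
  assumes "is_iet (T :: 'a::finite iet)"
  shows "bij_betw (pi_t T) UNIV {1..CARD('a)}" "bij_betw (pi_b T) UNIV {1..CARD('a)}"
    "inj (pi_t T)" "inj (pi_b T)" "\<And>a. 0 < len T $ a"
    "\<And>a. pi_t T a \<le> CARD('a)" "\<And>a. pi_b T a \<le> CARD('a)"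
    "pi_t T (last_t T) = CARD('a)" "pi_b T (last_b T) = CARD('a)"
proof -
  show 1: "bij_betw (pi_t T) UNIV {1..CARD('a)}" "bij_betw (pi_b T) UNIV {1..CARD('a)}"
    "\<And>a. 0 < len T $ a"
    using assms by (auto simp: is_iet_def irreducible_perm_def)
  then show "inj (pi_t T)" "inj (pi_b T)" by (auto dest: bij_betw_imp_inj_on)
  have r: "range (pi_t T) = {1..CARD('a)}" "range (pi_b T) = {1..CARD('a)}"
    using 1 by (auto dest: bij_betw_imp_surj_on)
  show "\<And>a. pi_t T a \<le> CARD('a)" "\<And>a. pi_b T a \<le> CARD('a)"
    using r by (metis atLeastAtMost_iff rangeI)+
  have "CARD('a) \<in> {1..CARD('a)}" by (simp add: Suc_leI)
  then show "pi_t T (last_t T) = CARD('a)" "pi_b T (last_b T) = CARD('a)"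
    unfolding last_t_def last_b_def using r by (auto intro: f_inv_into_f)
qed

context
  fixes T :: "'a::finite iet"
  assumes T: "is_iet T"
begin

lemma iet_interval_ne: "left_t T a \<in> iet_interval T a"
  using is_iet_D(5)[OF T] by (simp add: iet_interval_def)

lemma iet_interval_subset: "iet_interval T a \<subseteq> iet_dom T"
  unfolding iet_interval_def iet_dom_def left_t_left_end
  using left_end_nonneg[of "($) (len T)" "pi_t T" a] left_end_le_total[of "($) (len T)" "pi_t T" a] is_iet_D[OF T]
  by auto

lemma img_interval_subset: "img_interval T a \<subseteq> iet_dom T"
  unfolding img_interval_def iet_dom_def left_b_left_end
  using left_end_nonneg[of "($) (len T)" "pi_b T" a] left_end_le_total[of "($) (len T)" "pi_b T" a] is_iet_D[OF T]
  by auto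

lemma iet_interval_unique: "x \<in> iet_interval T a \<Longrightarrow> x \<in> iet_interval T b \<Longrightarrow> a = b"
  using left_end_unique[of "pi_t T" "($) (len T)" x a b] is_iet_D[OF T]
  by (simp add: iet_interval_def left_t_left_end)

lemma img_interval_unique: "x \<in> img_interval T a \<Longrightarrow> x \<in> img_interval T b \<Longrightarrow> a = b"
  using left_end_unique[of "pi_b T" "($) (len T)" x a b] is_iet_D[OF T]
  by (simp add: img_interval_def left_b_left_end)

lemma iet_interval_cover: "x \<in> iet_dom T \<Longrightarrow> \<exists>a. x \<in> iet_interval T a"
  using left_end_cover[of "pi_t T" "($) (len T)" x] is_iet_D[OF T]
  by (simp add: iet_interval_def left_t_left_end iet_dom_def)

lemma img_interval_cover: "x \<in> iet_dom T \<Longrightarrow> \<exists>a. x \<in> img_interval T a"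
  using left_end_cover[of "pi_b T" "($) (len T)" x] is_iet_D[OF T]
  by (simp add: img_interval_def left_b_left_end iet_dom_def)

lemma step_fun_in: "x \<in> iet_interval T a \<Longrightarrow> step_fun T v x = v $ a"
proof -
  assume x: "x \<in> iet_interval T a"
  have "step_fun T v x = (\<Sum>b\<in>UNIV. if b = a then v $ b else 0)"
    unfolding step_fun_def using x
    by (intro sum.cong) (auto simp: indicator_def dest: iet_interval_unique[OF x])
  then show ?thesis by simp
qed

lemma step_fun_out: "x \<notin> iet_dom T \<Longrightarrow> step_fun T v x = 0"
  unfolding step_fun_def using iet_interval_subset by (intro sum.neutral) (auto simp: indicator_def)

lemma iet_map_in: "x \<in> iet_interval T a \<Longrightarrow> iet_map T x = x + left_b T a - left_t T a"
  by (simp add: iet_map_def step_fun_in)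

lemma iet_map_out: "x \<notin> iet_dom T \<Longrightarrow> iet_map T x = x"
  by (simp add: iet_map_def step_fun_out)

lemma iet_map_img: "x \<in> iet_interval T a \<Longrightarrow> iet_map T x \<in> img_interval T a"
  by (simp add: iet_map_in) (auto simp: iet_interval_def img_interval_def)

lemma iet_map_image: "iet_map T ` iet_interval T a = img_interval T a"
proof
  show "iet_map T ` iet_interval T a \<subseteq> img_interval T a" using iet_map_img by auto
  show "img_interval T a \<subseteq> iet_map T ` iet_interval T a"
  proof
    fix y assume y: "y \<in> img_interval T a"
    have "y - left_b T a + left_t T a \<in> iet_interval T a"
      using y by (auto simp: iet_interval_def img_interval_def)
    then show "y \<in> iet_map T ` iet_interval T a"
      by (intro image_eqI[of _ _ "y - left_b T a + left_t T a"]) (auto simp: iet_map_in)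
  qed
qed

lemma iet_map_dom: "x \<in> iet_dom T \<Longrightarrow> iet_map T x \<in> iet_dom T"
  using iet_interval_cover iet_map_img img_interval_subset by blast

lemma iet_map_bij: "bij (iet_map T)"
proof (rule bijI)
  show "inj (iet_map T)"
  proof (rule injI)
    fix x y assume e: "iet_map T x = iet_map T y"
    show "x = y"
    proof (cases "x \<in> iet_dom T \<and> y \<in> iet_dom T")
      case True
      then obtain a b where ab: "x \<in> iet_interval T a" "y \<in> iet_interval T b"
        using iet_interval_cover by blast
      then have "a = b" using iet_map_img[OF ab(1)] iet_map_img[OF ab(2)] e img_interval_unique by metis
      then show ?thesis using ab e by (simp add: iet_map_in)
    next
      case False
      then show ?thesis using e iet_map_dom iet_map_out by metis
    qed
  qed
  show "surj (iet_map T)"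
  proof -
    have "\<exists>x. y = iet_map T x" for y
    proof (cases "y \<in> iet_dom T")
      case True
      then obtain a where "y \<in> iet_map T ` iet_interval T a"
        using img_interval_cover iet_map_image by blast
      then show ?thesis by blast
    next
      case False
      then show ?thesis using iet_map_out[of y] by metis
    qed
    then show ?thesis by (simp add: surj_def)
  qed
qed

lemma step_fun_measurable [measurable]: "step_fun T v \<in> borel_measurable borel"
  unfolding step_fun_def[abs_def] iet_interval_def by measurable

text \<open>The inverse is again a piecewise translation, over the intervals
  \<open>img_interval T a\<close>.\<close>

lemma inv_iet_map_measurable: "inv (iet_map T) \<in> borel_measurable borel"
proof -
  have "inv (iet_map T) y = y - (\<Sum>a\<in>UNIV. (left_b T a - left_t T a) * indicator (img_interval T a) y)" (is "_ = y - ?s y") for y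
  proof (cases "y \<in> iet_dom T")
    case True
    then obtain a where a: "y \<in> img_interval T a" using img_interval_cover by blast
    then obtain x where x: "x \<in> iet_interval T a" "y = iet_map T x" using iet_map_image by blast
    have "?s y = (\<Sum>b\<in>UNIV. if b = a then left_b T b - left_t T b else 0)"
      using a by (intro sum.cong) (auto simp: indicator_def dest: img_interval_unique[OF a])
    then have "y - ?s y = x" using x iet_map_in[OF x(1)] by simp
    then show ?thesis using x(2) iet_map_bij by (simp add: bij_is_inj)
  next
    case False
    then have "?s y = 0" using img_interval_subset by (intro sum.neutral) (auto simp: indicator_def)
    moreover have "inv (iet_map T) y = y"
      using iet_map_out[OF False] inv_f_f[OF bij_is_inj[OF iet_map_bij], of y] by simp
    ultimately show ?thesis by simp
  qed
  then have "inv (iet_map T) = (\<lambda>y. y - (\<Sum>a\<in>UNIV. (left_b T a - left_t T a) * indicator (img_interval T a) y))"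
    by blast
  moreover have "\<dots> \<in> borel_measurable borel" unfolding img_interval_def by measurable
  ultimately show ?thesis by simp
qed

end

section \<open>Rokhlin towers with prescribed itineraries, and their composition\<close>

section \<open>Towers over an induced exchange\<close>

lemma concat_split_index:
  "k < length (concat ls) \<Longrightarrow>
   \<exists>i<length ls. \<exists>j<length (ls ! i). k = length (concat (take i ls)) + j \<and> concat ls ! k = ls ! i ! j"
proof (induction ls arbitrary: k)
  case (Cons u ls)
  show ?case
  proof (cases "k < length u")
    case True
    then show ?thesis by (intro exI[of _ 0]) (auto simp: nth_append)
  next
    case False
    then have "k - length u < length (concat ls)" using Cons.prems by auto
    from Cons.IH[OF this] obtain i j where ij: "i < length ls" "j < length (ls ! i)"
      "k - length u = length (concat (take i ls)) + j" "concat ls ! (k - length u) = ls ! i ! j" by blast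
    then show ?thesis using False
      by (intro exI[of _ "Suc i"]) (auto simp: nth_append)
  qed
qed simp

lemma concat_join_index:
  "i < length ls \<Longrightarrow> j < length (ls ! i) \<Longrightarrow>
   length (concat (take i ls)) + j < length (concat ls) \<and>
   concat ls ! (length (concat (take i ls)) + j) = ls ! i ! j"
proof (induction ls arbitrary: i)
  case (Cons u ls)
  then show ?case by (cases i) (auto simp: nth_append)
qed simp

text \<open>Says that \<open>T'\<close> is the first return map of \<open>T\<close>, that all points
  of the \<open>a\<close>-th interval of \<open>T'\<close> follow the itinerary \<open>W a\<close>
  until they return, and that the towers fill the domain. Disjointness of the levels is a
  consequence, see \<open>tower_levels_unique\<close>.\<close>

definition tower_over :: "'a::finite iet \<Rightarrow> 'a iet \<Rightarrow> ('a \<Rightarrow> 'a list) \<Rightarrow> bool" where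
  "tower_over T T' W \<longleftrightarrow> iet_dom T' \<subseteq> iet_dom T \<and> (\<forall>a. W a \<noteq> []) \<and>
     (\<forall>a. \<forall>x\<in>iet_interval T' a.
        (\<forall>i<length (W a). (iet_map T ^^ i) x \<in> iet_interval T (W a ! i)) \<and>
        (\<forall>i. 0 < i \<and> i < length (W a) \<longrightarrow> (iet_map T ^^ i) x \<notin> iet_dom T') \<and>
        (iet_map T ^^ length (W a)) x = iet_map T' x) \<and>
     (\<forall>y\<in>iet_dom T. \<exists>a. \<exists>x\<in>iet_interval T' a. \<exists>i<length (W a). y = (iet_map T ^^ i) x)"

lemma tower_over_D:
  assumes "tower_over T T' W"
  shows "iet_dom T' \<subseteq> iet_dom T" "W a \<noteq> []" "0 < length (W a)"
    "x \<in> iet_interval T' a \<Longrightarrow> i < length (W a) \<Longrightarrow> (iet_map T ^^ i) x \<in> iet_interval T (W a ! i)"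
    "x \<in> iet_interval T' a \<Longrightarrow> 0 < i \<Longrightarrow> i < length (W a) \<Longrightarrow> (iet_map T ^^ i) x \<notin> iet_dom T'"
    "x \<in> iet_interval T' a \<Longrightarrow> (iet_map T ^^ length (W a)) x = iet_map T' x"
    "y \<in> iet_dom T \<Longrightarrow> \<exists>a. \<exists>x\<in>iet_interval T' a. \<exists>i<length (W a). y = (iet_map T ^^ i) x"
  using assms unfolding tower_over_def by auto

lemma tower_over_id:
  assumes "is_iet T" shows "tower_over T T (\<lambda>a. [a])"
  unfolding tower_over_def using iet_interval_cover[OF assms] by fastforce

lemma tower_over_prefix:
  assumes t: "tower_over T T' W" and x: "i \<le> length u"
    "\<And>i. i < length u \<Longrightarrow> (iet_map T' ^^ i) x \<in> iet_interval T' (u ! i)"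
  shows "(iet_map T ^^ length (concat (take i (map W u)))) x = (iet_map T' ^^ i) x"
  using x(1)
proof (induction i)
  case (Suc i)
  then have i: "i < length u" by simp
  have "take (Suc i) (map W u) = take i (map W u) @ [W (u ! i)]"
    using i by (simp add: take_Suc_conv_app_nth)
  then have "length (concat (take (Suc i) (map W u))) = length (W (u ! i)) + length (concat (take i (map W u)))"
    by simp
  then have "(iet_map T ^^ length (concat (take (Suc i) (map W u)))) x
      = (iet_map T ^^ length (W (u ! i))) ((iet_map T' ^^ i) x)"
    using Suc by (simp add: funpow_add)
  also have "\<dots> = iet_map T' ((iet_map T' ^^ i) x)"
    using tower_over_D(6)[OF t x(2)[OF i]] .
  finally show ?case by simp
qed simp

text \<open>Inducing twice substitutes \<open>W\<close> into the itineraries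
  \<open>W'\<close>.\<close>

lemma tower_over_trans:
  assumes t1: "tower_over T T' W" and t2: "tower_over T' T'' W'" and T': "is_iet T'"
  shows "tower_over T T'' (\<lambda>a. concat (map W (W' a)))"
  unfolding tower_over_def
proof (intro conjI allI ballI)
  show "iet_dom T'' \<subseteq> iet_dom T" using tower_over_D(1)[OF t1] tower_over_D(1)[OF t2] by blast
  show "concat (map W (W' a)) \<noteq> []" for a
    using tower_over_D(2)[OF t1] tower_over_D(2)[OF t2] by (cases "W' a") auto
next
  fix a x assume x: "x \<in> iet_interval T'' a"
  let ?u = "W' a"
  let ?f = "iet_map T" and ?g = "iet_map T'"
  have gx: "(?g ^^ i) x \<in> iet_interval T' (?u ! i)" if "i < length ?u" for i
    using tower_over_D(4)[OF t2 x that] .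
  note pre = tower_over_prefix[OF t1 _ gx]
  have point: "\<exists>i<length ?u. \<exists>j<length (W (?u ! i)). k = length (concat (take i (map W ?u))) + j \<and>
      concat (map W ?u) ! k = W (?u ! i) ! j \<and> (?f ^^ k) x = (?f ^^ j) ((?g ^^ i) x)"
    if "k < length (concat (map W ?u))" for k
  proof -
    from concat_split_index[OF that] obtain i j where ij: "i < length ?u" "j < length (W (?u ! i))"
      "k = length (concat (take i (map W ?u))) + j" "concat (map W ?u) ! k = W (?u ! i) ! j"
      by auto
    have "(?f ^^ k) x = (?f ^^ j) ((?f ^^ length (concat (take i (map W ?u)))) x)"
      unfolding ij(3) by (subst add.commute) (simp add: funpow_add)
    then show ?thesis using ij pre[of i] by (intro exI[of _ i] conjI exI[of _ j]) auto
  qed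
  show "k < length (concat (map W ?u)) \<longrightarrow> (?f ^^ k) x \<in> iet_interval T (concat (map W ?u) ! k)" for k
  proof
    assume "k < length (concat (map W ?u))"
    from point[OF this] obtain i j where ij: "i < length ?u" "j < length (W (?u ! i))"
      "concat (map W ?u) ! k = W (?u ! i) ! j" "(?f ^^ k) x = (?f ^^ j) ((?g ^^ i) x)" by blast
    show "(?f ^^ k) x \<in> iet_interval T (concat (map W ?u) ! k)"
      using tower_over_D(4)[OF t1 gx[OF ij(1)] ij(2)] ij by simp
  qed
  show "0 < k \<and> k < length (concat (map W ?u)) \<longrightarrow> (?f ^^ k) x \<notin> iet_dom T''" for k
  proof
    assume k: "0 < k \<and> k < length (concat (map W ?u))"
    then obtain i j where ij: "i < length ?u" "j < length (W (?u ! i))"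
      "k = length (concat (take i (map W ?u))) + j" "(?f ^^ k) x = (?f ^^ j) ((?g ^^ i) x)"
      using point by blast
    show "(?f ^^ k) x \<notin> iet_dom T''"
    \<comment> \<open>A block starts at a point of the \<open>T'\<close>-orbit, which is outside
      \<open>iet_dom T''\<close> by the second tower. Inside a block the orbit is already outside
      the larger set \<open>iet_dom T'\<close>.\<close>
    proof (cases "j = 0")
      case True
      then have "0 < i" using ij(3) k by (cases i) auto
      then show ?thesis using True ij(4) tower_over_D(5)[OF t2 x _ ij(1)] by simp
    next
      case False
      then show ?thesis
        using tower_over_D(5)[OF t1 gx[OF ij(1)] _ ij(2)] ij(4) tower_over_D(1)[OF t2] by auto
    qed
  qed
  show "(?f ^^ length (concat (map W ?u))) x = iet_map T'' x"
    using pre[of "length ?u"] tower_over_D(6)[OF t2 x] by simp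
next
  fix y assume "y \<in> iet_dom T"
  then obtain b z j where z: "z \<in> iet_interval T' b" "j < length (W b)" "y = (iet_map T ^^ j) z"
    using tower_over_D(7)[OF t1] by blast
  then have "z \<in> iet_dom T'" using iet_interval_subset[OF T'] by blast
  then obtain a x i where x: "x \<in> iet_interval T'' a" "i < length (W' a)" "z = (iet_map T' ^^ i) x"
    using tower_over_D(7)[OF t2] by blast
  have b: "b = W' a ! i"
    using iet_interval_unique[OF T' z(1)] tower_over_D(4)[OF t2 x(1,2)] x(3) by blast
  let ?k = "length (concat (take i (map W (W' a)))) + j"
  have "?k < length (concat (map W (W' a)))"
    using concat_join_index[of i "map W (W' a)" j] x z b by simp
  moreover have "y = (iet_map T ^^ ?k) x"
    using tower_over_prefix[OF t1, of i "W' a" x] tower_over_D(4)[OF t2 x(1)] x z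
    by (subst add.commute) (simp add: funpow_add)
  ultimately show "\<exists>a. \<exists>x\<in>iet_interval T'' a. \<exists>i<length (concat (map W (W' a))). y = (iet_map T ^^ i) x"
    using x(1) by blast
qed

lemma tower_return_time:
  assumes t: "tower_over T T' W" and T': "is_iet T'" and x: "x \<in> iet_interval T' a"
  shows "return_time (iet_map T) (iet_dom T') x = length (W a)"
  unfolding return_time_def
proof (rule Least_equality)
  have "iet_map T' x \<in> iet_dom T'" using iet_map_dom[OF T'] iet_interval_subset[OF T'] x by blast
  then show "0 < length (W a) \<and> (iet_map T ^^ length (W a)) x \<in> iet_dom T'"
    using tower_over_D(3,6)[OF t] x by simp
  show "length (W a) \<le> n" if "0 < n \<and> (iet_map T ^^ n) x \<in> iet_dom T'" for n
    using tower_over_D(5)[OF t x] that by (meson not_le)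
qed

lemma tower_first_return:
  assumes t: "tower_over T T' W" and T': "is_iet T'" and x: "x \<in> iet_dom T'"
  shows "first_return (iet_map T) (iet_dom T') x = iet_map T' x"
proof -
  obtain a where "x \<in> iet_interval T' a" using iet_interval_cover[OF T' x] by blast
  then show ?thesis
    unfolding first_return_def using tower_return_time[OF t T'] tower_over_D(6)[OF t] by simp
qed

text \<open>Heights are first return times, so no level meets an earlier one.\<close>

lemma tower_levels_unique:
  assumes t: "tower_over T T' W" and T: "is_iet T" and T': "is_iet T'"
    and x: "x \<in> iet_interval T' a" "i < length (W a)"
    and y: "y \<in> iet_interval T' b" "j < length (W b)"
    and e: "(iet_map T ^^ i) x = (iet_map T ^^ j) y"
  shows "a = b \<and> i = j \<and> x = y"
proof -
  let ?f = "iet_map T"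
  have inj: "inj (?f ^^ n)" for n
    using iet_map_bij[OF T] by (induction n) (auto simp: bij_is_inj intro: inj_compose)
  have aux: "\<not> i < j" if e: "(?f ^^ i) x = (?f ^^ j) y" and x: "x \<in> iet_interval T' a"
    and y: "y \<in> iet_interval T' b" "j < length (W b)" for x y a b i j
  proof
    assume ij: "i < j"
    have "(?f ^^ j) y = (?f ^^ i) ((?f ^^ (j - i)) y)"
      using ij by (metis add_diff_inverse_nat comp_apply funpow_add not_less_iff_gr_or_eq)
    then have "x = (?f ^^ (j - i)) y" using e inj by (metis injD)
    moreover have "(?f ^^ (j - i)) y \<notin> iet_dom T'"
      using tower_over_D(5)[OF t y(1), of "j - i"] ij y(2) by simp
    ultimately show False using x iet_interval_subset[OF T'] by blast
  qed
  have "i = j" using aux[OF e x(1) y] aux[OF e[symmetric] y(1) x] by simp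
  then have "x = y" using e inj by (metis injD)
  then show ?thesis using iet_interval_unique[OF T' x(1)] y(1) \<open>i = j\<close> by blast
qed

section \<open>The induction step in explicit form, its uniqueness, and the words of a whole
  period\<close>

section \<open>The Rauzy--Veech step\<close>

text \<open>The Rauzy move on one row, whose last letter is the loser \<open>l\<close>: it is
  reinserted right behind the winner \<open>w\<close>. The top type applies it to the bottom row,
  the bottom type to the top row.\<close>

definition move_after :: "('a \<Rightarrow> nat) \<Rightarrow> 'a \<Rightarrow> 'a \<Rightarrow> 'a \<Rightarrow> nat" where
  "move_after p w l a = (if a = l then Suc (p w) else if p w < p a then Suc (p a) else p a)"

lemma move_after_bij:
  fixes p :: "'a::finite \<Rightarrow> nat"
  assumes p: "bij_betw p UNIV {1..CARD('a)}" and l: "p l = CARD('a)" and wl: "w \<noteq> l"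
  shows "bij_betw (move_after p w l) UNIV {1..CARD('a)}"
proof -
  have inj: "inj p" using p by (rule bij_betw_imp_inj_on)
  have r: "p a \<in> {1..CARD('a)}" for a using bij_betwE[OF p] by blast
  have lt: "p a < CARD('a)" if "a \<noteq> l" for a
    using r[of a] l that injD[OF inj, of a l] by (auto simp: order.strict_iff_order)
  have inj': "inj (move_after p w l)"
  proof (rule injI)
    fix a b assume "move_after p w l a = move_after p w l b"
    then have "p a = p b" using lt wl l
      by (auto simp: move_after_def split: if_splits dest: injD[OF inj])
    then show "a = b" by (rule injD[OF inj])
  qed
  have "range (move_after p w l) \<subseteq> {1..CARD('a)}"
    using r lt[OF wl] lt by (fastforce simp: move_after_def Suc_le_eq)
  moreover have "card (range (move_after p w l)) = CARD('a)" using inj' by (simp add: card_image)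
  ultimately have "range (move_after p w l) = {1..CARD('a)}" by (intro card_subset_eq) auto
  then show ?thesis using inj' by (simp add: bij_betw_def)
qed

text \<open>The winner loses exactly the length of the loser, which is put right behind it. Together
  they fill the old interval of the winner, so all other letters stay in place.\<close>

lemma left_end_move_after:
  fixes p :: "'a::finite \<Rightarrow> nat"
  assumes p: "bij_betw p UNIV {1..CARD('a)}" and l: "p l = CARD('a)" and wl: "w \<noteq> l"
  shows "left_end (move_after p w l) (L(w := L w - L l)) a =
     (if a = l then left_end p L w + L w - L l else left_end p L a)"
proof -
  have inj: "inj p" using p by (rule bij_betw_imp_inj_on)
  have r: "p a \<in> {1..CARD('a)}" for a using bij_betwE[OF p] by blast
  have lt: "p a < CARD('a)" if "a \<noteq> l" for a
    using r[of a] l that injD[OF inj, of a l] by (auto simp: order.strict_iff_order)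
  let ?L = "L(w := L w - L l)"
  consider "a = l" | "a \<noteq> l" "p a \<le> p w" | "a \<noteq> l" "p w < p a" by linarith
  then show ?thesis
  proof cases
    case 1
    have "{b. move_after p w l b < move_after p w l a} = insert w {b. p b < p w}"
      using 1 lt[OF wl] l injD[OF inj] by (auto simp: move_after_def less_Suc_eq wl)
    moreover have "sum ?L {b. p b < p w} = sum L {b. p b < p w}" by (intro sum.cong) auto
    ultimately show ?thesis using 1 by (simp add: left_end_def)
  next
    case 2
    have "{b. move_after p w l b < move_after p w l a} = {b. p b < p a}"
      using 2 lt[OF 2(1)] l by (auto simp: move_after_def)
    moreover have "sum ?L {b. p b < p a} = sum L {b. p b < p a}" using 2 by (intro sum.cong) auto
    ultimately show ?thesis using 2 by (simp add: left_end_def)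
  next
    case 3
    have "{b. move_after p w l b < move_after p w l a} = insert l {b. p b < p a}"
      using 3 lt[OF 3(1)] l by (auto simp: move_after_def)
    moreover have "l \<notin> {b. p b < p a}" using lt[OF 3(1)] l by simp
    moreover have "sum ?L {b. p b < p a} = sum L {b. p b < p a} - L l"
    proof -
      have "sum ?L {b. p b < p a} = ?L w + sum ?L ({b. p b < p a} - {w})"
        using 3 by (intro sum.remove) auto
      also have "sum ?L ({b. p b < p a} - {w}) = sum L ({b. p b < p a} - {w})"
        by (intro sum.cong) auto
      also have "\<dots> = sum L {b. p b < p a} - L w"
        using 3 by (simp add: sum.remove[of _ w L])
      finally show ?thesis by simp
    qed
    ultimately show ?thesis using 3 wl by (simp add: left_end_def)
  qed
qed

lemma left_end_upd_last:
  fixes p :: "'a::finite \<Rightarrow> nat"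
  assumes "\<And>b. p b \<le> p w"
  shows "left_end p (L(w := c)) a = left_end p L a"
  unfolding left_end_def using assms by (intro sum.cong) (auto simp: not_less[symmetric])

lemma irreducible_perm_sym: "irreducible_perm p q \<Longrightarrow> irreducible_perm q p"
  unfolding irreducible_perm_def by metis

text \<open>A common initial set of fewer than all letters misses \<open>w\<close>, the last letter
  of \<open>p\<close>. Hence \<open>w\<close> stands beyond position \<open>k\<close> in
  \<open>q\<close>, and the move changes only positions behind \<open>w\<close>.\<close>

lemma irreducible_perm_move_after:
  fixes p q :: "'a::finite \<Rightarrow> nat"
  assumes irr: "irreducible_perm p q" and w: "p w = CARD('a)" and l: "q l = CARD('a)" and wl: "w \<noteq> l"
  shows "irreducible_perm p (move_after q w l)"
proof -
  have q: "bij_betw q UNIV {1..CARD('a)}" and p: "bij_betw p UNIV {1..CARD('a)}"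
    using irr by (auto simp: irreducible_perm_def)
  have "p -` {1..k} \<noteq> move_after q w l -` {1..k}" if k: "1 \<le> k" "k < CARD('a)" for k
  proof
    assume e: "p -` {1..k} = move_after q w l -` {1..k}"
    have "w \<notin> p -` {1..k}" using w k by simp
    then have "w \<notin> move_after q w l -` {1..k}" unfolding e .
    moreover have "1 \<le> q w" using bij_betwE[OF q] by simp
    ultimately have qw: "k < q w" using wl by (auto simp: move_after_def)
    have "move_after q w l -` {1..k} = q -` {1..k}"
    proof (rule set_eqI)
      fix a
      show "a \<in> move_after q w l -` {1..k} \<longleftrightarrow> a \<in> q -` {1..k}"
        using qw k l by (auto simp: move_after_def)
    qed
    then show False using e irr k by (auto simp: irreducible_perm_def)
  qed
  then show ?thesis using move_after_bij[OF q l wl] p unfolding irreducible_perm_def by blast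
qed

definition rv_next :: "'a::finite iet \<Rightarrow> 'a iet" where
  "rv_next T = (case rv_type_of T of
     Top_Type \<Rightarrow> \<lparr>pi_t = pi_t T, pi_b = move_after (pi_b T) (last_t T) (last_b T),
       len = (\<chi> a. if a = last_t T then len T $ last_t T - len T $ last_b T else len T $ a)\<rparr>
   | Bottom_Type \<Rightarrow> \<lparr>pi_t = move_after (pi_t T) (last_b T) (last_t T), pi_b = pi_b T,
       len = (\<chi> a. if a = last_b T then len T $ last_b T - len T $ last_t T else len T $ a)\<rparr>)"

text \<open>Only the loser's word has two letters, and it is the same in both types: for the top
  type \<open>I_b\<close> is mapped into \<open>I_t\<close>; for the bottom type the new interval of
  \<open>last_t\<close> is the part of \<open>I_b\<close> mapped onto \<open>I_t\<close>.\<close>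

definition step_word :: "'a::finite iet \<Rightarrow> 'a \<Rightarrow> 'a list" where
  "step_word T a =
     (if a = (case rv_type_of T of Top_Type \<Rightarrow> last_b T | Bottom_Type \<Rightarrow> last_t T)
      then [last_b T, last_t T] else [a])"

lemma left_t_last: "is_iet T \<Longrightarrow> left_t T (last_t T) + len T $ last_t T = sum (($) (len T)) UNIV"
  using left_end_last[of "pi_t T" "last_t T" "($) (len T)"] is_iet_D[of T] by (simp add: left_t_left_end)

lemma left_b_last: "is_iet T \<Longrightarrow> left_b T (last_b T) + len T $ last_b T = sum (($) (len T)) UNIV"
  using left_end_last[of "pi_b T" "last_b T" "($) (len T)"] is_iet_D[of T] by (simp add: left_b_left_end)

lemma sum_fun_upd:
  fixes f :: "'a::finite \<Rightarrow> real"
  shows "sum (f(w := c)) UNIV = sum f UNIV - f w + c"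
proof -
  have "sum (f(w := c)) UNIV = c + sum (f(w := c)) (UNIV - {w})" by (simp add: sum.remove[of _ w])
  also have "sum (f(w := c)) (UNIV - {w}) = sum f (UNIV - {w})" by (intro sum.cong) auto
  also have "\<dots> = sum f UNIV - f w" by (simp add: sum.remove[of _ w f])
  finally show ?thesis by simp
qed

context
  fixes T :: "'a::finite iet"
  assumes T: "is_iet T" and def: "rv_defined T"
begin

private abbreviation "t \<equiv> last_t T"
private abbreviation "b \<equiv> last_b T"
private abbreviation "D \<equiv> sum (($) (len T)) UNIV"

lemma last_neq: "t \<noteq> b" using def by (auto simp: rv_defined_def)

lemma rv_next_top_data:
  assumes "rv_type_of T = Top_Type"
  shows "len T $ b < len T $ t"
    "left_t (rv_next T) a = left_t T a"
    "left_b (rv_next T) a = (if a = b then left_b T t + len T $ t - len T $ b else left_b T a)"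
    "len (rv_next T) $ a = (if a = t then len T $ t - len T $ b else len T $ a)"
    "iet_dom (rv_next T) = {0 ..< D - len T $ b}"
    "is_iet (rv_next T)"
proof -
  show lt: "len T $ b < len T $ t" using assms by (auto simp: rv_type_of_def split: if_splits)
  show l: "len (rv_next T) $ a = (if a = t then len T $ t - len T $ b else len T $ a)" for a
    using assms by (simp add: rv_next_def)
  have le: "(($) (len (rv_next T))) = (($) (len T))(t := len T $ t - len T $ b)"
    by (auto simp: l)
  show "left_t (rv_next T) a = left_t T a"
    unfolding left_t_left_end le using assms is_iet_D[OF T]
    by (simp add: rv_next_def left_end_upd_last)
  show "left_b (rv_next T) a = (if a = b then left_b T t + len T $ t - len T $ b else left_b T a)"
    unfolding left_b_left_end le using assms left_end_move_after[of "pi_b T" b t "($) (len T)" a] is_iet_D[OF T] last_neq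
    by (simp add: rv_next_def)
  show "iet_dom (rv_next T) = {0 ..< D - len T $ b}"
    unfolding iet_dom_def le sum_fun_upd by simp
  have "irreducible_perm (pi_t T) (move_after (pi_b T) t b)"
    using irreducible_perm_move_after[of "pi_t T" "pi_b T" t b] T is_iet_D[OF T] last_neq by (simp add: is_iet_def)
  then show "is_iet (rv_next T)"
    using T lt l is_iet_D(5)[OF T] assms by (auto simp: is_iet_def rv_next_def)
qed

lemma rv_next_bottom_data:
  assumes "rv_type_of T = Bottom_Type"
  shows "len T $ t < len T $ b"
    "left_b (rv_next T) a = left_b T a"
    "left_t (rv_next T) a = (if a = t then left_t T b + len T $ b - len T $ t else left_t T a)"
    "len (rv_next T) $ a = (if a = b then len T $ b - len T $ t else len T $ a)"
    "iet_dom (rv_next T) = {0 ..< D - len T $ t}"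
    "is_iet (rv_next T)"
proof -
  show lt: "len T $ t < len T $ b" using assms def
    by (auto simp: rv_type_of_def rv_defined_def split: if_splits)
  show l: "len (rv_next T) $ a = (if a = b then len T $ b - len T $ t else len T $ a)" for a
    using assms by (simp add: rv_next_def)
  have le: "(($) (len (rv_next T))) = (($) (len T))(b := len T $ b - len T $ t)"
    by (auto simp: l)
  show "left_b (rv_next T) a = left_b T a"
    unfolding left_b_left_end le using assms is_iet_D[OF T]
    by (simp add: rv_next_def left_end_upd_last)
  show "left_t (rv_next T) a = (if a = t then left_t T b + len T $ b - len T $ t else left_t T a)"
    unfolding left_t_left_end le using assms left_end_move_after[of "pi_t T" t b "($) (len T)" a] is_iet_D[OF T] last_neq
    by (simp add: rv_next_def)
  show "iet_dom (rv_next T) = {0 ..< D - len T $ t}"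
    unfolding iet_dom_def le sum_fun_upd by simp
  have "irreducible_perm (move_after (pi_t T) b t) (pi_b T)"
    using irreducible_perm_sym[OF irreducible_perm_move_after[of "pi_b T" "pi_t T" b t]] irreducible_perm_sym
      T is_iet_D[OF T] last_neq by (auto simp: is_iet_def)
  then show "is_iet (rv_next T)"
    using T lt l is_iet_D(5)[OF T] assms by (auto simp: is_iet_def rv_next_def)
qed

lemma is_iet_rv_next: "is_iet (rv_next T)"
  using rv_next_top_data rv_next_bottom_data by (cases "rv_type_of T") auto

lemma rv_interval_next: "iet_interval (rv_next T) a = rv_interval T a"
proof (cases "rv_type_of T")
  case Top_Type
  note d = rv_next_top_data[OF this]
  have "iet_map T ` iet_interval T b = {D - len T $ b ..< D}"
    unfolding iet_map_image[OF T] img_interval_def using left_b_last[OF T] by auto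
  then show ?thesis
    using d(1) is_iet_D(5)[OF T, of b] left_t_last[OF T]
    by (auto simp: rv_interval_def Top_Type iet_interval_def d)
next
  case Bottom_Type
  note d = rv_next_bottom_data[OF this]
  have It: "iet_interval T t = {D - len T $ t ..< D}"
    unfolding iet_interval_def using left_t_last[OF T] by auto
  have Jb: "img_interval T b = {D - len T $ b ..< D}"
    unfolding img_interval_def using left_b_last[OF T] by auto
  \<comment> \<open>Here \<open>I_t\<close> and the image of \<open>I_b\<close> are both terminal
    segments of the domain, the former shorter. So the preimage of \<open>I_t\<close> is the
    terminal piece of \<open>I_b\<close>.\<close>
  have pre: "iet_preimage T (iet_interval T t) = {left_t T b + len T $ b - len T $ t ..< left_t T b + len T $ b}"
  proof (intro set_eqI iffI)
    fix x assume "x \<in> iet_preimage T (iet_interval T t)"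
    then have x: "x \<in> iet_dom T" "iet_map T x \<in> iet_interval T t" by (auto simp: iet_preimage_def)
    obtain c where c: "x \<in> iet_interval T c" using iet_interval_cover[OF T x(1)] by blast
    have "iet_map T x \<in> img_interval T b" using x(2) d(1) unfolding It Jb by auto
    then have "c = b" using img_interval_unique[OF T iet_map_img[OF T c]] by blast
    then show "x \<in> {left_t T b + len T $ b - len T $ t ..< left_t T b + len T $ b}"
      using c x(2) iet_map_in[OF T c] left_b_last[OF T] unfolding It by (auto simp: iet_interval_def)
  next
    fix x assume x: "x \<in> {left_t T b + len T $ b - len T $ t ..< left_t T b + len T $ b}"
    then have xb: "x \<in> iet_interval T b" using d(1) by (auto simp: iet_interval_def)
    then show "x \<in> iet_preimage T (iet_interval T t)"
      using x iet_map_in[OF T xb] left_b_last[OF T] iet_interval_subset[OF T, of b]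
      unfolding iet_preimage_def It by auto
  qed
  show ?thesis
    using d(1) is_iet_D(5)[OF T, of t] last_neq
    unfolding rv_interval_def pre by (auto simp: Bottom_Type iet_interval_def d)
qed

lemma rv_dom_next: "iet_dom (rv_next T) = rv_dom T"
proof (cases "rv_type_of T")
  case Top_Type
  have "iet_map T ` iet_interval T b = {D - len T $ b ..< D}"
    unfolding iet_map_image[OF T] img_interval_def using left_b_last[OF T] by auto
  then show ?thesis using is_iet_D(5)[OF T, of b]
    by (auto simp: rv_dom_def Top_Type rv_next_top_data(5)[OF Top_Type] iet_dom_def[of T])
next
  case Bottom_Type
  have "iet_interval T t = {D - len T $ t ..< D}"
    unfolding iet_interval_def using left_t_last[OF T] by auto
  then show ?thesis using is_iet_D(5)[OF T, of t]
    by (auto simp: rv_dom_def Bottom_Type rv_next_bottom_data(5)[OF Bottom_Type] iet_dom_def[of T])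
qed

lemma tower_over_rv_next: "tower_over T (rv_next T) (step_word T)"
  unfolding tower_over_def
proof (intro conjI allI ballI impI)
  show "iet_dom (rv_next T) \<subseteq> iet_dom T"
    unfolding rv_dom_next rv_dom_def by (auto split: rv_type.splits)
  show "step_word T a \<noteq> []" for a by (simp add: step_word_def)
next
  fix a x assume x: "x \<in> iet_interval (rv_next T) a"
  have "((\<forall>i<length (step_word T a). (iet_map T ^^ i) x \<in> iet_interval T (step_word T a ! i)) \<and>
        (\<forall>i. 0 < i \<and> i < length (step_word T a) \<longrightarrow> (iet_map T ^^ i) x \<notin> iet_dom (rv_next T)) \<and>
        (iet_map T ^^ length (step_word T a)) x = iet_map (rv_next T) x)"
  proof (cases "rv_type_of T")
    case Top_Type
    note d = rv_next_top_data[OF this]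
    have xa: "x \<in> iet_interval T a"
      using x d(1) is_iet_D(5)[OF T, of b] by (auto simp: iet_interval_def d split: if_splits)
    show ?thesis
    proof (cases "a = b")
      case True
      have Tx: "iet_map T x \<in> {D - len T $ b ..< D}"
        using iet_map_img[OF T xa] left_b_last[OF T] True by (auto simp: img_interval_def)
      have Txt: "iet_map T x \<in> iet_interval T t"
        using Tx d(1) left_t_last[OF T] by (auto simp: iet_interval_def)
      have "iet_map T (iet_map T x) = iet_map (rv_next T) x"
        using iet_map_in[OF T Txt] iet_map_in[OF T xa] iet_map_in[OF d(6) x] left_b_last[OF T]
          left_t_last[OF T] True by (simp add: d)
      then show ?thesis using Tx Txt xa True
        by (auto simp: step_word_def Top_Type less_Suc_eq numeral_2_eq_2 d(5))
    next
      case False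
      then have "iet_map T x = iet_map (rv_next T) x"
        using iet_map_in[OF T xa] iet_map_in[OF d(6) x] by (simp add: d)
      then show ?thesis using False xa by (simp add: step_word_def Top_Type)
    qed
  next
    case Bottom_Type
    note d = rv_next_bottom_data[OF this]
    show ?thesis
    proof (cases "a = t")
      case True
      have xb: "x \<in> iet_interval T b"
        using x d(1) True last_neq by (auto simp: iet_interval_def d(2-4))
      have Tx: "iet_map T x \<in> {D - len T $ t ..< D}"
        using iet_map_in[OF T xb] x left_b_last[OF T] True last_neq by (auto simp: iet_interval_def d)
      have Txt: "iet_map T x \<in> iet_interval T t"
        using Tx left_t_last[OF T] by (auto simp: iet_interval_def)
      have "iet_map T (iet_map T x) = iet_map (rv_next T) x"
        using iet_map_in[OF T Txt] iet_map_in[OF T xb] iet_map_in[OF d(6) x] left_b_last[OF T]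
          left_t_last[OF T] True by (simp add: d)
      then show ?thesis using Tx Txt xb True
        by (auto simp: step_word_def Bottom_Type less_Suc_eq numeral_2_eq_2 d(5))
    next
      case False
      have xa: "x \<in> iet_interval T a"
        using x d(1) False is_iet_D(5)[OF T, of t] by (auto simp: iet_interval_def d split: if_splits)
      then have "iet_map T x = iet_map (rv_next T) x"
        using iet_map_in[OF T xa] iet_map_in[OF d(6) x] False by (simp add: d)
      then show ?thesis using False xa by (simp add: step_word_def Bottom_Type)
    qed
  qed
  then show "\<And>i. i < length (step_word T a) \<Longrightarrow> (iet_map T ^^ i) x \<in> iet_interval T (step_word T a ! i)"
    "\<And>i. 0 < i \<and> i < length (step_word T a) \<Longrightarrow> (iet_map T ^^ i) x \<notin> iet_dom (rv_next T)"
    "(iet_map T ^^ length (step_word T a)) x = iet_map (rv_next T) x" by blast+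
next
  fix y assume y: "y \<in> iet_dom T"
  show "\<exists>a. \<exists>x\<in>iet_interval (rv_next T) a. \<exists>i<length (step_word T a). y = (iet_map T ^^ i) x"
  proof (cases "y \<in> iet_dom (rv_next T)")
    case True
    then obtain a where "y \<in> iet_interval (rv_next T) a"
      using iet_interval_cover[OF is_iet_rv_next] by blast
    then show ?thesis by (intro exI[of _ a] bexI[of _ y] exI[of _ 0]) (auto simp: step_word_def)
  next
    case False
    show ?thesis
    proof (cases "rv_type_of T")
      case Top_Type
      then obtain x where x: "x \<in> iet_interval T b" "y = iet_map T x"
        using False y by (auto simp: rv_dom_next rv_dom_def)
      then have "x \<in> iet_interval (rv_next T) b"
        using last_neq by (simp add: rv_interval_next rv_interval_def Top_Type)
      then show ?thesis using x(2)
        by (intro exI[of _ b] bexI[of _ x] exI[of _ 1]) (auto simp: step_word_def Top_Type)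
    next
      case Bottom_Type
      then have yt: "y \<in> iet_interval T t" using False y by (auto simp: rv_dom_next rv_dom_def)
      obtain x where x: "y = iet_map T x" using iet_map_bij[OF T] by (metis bij_pointE)
      then have "x \<in> iet_dom T" using y iet_map_out[OF T] by metis
      then have "x \<in> iet_interval (rv_next T) t"
        using x yt by (simp add: rv_interval_next rv_interval_def Bottom_Type iet_preimage_def)
      then show ?thesis using x
        by (intro exI[of _ t] bexI[of _ x] exI[of _ 1]) (auto simp: step_word_def Bottom_Type)
    qed
  qed
qed

lemma rv_step_next: "rv_step T (rv_next T)"
  unfolding rv_step_def
  using def is_iet_rv_next rv_dom_next rv_interval_next
    tower_first_return[OF tower_over_rv_next is_iet_rv_next] by simp

end

text \<open>Intervals give the lengths and the top row; the translations then give the bottom left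
  ends and hence the bottom row. This is the uniqueness behind the definite description in
  \<open>rv_iter\<close>.\<close>

lemma iet_eqI:
  fixes S T :: "'a::finite iet"
  assumes S: "is_iet S" and T: "is_iet T"
    and int: "\<And>a. iet_interval S a = iet_interval T a"
    and map: "\<And>x. x \<in> iet_dom S \<Longrightarrow> iet_map S x = iet_map T x"
  shows "S = T"
proof -
  have lt: "left_t S a = left_t T a \<and> len S $ a = len T $ a" for a
    using int[of a] is_iet_D(5)[OF S, of a] is_iet_D(5)[OF T, of a]
    by (auto simp: iet_interval_def Ico_eq_Ico)
  then have len: "len S = len T" by (simp add: vec_eq_iff)
  have pt: "pi_t S = pi_t T"
    using lt by (intro left_end_determines[of _ _ "($) (len S)"] is_iet_D S T) (simp_all add: left_t_left_end len)
  have "left_b S a = left_b T a" for a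
  proof -
    have "left_t S a \<in> iet_interval S a" by (rule iet_interval_ne[OF S])
    then show ?thesis
      using map[of "left_t S a"] iet_interval_subset[OF S, of a] iet_map_in[OF S, of "left_t S a" a]
        iet_map_in[OF T, of "left_t S a" a] int[of a] lt[of a] by auto
  qed
  then have pb: "pi_b S = pi_b T"
    by (intro left_end_determines[of _ _ "($) (len S)"] is_iet_D S T) (simp_all add: left_b_left_end len)
  show ?thesis using pt pb len by (simp add: iet.equality)
qed

lemma the_rv_step:
  assumes "is_iet T" "rv_defined T" shows "(THE T'. rv_step T T') = rv_next T"
proof (rule the_equality)
  show n: "rv_step T (rv_next T)" by (rule rv_step_next[OF assms])
  show "S = rv_next T" if "rv_step T S" for S
    using that n by (intro iet_eqI) (auto simp: rv_step_def)
qed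

lemma rv_iter_is_iet:
  assumes "is_iet T" "rv_infinite T"
  shows "is_iet (rv_iter T n)" "rv_iter T (Suc n) = rv_next (rv_iter T n)"
proof -
  show 1: "is_iet (rv_iter T n)" for n
  proof (induction n)
    case (Suc n)
    then show ?case using assms(2) by (simp add: the_rv_step is_iet_rv_next rv_infinite_def)
  qed (simp add: assms)
  show "rv_iter T (Suc n) = rv_next (rv_iter T n)"
    using 1 assms(2) by (simp add: the_rv_step rv_infinite_def)
qed

lemma rv_iter_add: "rv_iter T (m + n) = rv_iter (rv_iter T m) n"
  by (induction n) auto

primrec rv_word :: "'a::finite iet \<Rightarrow> nat \<Rightarrow> 'a \<Rightarrow> 'a list" where
  "rv_word T 0 = (\<lambda>a. [a])"
| "rv_word T (Suc n) = (\<lambda>a. concat (map (rv_word T n) (step_word (rv_iter T n) a)))"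

lemma tower_over_rv_iter:
  assumes "is_iet T" "rv_infinite T"
  shows "tower_over T (rv_iter T n) (rv_word T n)"
proof (induction n)
  case 0 then show ?case using tower_over_id[OF assms(1)] by simp
next
  case (Suc n)
  have "tower_over (rv_iter T n) (rv_iter T (Suc n)) (step_word (rv_iter T n))"
    unfolding rv_iter_is_iet(2)[OF assms]
    using tower_over_rv_next[OF rv_iter_is_iet(1)[OF assms]] assms(2) by (simp add: rv_infinite_def)
  from tower_over_trans[OF Suc this rv_iter_is_iet(1)[OF assms]] show ?case
    unfolding rv_word.simps .
qed

text \<open>The words see only the last letters and the type of each step, that is, the rotation
  number and not the lengths.\<close>

lemma rv_word_cong:
  assumes "\<And>n. rotation_number S n = rotation_number T n"
  shows "rv_word S n = rv_word T n"
proof (induction n)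
  case (Suc n)
  have "last_b (rv_iter S n) = last_b (rv_iter T n)" "last_t (rv_iter S n) = last_t (rv_iter T n)"
    using assms[of n] by (simp_all add: rotation_number_def last_t_def last_b_def)
  then have "step_word (rv_iter S n) = step_word (rv_iter T n)"
    using assms[of n] by (intro ext) (simp add: step_word_def rotation_number_def split: rv_type.split)
  then show ?case using Suc by simp
qed simp

text \<open>The exchange induced after \<open>j\<close> periods has the same rotation number as
  \<open>T\<close>, so every further period is described by the same substitution.\<close>

lemma self_similar_towers:
  assumes T: "is_iet T" and inf: "rv_infinite T" and per: "rv_period T N"
  shows "tower_over (rv_iter T (j * N)) (rv_iter T (Suc j * N)) (rv_word T N)"
proof -
  let ?S = "rv_iter T (j * N)"
  have it: "rv_iter ?S n = rv_iter T (j * N + n)" for n by (simp add: rv_iter_add)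
  have "rotation_number T (n + j * N) = rotation_number T n" for n
  proof (induction j)
    case (Suc j)
    have "rotation_number T (n + Suc j * N) = rotation_number T ((n + j * N) + N)"
      by (simp add: algebra_simps)
    also have "\<dots> = rotation_number T n" using per Suc unfolding rv_period_def by metis
    finally show ?case .
  qed simp
  then have "rotation_number ?S n = rotation_number T n" for n
    by (simp add: rotation_number_def it add.commute)
  then have w: "rv_word ?S N = rv_word T N" by (rule rv_word_cong)
  have "is_iet ?S" using rv_iter_is_iet[OF T inf] by simp
  moreover have "rv_infinite ?S" using inf by (simp add: rv_infinite_def it)
  ultimately have "tower_over ?S (rv_iter ?S N) (rv_word ?S N)" by (rule tower_over_rv_iter)
  then show ?thesis by (simp add: w it add.commute)
qed

section \<open>Words and the combinatorial data\<close>

context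
  fixes T :: "'a::finite iet" and N W
  assumes T: "is_iet T" and TN: "is_iet (rv_iter T N)" and tow: "tower_over T (rv_iter T N) W"
begin

lemma rv_time_word: "rv_time T N a = length (W a)"
  unfolding rv_time_def
  using tower_return_time[OF tow TN] iet_interval_ne[OF TN] by (intro the_equality) force+

lemma tower_letter_word_iff:
  assumes "i < length (W a)"
  shows "(iet_map T ^^ i) ` iet_interval (rv_iter T N) a \<subseteq> iet_interval T b \<longleftrightarrow> W a ! i = b"
proof
  show "(iet_map T ^^ i) ` iet_interval (rv_iter T N) a \<subseteq> iet_interval T b" if "W a ! i = b"
    using that tower_over_D(4)[OF tow _ assms] by auto
  show "W a ! i = b" if s: "(iet_map T ^^ i) ` iet_interval (rv_iter T N) a \<subseteq> iet_interval T b"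
    using s tower_over_D(4)[OF tow iet_interval_ne[OF TN] assms] iet_interval_ne[OF TN]
      iet_interval_unique[OF T] by blast
qed

lemma tower_letter_word:
  assumes "i < length (W a)" shows "tower_letter T N a i = W a ! i"
  unfolding tower_letter_def using tower_letter_word_iff[OF assms] by (intro the_equality) auto

lemma birkhoff_word:
  assumes "i \<le> length (W a)" "x \<in> iet_interval (rv_iter T N) a"
  shows "birkhoff_sum (iet_map T) i (step_fun T v) x = (\<Sum>j<i. v $ (W a ! j))"
  unfolding birkhoff_sum_def
  using assms tower_over_D(4)[OF tow assms(2)] step_fun_in[OF T] by (intro sum.cong) auto

lemma tower_sum_word:
  assumes "i \<le> length (W a)" shows "tower_sum T N v a i = (\<Sum>j<i. v $ (W a ! j))"
  unfolding tower_sum_def using birkhoff_word[OF assms] iet_interval_ne[OF TN]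
  by (intro the_equality) force+

lemma self_sim_matrix_word:
  "self_sim_matrix T N $ a $ b = real (card {k. k < length (W a) \<and> W a ! k = b})"
  unfolding self_sim_matrix_def
  using tower_letter_word_iff by (simp add: rv_time_word cong: conj_cong)

lemma twisted_matrix_word:
  "twisted_matrix T N v $ a $ b =
     (\<Sum>k | k < length (W a) \<and> W a ! k = b. exp (\<Sum>j<k. v $ (W a ! j)))"
  unfolding twisted_matrix_def
  by (auto simp: rv_time_word tower_letter_word tower_sum_word intro!: sum.cong)

end

section \<open>Weighted sums over words under iterated substitution\<close>

section \<open>Words, cocycle sums and twisted matrices\<close>

definition word_sum :: "real ^ 'a \<Rightarrow> 'a list \<Rightarrow> nat \<Rightarrow> real" where
  "word_sum v u k = (\<Sum>j<k. v $ (u ! j))"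

definition word_matrix :: "('a::finite \<Rightarrow> 'a list) \<Rightarrow> real ^ 'a \<Rightarrow> real ^ 'a ^ 'a" where
  "word_matrix W v = (\<chi> a b. \<Sum>k | k < length (W a) \<and> W a ! k = b. exp (word_sum v (W a) k))"

lemma word_matrix_mult:
  "(word_matrix W v *v y) $ a = (\<Sum>k<length (W a). exp (word_sum v (W a) k) * y $ (W a ! k))"
proof -
  have "(word_matrix W v *v y) $ a =
    (\<Sum>b\<in>UNIV. \<Sum>k | k \<in> {..<length (W a)} \<and> W a ! k = b. exp (word_sum v (W a) k) * y $ (W a ! k))"
    unfolding matrix_vector_component word_matrix_def by (auto simp: sum_distrib_right intro!: sum.cong)
  also have "\<dots> = (\<Sum>k<length (W a). exp (word_sum v (W a) k) * y $ (W a ! k))"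
    by (rule sum.group) auto
  finally show ?thesis .
qed

text \<open>So the matrix for the vector 0 is also the renormalization operator: it takes
  \<open>v\<close> to the Birkhoff sums of \<open>step_fun\<close> over the return
  itineraries.\<close>

lemma word_matrix_0_mult: "(word_matrix W 0 *v v) $ a = word_sum v (W a) (length (W a))"
  by (simp add: word_matrix_mult) (simp add: word_sum_def)

lemma word_matrix_0_entry: "word_matrix W 0 $ a $ b = real (card {k. k < length (W a) \<and> W a ! k = b})"
  by (simp add: word_matrix_def word_sum_def)

lemma word_matrix_pos:
  assumes "0 < word_matrix W 0 $ a $ b" shows "0 < word_matrix W v $ a $ b"
proof -
  have "finite {k. k < length (W a) \<and> W a ! k = b}" by simp
  moreover have "{k. k < length (W a) \<and> W a ! k = b} \<noteq> {}"
    using assms by (auto simp: word_matrix_0_entry card_gt_0_iff)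
  ultimately show ?thesis unfolding word_matrix_def by (simp add: sum_pos)
qed

definition word_exp_sum :: "real ^ 'a \<Rightarrow> 'a list \<Rightarrow> real" where
  "word_exp_sum v u = (\<Sum>k<length u. exp (word_sum v u k))"

lemma sum_lessThan_add: "(\<Sum>k<m + (n :: nat). (f k :: real)) = (\<Sum>k<m. f k) + (\<Sum>k<n. f (m + k))"
  by (induction n) (auto simp: add_ac)

lemma word_sum_append1: "k \<le> length u \<Longrightarrow> word_sum v (u @ w) k = word_sum v u k"
  unfolding word_sum_def by (intro sum.cong) (auto simp: nth_append)

lemma word_sum_append2:
  "word_sum v (u @ w) (length u + k) = word_sum v u (length u) + word_sum v w k"
  unfolding word_sum_def sum_lessThan_add by (auto simp: nth_append intro!: sum.cong)

lemma word_exp_sum_append: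
  "word_exp_sum v (u @ w) = word_exp_sum v u + exp (word_sum v u (length u)) * word_exp_sum v w"
proof -
  have "word_exp_sum v (u @ w) = (\<Sum>k<length u. exp (word_sum v (u @ w) k)) +
     (\<Sum>k<length w. exp (word_sum v (u @ w) (length u + k)))"
    unfolding word_exp_sum_def length_append sum_lessThan_add ..
  also have "(\<Sum>k<length u. exp (word_sum v (u @ w) k)) = word_exp_sum v u"
    unfolding word_exp_sum_def by (intro sum.cong) (auto simp: word_sum_append1)
  also have "(\<Sum>k<length w. exp (word_sum v (u @ w) (length u + k))) =
      exp (word_sum v u (length u)) * word_exp_sum v w"
    unfolding word_exp_sum_def word_sum_append2 exp_add sum_distrib_left ..
  finally show ?thesis .
qed

lemma word_sum_concat:
  assumes "\<And>b. word_sum v (g b) (length (g b)) = v' $ b"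
  shows "word_sum v (concat (map g u)) (length (concat (map g u))) = word_sum v' u (length u)"
proof (induction u rule: rev_induct)
  case (snoc x u)
  have "word_sum v (concat (map g (u @ [x]))) (length (concat (map g (u @ [x]))))
    = word_sum v (concat (map g u) @ g x) (length (concat (map g u)) + length (g x))" by simp
  also have "\<dots> = word_sum v' u (length u) + v' $ x"
    unfolding word_sum_append2 by (simp only: snoc assms)
  also have "\<dots> = word_sum v' (u @ [x]) (length u + length [x])"
    unfolding word_sum_append2 by (simp add: word_sum_def)
  finally show ?case by simp
qed (simp add: word_sum_def)

text \<open>Cocycle identity: every position in block \<open>k\<close> carries the common factor
  given by the total sums \<open>v'\<close> of the earlier blocks.\<close>

lemma word_exp_sum_concat:
  assumes v': "\<And>b. word_sum v (g b) (length (g b)) = v' $ b"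
  shows "word_exp_sum v (concat (map g u)) =
    (\<Sum>k<length u. exp (word_sum v' u k) * word_exp_sum v (g (u ! k)))"
proof (induction u rule: rev_induct)
  case (snoc x u)
  have "word_exp_sum v (concat (map g (u @ [x]))) =
     word_exp_sum v (concat (map g u)) + exp (word_sum v' u (length u)) * word_exp_sum v (g x)"
    using word_exp_sum_append[of v "concat (map g u)" "g x"] word_sum_concat[of v g v' u, OF v'] by simp
  also have "word_exp_sum v (concat (map g u)) =
    (\<Sum>k<length u. exp (word_sum v' (u @ [x]) k) * word_exp_sum v (g ((u @ [x]) ! k)))"
    unfolding snoc by (intro sum.cong) (auto simp: nth_append word_sum_append1)
  finally show ?case by (simp add: word_sum_append1)
qed (simp add: word_exp_sum_def)

primrec iter_word :: "('a \<Rightarrow> 'a list) \<Rightarrow> nat \<Rightarrow> 'a \<Rightarrow> 'a list" where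
  "iter_word W 0 = (\<lambda>a. [a])"
| "iter_word W (Suc n) = (\<lambda>a. concat (map (iter_word W n) (W a)))"

abbreviation iter_vec :: "('a::finite \<Rightarrow> 'a list) \<Rightarrow> nat \<Rightarrow> real ^ 'a \<Rightarrow> real ^ 'a" where
  "iter_vec W n v \<equiv> (((*v) (word_matrix W 0)) ^^ n) v"

lemma iter_vec_scaleR: "iter_vec W n (c *\<^sub>R v) = c *\<^sub>R iter_vec W n v"
  by (induction n) (auto simp: matrix_vector_mult_scaleR)

lemma word_sum_iter_word:
  "word_sum v (iter_word W n a) (length (iter_word W n a)) = iter_vec W n v $ a"
proof (induction n arbitrary: a)
  case (Suc n)
  show ?case unfolding iter_word.simps
    by (subst word_sum_concat[of v "iter_word W n", OF Suc]) (simp add: word_matrix_0_mult)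
qed (simp add: word_sum_def)

text \<open>Partition functions of statistical mechanics: per letter, the total Birkhoff weight of
  the levels of its tower at stage \<open>n\<close>.\<close>

definition part_fun :: "('a::finite \<Rightarrow> 'a list) \<Rightarrow> real ^ 'a \<Rightarrow> nat \<Rightarrow> real ^ 'a" where
  "part_fun W v n = (\<chi> a. word_exp_sum v (iter_word W n a))"

text \<open>The matrix depends on \<open>n\<close> because the new blocks are weighted by sums over
  whole level-\<open>n\<close> words, and these form the vector
  \<open>iter_vec W n v\<close>.\<close>

lemma part_fun_Suc: "part_fun W v (Suc n) = word_matrix W (iter_vec W n v) *v part_fun W v n"
  unfolding vec_eq_iff word_matrix_mult
  by (simp add: part_fun_def word_exp_sum_concat[of v "iter_word W n", OF word_sum_iter_word])

section \<open>Conformality as a local scaling rule that passes to induced exchanges\<close>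

section \<open>Scaling measures\<close>

text \<open>Neither total mass 1 nor finiteness is part of the notion, so Lebesgue measure on the
  line fits with \<open>v = 0\<close> and lengths are treated like conformal measures.\<close>

definition scales :: "real measure \<Rightarrow> 'a::finite iet \<Rightarrow> real ^ 'a \<Rightarrow> bool" where
  "scales \<mu> T v \<longleftrightarrow> sets \<mu> = sets borel \<and>
     (\<forall>a A. A \<in> sets borel \<and> A \<subseteq> iet_interval T a \<longrightarrow>
        emeasure \<mu> (iet_map T ` A) = ennreal (exp (v $ a)) * emeasure \<mu> A)"

lemma iet_image_borel:
  assumes "is_iet T" "A \<in> sets borel" shows "iet_map T ` A \<in> sets borel"
proof -
  have "iet_map T ` A = inv (iet_map T) -` A"
    using bij_vimage_eq_inv_image[OF bij_imp_bij_inv[OF iet_map_bij[OF assms(1)]]]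
    by (simp add: inv_inv_eq iet_map_bij[OF assms(1)])
  then show ?thesis using measurable_sets[OF inv_iet_map_measurable[OF assms(1)] assms(2)] by simp
qed

lemma iet_interval_borel [measurable]: "iet_interval T a \<in> sets borel"
  by (simp add: iet_interval_def)

lemma conformal_scales:
  assumes T: "is_iet T" and c: "conformal_measure T v \<nu>"
  shows "scales \<nu> T v"
  unfolding scales_def
proof (intro conjI allI impI)
  have s: "sets \<nu> = sets borel" and
    d: "distr \<nu> borel (inv (iet_map T)) = density \<nu> (\<lambda>x. ennreal (exp (step_fun T v x)))"
    using c by (auto simp: conformal_measure_def)
  show "sets \<nu> = sets borel" by (rule s)
  fix a A assume A: "A \<in> sets borel \<and> A \<subseteq> iet_interval T a"
  have im: "iet_map T ` A = inv (iet_map T) -` A"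
    using bij_vimage_eq_inv_image[OF bij_imp_bij_inv[OF iet_map_bij[OF T]]]
    by (simp add: inv_inv_eq iet_map_bij[OF T])
  have sp: "space \<nu> = UNIV" using sets_eq_imp_space_eq[OF s] by simp
  have m: "inv (iet_map T) \<in> measurable \<nu> borel"
    using inv_iet_map_measurable[OF T] measurable_cong_sets[OF s refl] by blast
  have ms: "step_fun T v \<in> borel_measurable \<nu>"
    using step_fun_measurable[OF T] measurable_cong_sets[OF s refl] by blast
  have "emeasure \<nu> (iet_map T ` A) = emeasure (distr \<nu> borel (inv (iet_map T))) A"
    using A m by (simp add: emeasure_distr im sp)
  also have "\<dots> = (\<integral>\<^sup>+x. ennreal (exp (step_fun T v x)) * indicator A x \<partial>\<nu>)"
    unfolding d using A s ms by (intro emeasure_density) auto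
  also have "\<dots> = (\<integral>\<^sup>+x. ennreal (exp (v $ a)) * indicator A x \<partial>\<nu>)"
    using A by (intro nn_integral_cong) (auto simp: indicator_def step_fun_in[OF T, of _ a])
  also have "\<dots> = ennreal (exp (v $ a)) * emeasure \<nu> A"
    using A s by (simp add: nn_integral_cmult_indicator)
  finally show "emeasure \<nu> (iet_map T ` A) = ennreal (exp (v $ a)) * emeasure \<nu> A" .
qed

lemma lborel_scales:
  assumes T: "is_iet T" shows "scales lborel T 0"
  unfolding scales_def
proof (intro conjI allI impI)
  fix a A assume A: "A \<in> sets (borel :: real measure) \<and> A \<subseteq> iet_interval T a"
  define c where "c = left_b T a - left_t T a"
  have "iet_map T ` A = (\<lambda>x. c + x) ` A"
    using A iet_map_in[OF T, of _ a] by (intro image_cong) (auto simp: c_def)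
  also have "\<dots> = (\<lambda>x. -c + x) -` A"
  proof (intro set_eqI iffI)
    fix y assume "y \<in> (\<lambda>x. -c + x) -` A"
    then show "y \<in> (\<lambda>x. c + x) ` A" by (intro image_eqI[of y _ "-c + y"]) auto
  qed auto
  finally have im: "iet_map T ` A = (\<lambda>x. -c + x) -` A" .
  have "emeasure lborel (iet_map T ` A) = emeasure (distr lborel borel ((+) (-c))) A"
    unfolding im using A by (subst emeasure_distr) auto
  then show "emeasure lborel (iet_map T ` A) = ennreal (exp ((0 :: real ^ 'a) $ a)) * emeasure lborel A"
    by (simp add: lborel_distr_plus)
qed simp

context
  fixes T T' :: "'a::finite iet" and W \<mu> v
  assumes T: "is_iet T" and T': "is_iet T'" and tow: "tower_over T T' W" and sc: "scales \<mu> T v"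
begin

lemma scales_level:
  assumes A: "A \<in> sets borel" "A \<subseteq> iet_interval T' a" and k: "k \<le> length (W a)"
  shows "(iet_map T ^^ k) ` A \<in> sets borel \<and>
    emeasure \<mu> ((iet_map T ^^ k) ` A) = ennreal (exp (word_sum v (W a) k)) * emeasure \<mu> A"
  using k
proof (induction k)
  case 0 then show ?case using A by (simp add: word_sum_def)
next
  case (Suc k)
  let ?B = "(iet_map T ^^ k) ` A"
  have B: "?B \<in> sets borel" "emeasure \<mu> ?B = ennreal (exp (word_sum v (W a) k)) * emeasure \<mu> A"
    using Suc by auto
  have sub: "?B \<subseteq> iet_interval T (W a ! k)" using A tower_over_D(4)[OF tow] Suc.prems by auto
  have im: "(iet_map T ^^ Suc k) ` A = iet_map T ` ?B" by (simp add: image_comp)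
  have "emeasure \<mu> (iet_map T ` ?B) = ennreal (exp (v $ (W a ! k))) * emeasure \<mu> ?B"
    using sc sub B(1) by (auto simp: scales_def)
  then show ?case unfolding im using B iet_image_borel[OF T B(1)]
    by (simp add: word_sum_def exp_add ennreal_mult mult_ac)
qed

text \<open>The same measure, not rescaled, is conformal for the induced exchange; the return sums
  become the new vector.\<close>

lemma scales_induced: "scales \<mu> T' (word_matrix W 0 *v v)"
  unfolding scales_def
proof (intro conjI allI impI)
  show "sets \<mu> = sets borel" using sc by (simp add: scales_def)
  fix a A assume A: "A \<in> sets (borel :: real measure) \<and> A \<subseteq> iet_interval T' a"
  then have "iet_map T' ` A = (iet_map T ^^ length (W a)) ` A"
    using tower_over_D(6)[OF tow] by (intro image_cong) auto
  then show "emeasure \<mu> (iet_map T' ` A) = ennreal (exp ((word_matrix W 0 *v v) $ a)) * emeasure \<mu> A"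
    using scales_level[of A a "length (W a)"] A by (simp add: word_matrix_0_mult)
qed

text \<open>The interval of \<open>b\<close> is the disjoint union of the tower levels over
  \<open>T'\<close> that carry the letter \<open>b\<close>, and each level has its Birkhoff weight
  times the measure of its base.\<close>

lemma scales_partition:
  assumes fin: "\<And>a. emeasure \<mu> (iet_interval T' a) < \<infinity>"
  shows "(\<chi> b. measure \<mu> (iet_interval T b)) = (\<chi> a. measure \<mu> (iet_interval T' a)) v* word_matrix W v"
    (is "?l = ?l' v* _")
proof -
  have "?l $ b = (?l' v* word_matrix W v) $ b" for b
  proof -
    define P where "P = (SIGMA a:UNIV. {k. k < length (W a) \<and> W a ! k = b})"
    define F where "F = (\<lambda>(a, k). (iet_map T ^^ k) ` iet_interval T' a)"
    have finP: "finite P" unfolding P_def by (intro finite_SigmaI) auto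
    have sets: "F p \<in> sets \<mu>" "emeasure \<mu> (F p) =
        (case p of (a, k) \<Rightarrow> ennreal (exp (word_sum v (W a) k)) * emeasure \<mu> (iet_interval T' a))"
      if "p \<in> P" for p
      using that scales_level[of "iet_interval T' (fst p)" "fst p" "snd p"] sc
      by (auto simp: P_def F_def scales_def)
    have "disjoint_family_on F P"
      unfolding disjoint_family_on_def
    proof (intro ballI impI)
      fix p q assume pq: "p \<in> P" "q \<in> P" "p \<noteq> q"
      show "F p \<inter> F q = {}"
      proof (rule ccontr)
        assume "F p \<inter> F q \<noteq> {}"
        obtain a i c j where p: "p = (a, i)" and q: "q = (c, j)" by (metis surj_pair)
        from \<open>F p \<inter> F q \<noteq> {}\<close> obtain x y where "x \<in> iet_interval T' a" "y \<in> iet_interval T' c"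
          "(iet_map T ^^ i) x = (iet_map T ^^ j) y"
          unfolding F_def p q prod.case by blast
        moreover have "i < length (W a)" "j < length (W c)" using pq p q by (auto simp: P_def)
        ultimately have "a = c \<and> i = j" using tower_levels_unique[OF tow T T'] by metis
        then show False using pq(3) p q by simp
      qed
    qed
    moreover have "(\<Union>p\<in>P. F p) = iet_interval T b"
    proof
      show "(\<Union>p\<in>P. F p) \<subseteq> iet_interval T b"
        using tower_over_D(4)[OF tow] by (auto simp: P_def F_def)
      show "iet_interval T b \<subseteq> (\<Union>p\<in>P. F p)"
      proof
        fix y assume y: "y \<in> iet_interval T b"
        then obtain a x i where x: "x \<in> iet_interval T' a" "i < length (W a)" "y = (iet_map T ^^ i) x"
          using tower_over_D(7)[OF tow] iet_interval_subset[OF T] by blast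
        then have "W a ! i = b" using tower_over_D(4)[OF tow x(1,2)] iet_interval_unique[OF T y] by metis
        then have "(a, i) \<in> P" "y \<in> F (a, i)" using x by (auto simp: P_def F_def)
        then show "y \<in> (\<Union>p\<in>P. F p)" by blast
      qed
    qed
    moreover have "F ` P \<subseteq> sets \<mu>" using sets(1) by blast
    ultimately have e: "emeasure \<mu> (iet_interval T b) = (\<Sum>p\<in>P. emeasure \<mu> (F p))"
      using sum_emeasure[of F P \<mu>] finP by simp
    define G where "G = (\<lambda>(a, k). exp (word_sum v (W a) k) * measure \<mu> (iet_interval T' a))"
    have G0: "0 \<le> G p" for p by (auto simp: G_def split: prod.splits)
    have "emeasure \<mu> (F p) = ennreal (G p)" if "p \<in> P" for p
    proof -
      obtain a k where p: "p = (a, k)" by (metis surj_pair)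
      have "emeasure \<mu> (iet_interval T' a) = ennreal (measure \<mu> (iet_interval T' a))"
        using fin[of a] by (intro emeasure_eq_ennreal_measure) auto
      then show ?thesis using sets(2)[OF that] by (simp add: p G_def ennreal_mult')
    qed
    then have "emeasure \<mu> (iet_interval T b) = (\<Sum>p\<in>P. ennreal (G p))"
      unfolding e by (intro sum.cong) auto
    also have "\<dots> = ennreal (\<Sum>p\<in>P. G p)" using G0 by (simp add: sum_ennreal)
    finally have "measure \<mu> (iet_interval T b) = (\<Sum>p\<in>P. G p)"
      using G0 by (simp add: measure_def sum_nonneg)
    also have "\<dots> = (\<Sum>a\<in>UNIV. \<Sum>k | k < length (W a) \<and> W a ! k = b.
        exp (word_sum v (W a) k) * measure \<mu> (iet_interval T' a))"
      unfolding P_def G_def by (subst sum.Sigma) auto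
    finally show ?thesis
      by (simp add: vector_matrix_mult_def word_matrix_def sum_distrib_left mult.commute)
  qed
  then show ?thesis by (simp add: vec_eq_iff)
qed

end

section \<open>Sequences of induced exchanges\<close>

text \<open>In the application \<open>S n\<close> is the exchange induced after \<open>n\<close>
  periods, on its actual shrinking domain; only the word map \<open>W\<close> is the same at all
  levels.\<close>

locale iet_sequence =
  fixes S :: "nat \<Rightarrow> 'a::finite iet" and W :: "'a \<Rightarrow> 'a list"
  assumes iet: "\<And>n. is_iet (S n)" and tow: "\<And>n. tower_over (S n) (S (Suc n)) W"
    and pos: "\<And>a b. 0 < word_matrix W 0 $ a $ b"
begin

lemma tower_iter: "tower_over (S 0) (S n) (iter_word W n)"
proof (induction n)
  case 0 then show ?case using tower_over_id[OF iet] by simp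
next
  case (Suc n)
  from tower_over_trans[OF Suc tow iet] show ?case by simp
qed

lemma scales_iter:
  assumes "scales \<mu> (S 0) v" shows "scales \<mu> (S n) (iter_vec W n v)"
proof (induction n)
  case (Suc n)
  from scales_induced[OF iet iet tow Suc] show ?case by simp
qed (simp add: assms)

definition cyl :: "nat \<Rightarrow> 'a \<Rightarrow> nat \<Rightarrow> real set" where
  "cyl n a k = (iet_map (S 0) ^^ k) ` iet_interval (S n) a"

lemma cyl_interval:
  assumes "k < length (iter_word W n a)"
  shows "\<exists>c. cyl n a k = {c ..< c + len (S n) $ a}"
proof -
  have "\<exists>c. \<forall>x\<in>iet_interval (S n) a. (iet_map (S 0) ^^ k) x = x + c"
    using less_imp_le[OF assms]
  proof (induction k)
    case (Suc k)
    then obtain c where c: "\<forall>x\<in>iet_interval (S n) a. (iet_map (S 0) ^^ k) x = x + c" by auto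
    let ?b = "iter_word W n a ! k"
    have "iet_map (S 0) (x + c) = x + (c + left_b (S 0) ?b - left_t (S 0) ?b)"
      if "x \<in> iet_interval (S n) a" for x
      using iet_map_in[OF iet, of "x + c" 0 ?b] tower_over_D(4)[OF tower_iter that, of k] c that Suc.prems by auto
    then show ?case using c by auto
  qed (auto intro: exI[of _ 0])
  then obtain c where "\<forall>x\<in>iet_interval (S n) a. (iet_map (S 0) ^^ k) x = x + c" by blast
  then have "cyl n a k = (\<lambda>x. x + c) ` iet_interval (S n) a" by (auto simp: cyl_def)
  also have "\<dots> = {left_t (S n) a + c ..< left_t (S n) a + c + len (S n) $ a}"
    by (auto simp: iet_interval_def image_iff intro: bexI[of _ "_ - c"])
  finally show ?thesis by blast
qed

text \<open>Follows from uniqueness of tower levels for the composed tower of height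
  \<open>iter_word W n\<close> over \<open>S n\<close>.\<close>

lemma cyl_disjoint:
  assumes "k < length (iter_word W n a)" "j < length (iter_word W n b)"
    "x \<in> cyl n a k" "x \<in> cyl n b j"
  shows "a = b \<and> k = j"
  using tower_levels_unique[OF tower_iter iet iet _ assms(1) _ assms(2)] assms(3,4)
  by (auto simp: cyl_def)

lemma cyl_cover: "x \<in> iet_dom (S 0) \<Longrightarrow> \<exists>a. \<exists>k<length (iter_word W n a). x \<in> cyl n a k"
  using tower_over_D(7)[OF tower_iter[of n]] unfolding cyl_def by blast

lemma cyl_measure:
  assumes "scales \<mu> (S 0) v" "k < length (iter_word W n a)" "emeasure \<mu> (iet_interval (S n) a) < \<infinity>"
  shows "cyl n a k \<in> sets borel"
    "emeasure \<mu> (cyl n a k) = ennreal (exp (word_sum v (iter_word W n a) k) * measure \<mu> (iet_interval (S n) a))"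
  using scales_level[OF iet iet tower_iter assms(1), of "iet_interval (S n) a" n a k] assms
  by (auto simp: cyl_def ennreal_mult emeasure_eq_ennreal_measure top.not_eq_extremum)

end

section \<open>Growth along products of positive matrices that converge to a limit\<close>

section \<open>Growth rates\<close>

lemma seq_growth:
  fixes x :: "nat \<Rightarrow> real"
  assumes ev: "eventually (\<lambda>n. x (Suc n) \<le> exp c * x n) sequentially"
  shows "\<exists>K>0. \<forall>n. x n \<le> K * exp (real n * c)"
proof -
  obtain n0 where n0: "\<And>n. n \<ge> n0 \<Longrightarrow> x (Suc n) \<le> exp c * x n"
    using ev by (auto simp: eventually_sequentially)
  \<comment> \<open>After removing the expected rate the sequence decreases from \<open>n0\<close>
    on; the finitely many earlier values only enlarge the constant.\<close>
  define y where "y n = x n * exp (- (real n * c))" for n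
  have dec: "y (Suc n) \<le> y n" if "n \<ge> n0" for n
  proof -
    have "y (Suc n) \<le> (exp c * x n) * exp (- (real (Suc n) * c))"
      unfolding y_def using n0[OF that] by (intro mult_right_mono) auto
    also have "\<dots> = y n" by (simp add: y_def exp_add[symmetric] exp_minus field_simps exp_add)
    finally show ?thesis .
  qed
  have le: "y n \<le> y n0" if "n \<ge> n0" for n
    using that by (induction rule: dec_induct) (auto intro: order_trans dec)
  define K where "K = Max (insert 1 (y ` {..n0}))"
  have "1 \<le> K" unfolding K_def by (intro Max_ge) auto
  moreover have "y n \<le> K" for n
  proof (cases "n \<le> n0")
    case True then show ?thesis unfolding K_def by (intro Max_ge) auto
  next
    case False
    have "y n0 \<le> K" unfolding K_def by (intro Max_ge) auto
    then show ?thesis using le[of n] False by simp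
  qed
  moreover have "x n = y n * exp (real n * c)" for n by (simp add: y_def exp_minus)
  ultimately show ?thesis by (intro exI[of _ K]) (auto intro: mult_right_mono)
qed

lemma tendsto_word_matrix:
  assumes "u \<longlonglongrightarrow> w"
  shows "(\<lambda>n. word_matrix W (u n) $ a $ b) \<longlonglongrightarrow> word_matrix W w $ a $ b"
  unfolding word_matrix_def word_sum_def
  by (simp, intro tendsto_intros tendsto_vec_nth assms)

lemma tendsto_word_matrix_mult:
  assumes "u \<longlonglongrightarrow> w"
  shows "(\<lambda>n. (word_matrix W (u n) *v y) $ a) \<longlonglongrightarrow> (word_matrix W w *v y) $ a"
  unfolding matrix_vector_component by (intro tendsto_intros tendsto_word_matrix assms)


lemma seq_lower_bound:
  fixes f :: "nat \<Rightarrow> real"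
  assumes "\<And>n. 0 < f n" "f \<longlonglongrightarrow> c" "0 < c"
  shows "\<exists>K>0. \<forall>n. 1 \<le> K * f n"
proof -
  have "(\<lambda>n. 1 / f n) \<longlonglongrightarrow> 1 / c" using assms by (intro tendsto_intros) auto
  then have "Bseq (\<lambda>n. 1 / f n)" by (intro convergent_imp_Bseq convergentI)
  then obtain K where K: "0 < K" "\<And>n. norm (1 / f n) \<le> K" by (auto elim: BseqE)
  have "1 \<le> K * f n" for n using K(2)[of n] assms(1)[of n] by (simp add: field_simps)
  then show ?thesis using K by blast
qed

text \<open>\<open>L n\<close> stands for the vector of measures of the exchanged intervals at level \<open>n\<close>, paired with
  the right eigenvector \<open>th\<close> of the limit matrix.\<close>

locale left_recursion =
  fixes W :: "'a::finite \<Rightarrow> 'a list" and u :: "nat \<Rightarrow> real ^ 'a" and w th :: "real ^ 'a" and r :: real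
    and L :: "nat \<Rightarrow> real ^ 'a"
  assumes pos0: "\<And>a b. 0 < word_matrix W 0 $ a $ b" and u: "u \<longlonglongrightarrow> w"
    and th: "\<And>a. 0 < th $ a" "word_matrix W w *v th = r *s th" and r: "0 < r"
    and L0: "L 0 \<noteq> 0" and Lnn: "\<And>n a. 0 \<le> L n $ a"
    and rec: "\<And>n. L n = L (Suc n) v* word_matrix W (u n)"
begin

lemma pos: "0 < word_matrix W v $ a $ b" by (rule word_matrix_pos[OF pos0])

lemma L_nz: "L n \<noteq> 0"
proof (induction n)
  case (Suc n)
  then show ?case using rec[of n] by (metis vector_matrix_mult_0)
qed (rule L0)

lemma pair_pos: "0 < L n \<bullet> th"
proof -
  obtain a where "L n $ a \<noteq> 0" using L_nz[of n] by (auto simp: vec_eq_iff)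
  then have "0 < L n $ a * th $ a" using Lnn[of n a] th(1)[of a] by simp
  then show ?thesis unfolding inner_vec_def
    using Lnn th(1) by (intro sum_pos2[of _ a]) (auto simp: less_imp_le)
qed

lemma pair_rec: "L n \<bullet> th = L (Suc n) \<bullet> (word_matrix W (u n) *v th)"
  unfolding rec[of n] by (rule dot_lmul_matrix)

text \<open>One positive matrix already mixes all letters: each component at level \<open>n\<close>
  dominates the whole mass at level \<open>Suc n\<close>. The constant is uniform in
  \<open>n\<close> since the entries converge to positive limits.\<close>

lemma component_bounds:
  "\<exists>K>0. \<forall>n a. L n $ a \<le> K * (L n \<bullet> th) \<and> L (Suc n) \<bullet> th \<le> K * L n $ a"
proof -
  define K1 where "K1 = (\<Sum>a\<in>UNIV. 1 / th $ a)"
  have K1: "1 / th $ a \<le> K1" for a unfolding K1_def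
    using th(1) by (intro member_le_sum) (auto simp: less_imp_le)
  have up: "L n $ a \<le> K1 * (L n \<bullet> th)" for n a
  proof -
    have "L n $ a * th $ a \<le> L n \<bullet> th" unfolding inner_vec_def inner_real_def
      using Lnn th(1) by (intro member_le_sum[of a UNIV "\<lambda>a. L n $ a * th $ a"]) (auto simp: less_imp_le)
    then have "L n $ a \<le> (1 / th $ a) * (L n \<bullet> th)" using th(1)[of a] by (simp add: field_simps)
    also have "\<dots> \<le> K1 * (L n \<bullet> th)" using K1 pair_pos[of n] by (intro mult_right_mono) auto
    finally show ?thesis .
  qed
  have "\<exists>K. 0 < K \<and> (\<forall>n. 1 \<le> K * word_matrix W (u n) $ a $ b)" for a b
    using seq_lower_bound[OF pos tendsto_word_matrix[OF u] pos] by blast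
  then obtain KK where KK: "\<And>a b. 0 < KK a b" "\<And>a b n. 1 \<le> KK a b * word_matrix W (u n) $ a $ b"
    by metis
  define K2 where "K2 = (\<Sum>a\<in>UNIV. \<Sum>b\<in>UNIV. th $ a * KK a b)"
  have K2: "th $ a * KK a b \<le> K2" for a b
  proof -
    have "th $ a * KK a b \<le> (\<Sum>b\<in>UNIV. th $ a * KK a b)"
      using KK th(1) by (intro member_le_sum[of b UNIV "\<lambda>b. th $ a * KK a b"]) (auto simp: less_imp_le)
    also have "\<dots> \<le> K2" unfolding K2_def
      using KK th(1) by (intro member_le_sum[of a UNIV "\<lambda>a. \<Sum>b\<in>UNIV. th $ a * KK a b"])
        (auto simp: less_imp_le intro!: sum_nonneg)
    finally show ?thesis .
  qed
  have lo: "L (Suc n) \<bullet> th \<le> K2 * L n $ b" for n b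
  proof -
    have "L (Suc n) \<bullet> th = (\<Sum>a\<in>UNIV. L (Suc n) $ a * th $ a)" by (simp add: inner_vec_def)
    also have "\<dots> \<le> (\<Sum>a\<in>UNIV. K2 * (L (Suc n) $ a * word_matrix W (u n) $ a $ b))"
    proof (rule sum_mono)
      fix a
      have "th $ a * 1 \<le> th $ a * (KK a b * word_matrix W (u n) $ a $ b)"
        using KK(2) th(1)[of a] by (intro mult_left_mono) auto
      also have "\<dots> \<le> K2 * word_matrix W (u n) $ a $ b"
        using K2[of a b] pos[of "u n" a b] by (simp add: mult.assoc[symmetric])
      finally have "L (Suc n) $ a * th $ a \<le> L (Suc n) $ a * (K2 * word_matrix W (u n) $ a $ b)"
        using Lnn by (intro mult_left_mono) auto
      then show "L (Suc n) $ a * th $ a \<le> K2 * (L (Suc n) $ a * word_matrix W (u n) $ a $ b)"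
        by (simp add: mult_ac)
    qed
    also have "\<dots> = K2 * L n $ b"
      by (simp add: rec[of n] vector_matrix_mult_def sum_distrib_left mult_ac)
    finally show ?thesis .
  qed
  define K where "K = max 1 (max K1 K2)"
  have "L n $ a \<le> K * (L n \<bullet> th)" for n a
    using up[of n a] pair_pos[of n] by (smt (verit) K_def mult_right_mono)
  moreover have "L (Suc n) \<bullet> th \<le> K * L n $ a" for n a
    using lo[of n a] Lnn[of n a] by (smt (verit) K_def mult_right_mono)
  moreover have "0 < K" by (simp add: K_def)
  ultimately show ?thesis by blast
qed

text \<open>By \<open>pair_rec\<close> and convergence of the matrices, passing to the next level
  eventually divides the pairing with \<open>th\<close> by at least
  \<open>exp (ln r - \<epsilon>)\<close>.\<close>

lemma upper_growth:
  assumes "0 < \<epsilon>"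
  shows "\<exists>K>0. \<forall>n a. L n $ a \<le> K * exp (- real n * (ln r - \<epsilon>))"
proof -
  have "eventually (\<lambda>n. exp (ln r - \<epsilon>) * th $ a < (word_matrix W (u n) *v th) $ a) sequentially" for a
  proof (rule order_tendstoD(1)[OF tendsto_word_matrix_mult[OF u]])
    have "exp (ln r - \<epsilon>) < r" using assms r by (simp add: exp_diff field_simps)
    then show "exp (ln r - \<epsilon>) * th $ a < (word_matrix W w *v th) $ a" using th(1)[of a] by (simp add: th(2))
  qed
  then have "eventually (\<lambda>n. \<forall>a. exp (ln r - \<epsilon>) * th $ a < (word_matrix W (u n) *v th) $ a) sequentially"
    by (rule eventually_all_finite)
  then have "eventually (\<lambda>n. L (Suc n) \<bullet> th \<le> exp (- (ln r - \<epsilon>)) * (L n \<bullet> th)) sequentially"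
  proof eventually_elim
    case (elim n)
    have "exp (ln r - \<epsilon>) * (L (Suc n) \<bullet> th) = (\<Sum>a\<in>UNIV. L (Suc n) $ a * (exp (ln r - \<epsilon>) * th $ a))"
      by (simp add: inner_vec_def sum_distrib_left mult_ac)
    also have "\<dots> \<le> (\<Sum>a\<in>UNIV. L (Suc n) $ a * (word_matrix W (u n) *v th) $ a)"
      using elim Lnn by (intro sum_mono mult_left_mono) (auto simp: less_imp_le)
    also have "\<dots> = L n \<bullet> th" unfolding pair_rec by (simp add: inner_vec_def)
    finally have "exp (ln r - \<epsilon>) * (L (Suc n) \<bullet> th) \<le> L n \<bullet> th" .
    then have "exp (- (ln r - \<epsilon>)) * (exp (ln r - \<epsilon>) * (L (Suc n) \<bullet> th)) \<le> exp (- (ln r - \<epsilon>)) * (L n \<bullet> th)"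
      by (intro mult_left_mono) auto
    then show ?case by (simp add: mult.assoc[symmetric] exp_add[symmetric] del: minus_diff_eq)
  qed
  from seq_growth[OF this] obtain K where K: "0 < K" "\<And>n. L n \<bullet> th \<le> K * exp (real n * - (ln r - \<epsilon>))"
    by blast
  obtain K' where K': "0 < K'" "\<And>n a. L n $ a \<le> K' * (L n \<bullet> th)" using component_bounds by blast
  have "L n $ a \<le> (K' * K) * exp (- real n * (ln r - \<epsilon>))" for n a
  proof -
    have "K' * (L n \<bullet> th) \<le> K' * (K * exp (real n * - (ln r - \<epsilon>)))"
      using K K' by (intro mult_left_mono) auto
    also have "\<dots> = (K' * K) * exp (- real n * (ln r - \<epsilon>))" by (simp add: algebra_simps)
    finally show ?thesis using K'(2)[of n a] by linarith
  qed
  then show ?thesis using K(1) K'(1) by (intro exI[of _ "K' * K"]) auto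
qed

text \<open>With equal matrices the pairing is divided by exactly \<open>r\<close>, so there is no
  exponential loss; the level shift in \<open>component_bounds\<close> costs only a factor
  \<open>r\<close>.\<close>

lemma constant_growth:
  assumes "\<And>n. u n = w"
  shows "\<exists>K>0. \<forall>n a. L n $ a \<le> K * exp (- real n * ln r) \<and> exp (- real n * ln r) \<le> K * L n $ a"
proof -
  have step: "L n \<bullet> th = r * (L (Suc n) \<bullet> th)" for n
    using pair_rec[of n] by (simp add: assms th scalar_mult_eq_scaleR)
  have x: "L n \<bullet> th = exp (- real n * ln r) * (L 0 \<bullet> th)" for n
  proof (induction n)
    case (Suc n)
    have "exp (- real (Suc n) * ln r) = exp (- real n * ln r) / r"
      using r by (simp add: algebra_simps exp_add exp_diff exp_minus field_simps)
    then have "exp (- real n * ln r) = r * exp (- real (Suc n) * ln r)" using r by simp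
    then have "r * (L (Suc n) \<bullet> th) = r * (exp (- real (Suc n) * ln r) * (L 0 \<bullet> th))"
      using step[of n] Suc by (metis mult.assoc)
    then show ?case using r by simp
  qed simp
  obtain K where K: "0 < K" "\<And>n a. L n $ a \<le> K * (L n \<bullet> th)" "\<And>n a. L (Suc n) \<bullet> th \<le> K * L n $ a"
    using component_bounds by blast
  let ?x = "L 0 \<bullet> th"
  have x0: "0 < ?x" by (rule pair_pos)
  define K' where "K' = max (K * ?x) (K * r / ?x)"
  have "L n $ a \<le> K' * exp (- real n * ln r)" for n a
  proof -
    have "L n $ a \<le> (K * ?x) * exp (- real n * ln r)" using K(2)[of n a] x[of n] by (simp add: mult_ac)
    also have "\<dots> \<le> K' * exp (- real n * ln r)" unfolding K'_def by (intro mult_right_mono) auto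
    finally show ?thesis .
  qed
  moreover have "exp (- real n * ln r) \<le> K' * L n $ a" for n a
  proof -
    have "exp (- real n * ln r) * ?x = r * (L (Suc n) \<bullet> th)" using x[of n] step[of n] by simp
    also have "\<dots> \<le> r * (K * L n $ a)" using K(3)[of n a] r by (intro mult_left_mono) auto
    finally have "exp (- real n * ln r) \<le> (K * r / ?x) * L n $ a" using x0 by (simp add: field_simps)
    also have "\<dots> \<le> K' * L n $ a" unfolding K'_def using Lnn by (intro mult_right_mono) auto
    finally show ?thesis .
  qed
  moreover have "0 < K'" using K(1) x0 by (simp add: K'_def less_max_iff_disj)
  ultimately show ?thesis by blast
qed

end

section \<open>First-order perturbation of the Perron eigenvalue in the exponent
  \<open>s\<close>\<close>

section \<open>The pressure function near 1\<close>

text \<open>The first-order coefficient at \<open>s = 1\<close> of the logarithm of the Perron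
  eigenvalue of \<open>word_matrix W (s *\<^sub>R w)\<close>, written in the form of the double sum
  in the entropy formula.\<close>

definition pressure_slope :: "('a::finite \<Rightarrow> 'a list) \<Rightarrow> real ^ 'a \<Rightarrow> real" where
  "pressure_slope W w = (\<Sum>a\<in>UNIV. \<Sum>k<length (W a).
     snd (pf_vectors (word_matrix W w)) $ (W a ! k) * exp (- ln (pf_eigenvalue (word_matrix W w))) *
     fst (pf_vectors (word_matrix W w)) $ a * exp (word_sum w (W a) k) * word_sum w (W a) k)"

lemma word_sum_scaleR: "word_sum (s *\<^sub>R w) u k = s * word_sum w u k"
  by (simp add: word_sum_def sum_distrib_left)

context
  fixes W :: "'a::finite \<Rightarrow> 'a list" and w :: "real ^ 'a"
  assumes pos0: "\<And>a b. 0 < word_matrix W 0 $ a $ b"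
begin

private abbreviation "A \<equiv> word_matrix W w"
private abbreviation "r \<equiv> pf_eigenvalue A"
private abbreviation "l \<equiv> fst (pf_vectors A)"
private abbreviation "th \<equiv> snd (pf_vectors A)"

lemma pf_word:
  "0 < r" "\<And>i. 0 < l $ i" "\<And>i. 0 < th $ i" "l v* A = r *s l" "A *v th = r *s th"
    "(\<Sum>i\<in>UNIV. l $ i) = 1" "l \<bullet> th = 1"
  using pf_spec[OF word_matrix_pos[OF pos0]] by auto

text \<open>Derivative at \<open>s = 1\<close> of the matrix twisted by \<open>s w\<close>, applied
  to the unchanged eigenvector \<open>th\<close>.\<close>

definition deriv_vec :: "real ^ 'a" where
  "deriv_vec = (\<chi> a. \<Sum>k<length (W a). exp (word_sum w (W a) k) * word_sum w (W a) k * th $ (W a ! k))"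

lemma slope_deriv_vec: "l \<bullet> deriv_vec = r * pressure_slope W w"
  unfolding deriv_vec_def pressure_slope_def inner_vec_def sum_distrib_left
  using pf_word(1) by (simp add: sum_distrib_left, intro sum.cong refl) (simp add: exp_minus field_simps)

text \<open>Pairing the right-hand side with \<open>l\<close> gives 0 precisely because of the value
  of the slope, so the Fredholm alternative applies.\<close>

lemma test_direction: "\<exists>g. \<forall>a. r * g $ a - (A *v g) $ a = deriv_vec $ a - r * pressure_slope W w * th $ a"
proof -
  have "l \<bullet> (deriv_vec - (r * pressure_slope W w) *\<^sub>R th) = 0"
    by (simp add: inner_diff_right slope_deriv_vec pf_word(7))
  from pf_fredholm[OF word_matrix_pos[OF pos0] pf_word(4,3,5,7) this]
  obtain g where "r *\<^sub>R g - A *v g = deriv_vec - (r * pressure_slope W w) *\<^sub>R th" by blast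
  then show ?thesis by (metis real_scaleR_def vector_minus_component vector_scaleR_component)
qed

text \<open>The first-order perturbation \<open>th + (s - 1) g\<close> of the right eigenvector is an approximate
  eigenvector of the matrix twisted by \<open>s w\<close>, to first order in \<open>s - 1\<close>.\<close>

lemma test_vector:
  assumes \<eta>: "0 < \<eta>"
  shows "\<exists>\<delta>>0. \<forall>s. \<bar>s - 1\<bar> < \<delta> \<longrightarrow> (\<exists>x. \<forall>a. 0 < x $ a \<and>
    (word_matrix W (s *\<^sub>R w) *v x) $ a \<le> exp (ln r + (s - 1) * pressure_slope W w + \<eta> * \<bar>s - 1\<bar>) * x $ a)"
proof -
  obtain g where g: "\<And>a. r * g $ a - (A *v g) $ a = deriv_vec $ a - r * pressure_slope W w * th $ a"
    using test_direction by blast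
  define x where "x s = th + (s - 1) *\<^sub>R g" for s :: real
  define num where "num a s = (word_matrix W (s *\<^sub>R w) *v x s) $ a" for a s
  define F where "F a s = ln (num a s) - ln (x s $ a)" for a s
  have num: "num a s = (\<Sum>k<length (W a). exp (s * word_sum w (W a) k) * (th $ (W a ! k) + (s - 1) * g $ (W a ! k)))"
    for a s by (simp add: num_def word_matrix_mult word_sum_scaleR x_def)
  have num1: "num a 1 = r * th $ a" for a by (simp add: num_def x_def pf_word(5))
  have dnum: "(num a has_real_derivative (deriv_vec $ a + (A *v g) $ a)) (at 1)" for a
  proof -
    have "(num a has_real_derivative (\<Sum>k<length (W a). exp (word_sum w (W a) k) * word_sum w (W a) k * th $ (W a ! k)
       + exp (word_sum w (W a) k) * g $ (W a ! k))) (at 1)"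
      unfolding num by (auto intro!: derivative_eq_intros sum.cong simp: algebra_simps)
    then show ?thesis by (simp add: deriv_vec_def word_matrix_mult sum.distrib)
  qed
  have dx: "((\<lambda>s. x s $ a) has_real_derivative g $ a) (at 1)" for a
    unfolding x_def by (auto intro!: derivative_eq_intros)
  have x1: "x 1 $ a = th $ a" for a by (simp add: x_def)
  \<comment> \<open>The correction \<open>g\<close> serves to make this logarithmic derivative the
    same number for every letter \<open>a\<close>.\<close>
  have dF: "(F a has_real_derivative pressure_slope W w) (at 1)" for a
  proof -
    have p: "0 < num a 1" "0 < x 1 $ a" using pf_word(1,3) by (auto simp: num1 x1)
    have "(F a has_real_derivative (deriv_vec $ a + (A *v g) $ a) / num a 1 - g $ a / x 1 $ a) (at 1)"
      unfolding F_def using p by (auto intro!: derivative_eq_intros dnum dx)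
    moreover have "(deriv_vec $ a + (A *v g) $ a) / num a 1 - g $ a / x 1 $ a = pressure_slope W w"
    proof -
      have "deriv_vec $ a + (A *v g) $ a = r * g $ a + r * pressure_slope W w * th $ a" using g[of a] by simp
      then show ?thesis using pf_word(1) pf_word(3)[of a] by (simp add: num1 x1 field_simps)
    qed
    ultimately show ?thesis by simp
  qed
  have "eventually (\<lambda>s. 0 < x s $ a \<and> num a s \<le> exp (ln r + (s - 1) * pressure_slope W w + \<eta> * \<bar>s - 1\<bar>) * x s $ a) (at 1)" for a
  proof -
    have "((\<lambda>s. x s $ a) \<longlongrightarrow> th $ a) (at 1)" 
      using DERIV_isCont[OF dx] by (simp add: isCont_def x1)
    then have e1: "eventually (\<lambda>s. 0 < x s $ a) (at 1)" using pf_word(3) by (rule order_tendstoD(1))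
    have "(num a \<longlongrightarrow> num a 1) (at 1)" using DERIV_isCont[OF dnum] by (simp add: isCont_def)
    moreover have "0 < num a 1" using pf_word(1,3) by (simp add: num1)
    ultimately have e2: "eventually (\<lambda>s. 0 < num a s) (at 1)" by (rule order_tendstoD(1))
    have "((\<lambda>s. (F a s - F a 1) / (s - 1)) \<longlongrightarrow> pressure_slope W w) (at 1)"
      using dF[of a] by (simp add: has_field_derivative_iff)
    then have e3: "eventually (\<lambda>s. dist ((F a s - F a 1) / (s - 1)) (pressure_slope W w) < \<eta>) (at 1)"
      using \<eta> by (rule tendstoD)
    have e4: "eventually (\<lambda>s. s \<noteq> (1::real)) (at 1)" by (simp add: eventually_at_filter)
    show ?thesis using e1 e2 e3 e4
    proof eventually_elim
      case (elim s)
      have "\<bar>F a s - F a 1 - (s - 1) * pressure_slope W w\<bar> = \<bar>s - 1\<bar> * \<bar>(F a s - F a 1) / (s - 1) - pressure_slope W w\<bar>"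
        using elim by (simp add: abs_mult[symmetric] field_simps)
      also have "\<dots> \<le> \<bar>s - 1\<bar> * \<eta>" using elim by (intro mult_left_mono) (auto simp: dist_real_def)
      finally have "F a s \<le> F a 1 + (s - 1) * pressure_slope W w + \<eta> * \<bar>s - 1\<bar>" by (simp add: mult.commute)
      moreover have "F a 1 = ln r" using pf_word(1) pf_word(3)[of a] by (simp add: F_def num1 x1 ln_mult)
      ultimately have "ln (num a s) \<le> (ln r + (s - 1) * pressure_slope W w + \<eta> * \<bar>s - 1\<bar>) + ln (x s $ a)"
        by (simp add: F_def)
      then have "exp (ln (num a s)) \<le> exp ((ln r + (s - 1) * pressure_slope W w + \<eta> * \<bar>s - 1\<bar>) + ln (x s $ a))"
        by simp
      then show ?case using elim by (simp only: exp_add exp_ln)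
    qed
  qed
  then have "eventually (\<lambda>s. \<forall>a\<in>UNIV. 0 < x s $ a \<and> num a s \<le> exp (ln r + (s - 1) * pressure_slope W w + \<eta> * \<bar>s - 1\<bar>) * x s $ a) (at 1)"
    by (intro eventually_ball_finite) auto
  then obtain \<delta> where \<delta>: "0 < \<delta>" "\<And>s. s \<noteq> 1 \<Longrightarrow> dist s 1 < \<delta> \<Longrightarrow>
     \<forall>a. 0 < x s $ a \<and> num a s \<le> exp (ln r + (s - 1) * pressure_slope W w + \<eta> * \<bar>s - 1\<bar>) * x s $ a"
    by (auto simp: eventually_at)
  have "\<forall>a. 0 < x s $ a \<and> num a s \<le> exp (ln r + (s - 1) * pressure_slope W w + \<eta> * \<bar>s - 1\<bar>) * x s $ a"
    if "\<bar>s - 1\<bar> < \<delta>" for s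
  proof (cases "s = 1")
    case True then show ?thesis using pf_word(1,3) by (simp add: x1 num1)
  next
    case False then show ?thesis using \<delta>(2)[of s] that by (simp add: dist_real_def)
  qed
  then show ?thesis using \<delta>(1) unfolding num_def by blast
qed

lemma part_fun_growth:
  assumes conv: "(\<lambda>n. iter_vec W n v) \<longlonglongrightarrow> w" and \<eta>: "0 < \<eta>"
  shows "\<exists>\<delta>>0. \<forall>s. s \<noteq> 1 \<and> \<bar>s - 1\<bar> < \<delta> \<longrightarrow> (\<exists>K>0. \<forall>n a. part_fun W (s *\<^sub>R v) n $ a
     \<le> K * exp (real n * (ln r + (s - 1) * pressure_slope W w + \<eta> * \<bar>s - 1\<bar>)))"
proof -
  \<comment> \<open>Half of \<open>\<eta>\<close> pays for the test vector, the other half for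
    replacing the limit matrix by those of large \<open>n\<close>. That slack is positive only for
    \<open>s \<noteq> 1\<close>.\<close>
  obtain \<delta> where \<delta>: "0 < \<delta>" "\<And>s. \<bar>s - 1\<bar> < \<delta> \<Longrightarrow> (\<exists>x. \<forall>a. 0 < x $ a \<and>
    (word_matrix W (s *\<^sub>R w) *v x) $ a \<le> exp (ln r + (s - 1) * pressure_slope W w + \<eta> / 2 * \<bar>s - 1\<bar>) * x $ a)"
    using test_vector[of "\<eta> / 2"] \<eta> by auto
  have "\<exists>K>0. \<forall>n a. part_fun W (s *\<^sub>R v) n $ a
     \<le> K * exp (real n * (ln r + (s - 1) * pressure_slope W w + \<eta> * \<bar>s - 1\<bar>))"
    if s: "s \<noteq> 1" "\<bar>s - 1\<bar> < \<delta>" for s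
  proof -
    obtain x where x: "\<And>a. 0 < x $ a" "\<And>a. (word_matrix W (s *\<^sub>R w) *v x) $ a
      \<le> exp (ln r + (s - 1) * pressure_slope W w + \<eta> / 2 * \<bar>s - 1\<bar>) * x $ a"
      using \<delta>(2)[OF s(2)] by blast
    define q where "q = ln r + (s - 1) * pressure_slope W w + \<eta> * \<bar>s - 1\<bar>"
    have cv: "(\<lambda>n. s *\<^sub>R iter_vec W n v) \<longlonglongrightarrow> s *\<^sub>R w" by (intro tendsto_intros conv)
    have "eventually (\<lambda>n. (word_matrix W (s *\<^sub>R iter_vec W n v) *v x) $ a < exp q * x $ a) sequentially" for a
    proof (rule order_tendstoD(2)[OF tendsto_word_matrix_mult[OF cv]])
      have "ln r + (s - 1) * pressure_slope W w + \<eta> / 2 * \<bar>s - 1\<bar> < q" using \<eta> s by (simp add: q_def)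
      then have "exp (ln r + (s - 1) * pressure_slope W w + \<eta> / 2 * \<bar>s - 1\<bar>) * x $ a < exp q * x $ a"
        using x(1)[of a] by simp
      then show "(word_matrix W (s *\<^sub>R w) *v x) $ a < exp q * x $ a" using x(2)[of a] by linarith
    qed
    then have ev: "eventually (\<lambda>n. \<forall>a. (word_matrix W (s *\<^sub>R iter_vec W n v) *v x) $ a < exp q * x $ a) sequentially"
      by (rule eventually_all_finite)
    let ?Z = "part_fun W (s *\<^sub>R v)"
    \<comment> \<open>Collatz-Wielandt ratio: a positive \<open>x\<close> that every matrix
      stretches by at most \<open>exp q\<close> keeps this maximum from growing faster.\<close>
    define y where "y n = Max (range (\<lambda>a. ?Z n $ a / x $ a))" for n
    have Zy: "?Z n $ a \<le> y n * x $ a" for n a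
    proof -
      have "?Z n $ a / x $ a \<le> y n" unfolding y_def by (intro Max_ge) auto
      then show ?thesis using x(1)[of a] by (simp add: field_simps)
    qed
    have Z0: "0 \<le> ?Z n $ a" for n a by (simp add: part_fun_def word_exp_sum_def sum_nonneg)
    have y0: "0 \<le> y n" for n
    proof -
      have "0 \<le> y n * x $ undefined" using Zy[of n undefined] Z0[of n undefined] by linarith
      then show ?thesis using x(1)[of undefined] by (simp add: zero_le_mult_iff)
    qed
    have "eventually (\<lambda>n. y (Suc n) \<le> exp q * y n) sequentially"
      using ev
    proof eventually_elim
      case (elim n)
      have "?Z (Suc n) $ a / x $ a \<le> exp q * y n" for a
      proof -
        have "?Z (Suc n) $ a = (word_matrix W (s *\<^sub>R iter_vec W n v) *v ?Z n) $ a"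
          by (simp add: part_fun_Suc iter_vec_scaleR)
        also have "\<dots> \<le> (\<Sum>b\<in>UNIV. word_matrix W (s *\<^sub>R iter_vec W n v) $ a $ b * (y n * x $ b))"
          unfolding matrix_vector_component using Zy word_matrix_pos[OF pos0]
          by (intro sum_mono mult_left_mono) (auto simp: less_imp_le)
        also have "\<dots> = y n * (word_matrix W (s *\<^sub>R iter_vec W n v) *v x) $ a"
          by (simp add: matrix_vector_component sum_distrib_left mult_ac)
        also have "\<dots> \<le> y n * (exp q * x $ a)"
          using elim y0 by (intro mult_left_mono) (auto simp: less_imp_le)
        finally show ?thesis using x(1)[of a] by (simp add: field_simps)
      qed
      then show ?case unfolding y_def[of "Suc n"] by (subst Max_le_iff) auto
    qed
    from seq_growth[OF this] obtain K where K: "0 < K" "\<And>n. y n \<le> K * exp (real n * q)" by blast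
    define X where "X = Max (range (\<lambda>a. x $ a))"
    have X: "x $ a \<le> X" for a unfolding X_def by (intro Max_ge) auto
    have X0: "0 < X" using X[of undefined] x(1)[of undefined] by linarith
    have "?Z n $ a \<le> (K * X) * exp (real n * q)" for n a
    proof -
      have "?Z n $ a \<le> y n * x $ a" by (rule Zy)
      also have "\<dots> \<le> (K * exp (real n * q)) * X"
        using K X x(1)[of a] y0 by (intro mult_mono) (auto simp: less_imp_le)
      finally show ?thesis by (simp add: mult_ac)
    qed
    then show ?thesis using K(1) X0 unfolding q_def by (intro exI[of _ "K * X"]) auto
  qed
  then show ?thesis using \<delta>(1) by blast
qed

text \<open>The sum factors per letter as \<open>(L n $ a) powr s\<close> times a partition function
  for \<open>s v\<close>. Their exponents \<open>- s ln r\<close> and \<open>ln r + (s - 1)\<close>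
  times the slope add up to \<open>(1 - s)\<close> times \<open>ln r\<close> minus the
  slope.\<close>

lemma cylinder_sum_growth:
  assumes conv: "(\<lambda>n. iter_vec W n v) \<longlonglongrightarrow> w" and \<eta>: "0 < \<eta>"
    and L0: "L 0 \<noteq> 0" and Lnn: "\<And>n a. 0 \<le> L n $ a"
    and rec: "\<And>n. L n = L (Suc n) v* word_matrix W (iter_vec W n v)"
  shows "\<exists>\<delta>>0. \<forall>s. 0 < s \<and> s \<noteq> 1 \<and> \<bar>s - 1\<bar> < \<delta> \<longrightarrow> (\<exists>K>0. \<forall>n.
    (\<Sum>a\<in>UNIV. \<Sum>k<length (iter_word W n a). (exp (word_sum v (iter_word W n a) k) * L n $ a) powr s)
     \<le> K * exp (real n * ((1 - s) * (ln r - pressure_slope W w) + \<eta> * \<bar>s - 1\<bar>)))"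
proof -
  interpret lr: left_recursion W "\<lambda>n. iter_vec W n v" w th r L
    by unfold_locales (rule pos0 conv pf_word L0 Lnn rec)+
  have half: "0 < \<eta> / 2" using \<eta> by simp
  obtain \<delta> where \<delta>: "0 < \<delta>" "\<And>s. s \<noteq> 1 \<Longrightarrow> \<bar>s - 1\<bar> < \<delta> \<Longrightarrow> (\<exists>K>0. \<forall>n a. part_fun W (s *\<^sub>R v) n $ a
     \<le> K * exp (real n * (ln r + (s - 1) * pressure_slope W w + \<eta> / 2 * \<bar>s - 1\<bar>)))"
    using part_fun_growth[OF conv half] by blast
  have "\<exists>K>0. \<forall>n.
    (\<Sum>a\<in>UNIV. \<Sum>k<length (iter_word W n a). (exp (word_sum v (iter_word W n a) k) * L n $ a) powr s)
     \<le> K * exp (real n * ((1 - s) * (ln r - pressure_slope W w) + \<eta> * \<bar>s - 1\<bar>))"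
    if s: "0 < s" "s \<noteq> 1" "\<bar>s - 1\<bar> < \<delta>" for s
  proof -
    \<comment> \<open>Chosen so that, after raising to the power \<open>s\<close>, the loss in
      \<open>L n\<close> is exactly half of the allowed error.\<close>
    define e where "e = \<eta> / 2 * \<bar>s - 1\<bar> / s"
    have e: "0 < e" using \<eta> s by (simp add: e_def)
    obtain K where K: "0 < K" "\<And>n a. part_fun W (s *\<^sub>R v) n $ a
     \<le> K * exp (real n * (ln r + (s - 1) * pressure_slope W w + \<eta> / 2 * \<bar>s - 1\<bar>))"
      using \<delta>(2)[OF s(2,3)] by blast
    obtain K' where K': "0 < K'" "\<And>n a. L n $ a \<le> K' * exp (- real n * (ln r - e))"
      using lr.upper_growth[OF e] by blast
    define C where "C = real CARD('a) * (K' powr s * K)"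
    have "(\<Sum>a\<in>UNIV. \<Sum>k<length (iter_word W n a). (exp (word_sum v (iter_word W n a) k) * L n $ a) powr s)
     \<le> C * exp (real n * ((1 - s) * (ln r - pressure_slope W w) + \<eta> * \<bar>s - 1\<bar>))" for n
    proof -
      have "(\<Sum>k<length (iter_word W n a). (exp (word_sum v (iter_word W n a) k) * L n $ a) powr s)
        \<le> (K' powr s * K) * exp (real n * ((1 - s) * (ln r - pressure_slope W w) + \<eta> * \<bar>s - 1\<bar>))" for a
      proof -
        have "(\<Sum>k<length (iter_word W n a). (exp (word_sum v (iter_word W n a) k) * L n $ a) powr s)
          = (L n $ a) powr s * part_fun W (s *\<^sub>R v) n $ a"
          using Lnn by (simp add: part_fun_def word_exp_sum_def word_sum_scaleR powr_mult
              exp_powr_real mult.commute sum_distrib_left)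
        also have "\<dots> \<le> (K' * exp (- real n * (ln r - e))) powr s *
           (K * exp (real n * (ln r + (s - 1) * pressure_slope W w + \<eta> / 2 * \<bar>s - 1\<bar>)))"
          using K K' Lnn s by (intro mult_mono powr_mono2) (auto simp: part_fun_def word_exp_sum_def sum_nonneg)
        also have "\<dots> = (K' powr s * K) * (exp (- real n * (ln r - e) * s) *
           exp (real n * (ln r + (s - 1) * pressure_slope W w + \<eta> / 2 * \<bar>s - 1\<bar>)))"
          using K'(1) by (simp add: powr_mult exp_powr_real)
        also have "\<dots> = (K' powr s * K) * exp (real n * ((1 - s) * (ln r - pressure_slope W w) + \<eta> * \<bar>s - 1\<bar>))"
        proof -
          have es: "e * s = \<eta> / 2 * \<bar>s - 1\<bar>" using s by (simp add: e_def)
          have "- real n * (ln r - e) * s + real n * (ln r + (s - 1) * pressure_slope W w + \<eta> / 2 * \<bar>s - 1\<bar>)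
            = real n * ((1 - s) * (ln r - pressure_slope W w) + (e * s + \<eta> / 2 * \<bar>s - 1\<bar>))"
            by (simp add: algebra_simps)
          also have "e * s + \<eta> / 2 * \<bar>s - 1\<bar> = \<eta> * \<bar>s - 1\<bar>" using es by simp
          finally have "- real n * (ln r - e) * s + real n * (ln r + (s - 1) * pressure_slope W w + \<eta> / 2 * \<bar>s - 1\<bar>)
            = real n * ((1 - s) * (ln r - pressure_slope W w) + \<eta> * \<bar>s - 1\<bar>)" .
          then show ?thesis by (simp only: exp_add[symmetric])
        qed
        finally show ?thesis .
      qed
      then have "(\<Sum>a\<in>UNIV. \<Sum>k<length (iter_word W n a). (exp (word_sum v (iter_word W n a) k) * L n $ a) powr s)
        \<le> real CARD('a) * ((K' powr s * K) * exp (real n * ((1 - s) * (ln r - pressure_slope W w) + \<eta> * \<bar>s - 1\<bar>)))"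
        by (intro sum_bounded_above)
      then show ?thesis by (simp add: C_def mult.assoc)
    qed
    moreover have "0 < C" using K K' by (simp add: C_def)
    ultimately show ?thesis by blast
  qed
  then show ?thesis using \<delta>(1) by blast
qed

end

section \<open>The entropy as that of a Markov chain, compared with the Parry chain\<close>

section \<open>Bounds for the entropy\<close>

definition word_entropy :: "('a::finite \<Rightarrow> 'a list) \<Rightarrow> real ^ 'a \<Rightarrow> real" where
  "word_entropy W w = ln (pf_eigenvalue (word_matrix W w)) - pressure_slope W w"

text \<open>\<open>p\<close> are the edge weights and \<open>P\<close> the transition probabilities of the Markov chain on letters
  whose entropy is \<open>word_entropy W w\<close>; \<open>Q\<close> is the Parry chain of \<open>word_matrix W 0\<close>.\<close>

context
  fixes W :: "'a::finite \<Rightarrow> 'a list" and w :: "real ^ 'a"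
  assumes pos0: "\<And>a b. 0 < word_matrix W 0 $ a $ b" and card2: "CARD('a) \<ge> 2"
begin

private abbreviation "Aw \<equiv> word_matrix W w"
private abbreviation "rw \<equiv> pf_eigenvalue Aw"
private abbreviation "lw \<equiv> fst (pf_vectors Aw)"
private abbreviation "thw \<equiv> snd (pf_vectors Aw)"
private abbreviation "M \<equiv> word_matrix W 0"
private abbreviation "r' \<equiv> pf_eigenvalue M"
private abbreviation "l' \<equiv> fst (pf_vectors M)"
private abbreviation "S a k \<equiv> word_sum w (W a) k"

private definition "p a k = lw $ a * exp (S a k) * thw $ (W a ! k) / rw"
private definition "P a k = lw $ a * exp (S a k) / (rw * lw $ (W a ! k))"
private definition "Q a k = l' $ a / (r' * l' $ (W a ! k))"

private lemmas pfA = pf_word[OF pos0, where w = w]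
private lemmas pfM = pf_word[OF pos0, where w = 0]

private lemma other_letter: "\<exists>b. b \<noteq> (a :: 'a)"
proof (rule ccontr)
  assume "\<not> ?thesis"
  then have "UNIV = {a}" by auto
  then have "CARD('a) = 1" by (metis card_1_singleton_iff One_nat_def)
  then show False using card2 by simp
qed

private lemma p_pos: "0 < p a k" and P_pos: "0 < P a k" and Q_pos: "0 < Q a k"
  using pfA pfM by (auto simp: p_def P_def Q_def)

private lemma edge_sum_target:
  "(\<Sum>a\<in>UNIV. \<Sum>k<length (W a). lw $ a * exp (S a k) * y $ (W a ! k)) = rw * (lw \<bullet> y)"
proof -
  have "(\<Sum>a\<in>UNIV. \<Sum>k<length (W a). lw $ a * exp (S a k) * y $ (W a ! k)) = lw \<bullet> (Aw *v y)"
    by (simp add: inner_vec_def word_matrix_mult sum_distrib_left mult.assoc)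
  also have "\<dots> = rw * (lw \<bullet> y)"
    by (simp add: dot_lmul_matrix[symmetric] pfA(4) scalar_mult_eq_scaleR)
  finally show ?thesis .
qed

private lemma p_target: "(\<Sum>a\<in>UNIV. \<Sum>k<length (W a). p a k * f (W a ! k)) = (\<Sum>b\<in>UNIV. lw $ b * thw $ b * f b)"
proof -
  have "(\<Sum>a\<in>UNIV. \<Sum>k<length (W a). p a k * f (W a ! k)) =
    (\<Sum>a\<in>UNIV. \<Sum>k<length (W a). lw $ a * exp (S a k) * (\<chi> b. thw $ b * f b) $ (W a ! k)) / rw"
    by (simp add: p_def sum_divide_distrib mult.assoc)
  also have "\<dots> = lw \<bullet> (\<chi> b. thw $ b * f b)" unfolding edge_sum_target using pfA(1) by simp
  finally show ?thesis by (simp add: inner_vec_def mult.assoc)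
qed

text \<open>With \<open>p_target\<close> this is stationarity: both ends of a
  \<open>p\<close>-random edge have the same law, so differences of a function between target and
  source average to 0.\<close>

private lemma p_source: "(\<Sum>a\<in>UNIV. \<Sum>k<length (W a). p a k * f a) = (\<Sum>b\<in>UNIV. lw $ b * thw $ b * f b)"
proof -
  have "(\<Sum>k<length (W a). p a k * f a) = lw $ a * thw $ a * f a" for a
  proof -
    have "(\<Sum>k<length (W a). p a k * f a) = lw $ a * f a / rw * (Aw *v thw) $ a"
      by (simp add: p_def word_matrix_mult sum_distrib_left mult_ac)
    then show ?thesis using pfA(1) by (simp add: pfA(5))
  qed
  then show ?thesis by simp
qed

private lemma p_sum: "(\<Sum>a\<in>UNIV. \<Sum>k<length (W a). p a k) = 1"
  using p_target[of "\<lambda>_. 1"] pfA(7) by (simp add: inner_vec_def)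

text \<open>In \<open>ln (P a k)\<close> the eigenvector terms form such a target-minus-source
  difference and drop out of the average.\<close>

private lemma entropy_P: "word_entropy W w = (\<Sum>a\<in>UNIV. \<Sum>k<length (W a). p a k * - ln (P a k))"
proof -
  have "p a k * - ln (P a k) = p a k * ln rw - p a k * S a k + (p a k * ln (lw $ (W a ! k)) - p a k * ln (lw $ a))" for a k
  proof -
    have e: "ln (P a k) = ln (lw $ a) + S a k - (ln rw + ln (lw $ (W a ! k)))"
      using pfA(1) pfA(2)[of a] pfA(2)[of "W a ! k"] by (simp add: P_def ln_div ln_mult)
    show ?thesis unfolding e by (simp add: algebra_simps)
  qed
  then have "(\<Sum>a\<in>UNIV. \<Sum>k<length (W a). p a k * - ln (P a k)) =
     (\<Sum>a\<in>UNIV. \<Sum>k<length (W a). p a k) * ln rw - (\<Sum>a\<in>UNIV. \<Sum>k<length (W a). p a k * S a k)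
     + ((\<Sum>a\<in>UNIV. \<Sum>k<length (W a). p a k * ln (lw $ (W a ! k))) - (\<Sum>a\<in>UNIV. \<Sum>k<length (W a). p a k * ln (lw $ a)))"
    by (simp add: sum.distrib sum_subtractf sum_distrib_right)
  also have "\<dots> = ln rw - (\<Sum>a\<in>UNIV. \<Sum>k<length (W a). p a k * S a k)"
    unfolding p_sum p_target[of "\<lambda>b. ln (lw $ b)"] p_source[of "\<lambda>b. ln (lw $ b)"] by simp
  also have "(\<Sum>a\<in>UNIV. \<Sum>k<length (W a). p a k * S a k) = pressure_slope W w"
    unfolding pressure_slope_def p_def using pfA(1)
    by (intro sum.cong refl) (simp add: exp_minus field_simps)
  finally show ?thesis by (simp add: word_entropy_def)
qed

text \<open>\<open>P\<close> is the probability of an edge given its target. With two letters and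
  positive entries, every target is also reached from another letter, so no edge takes all the
  probability.\<close>

private lemma P_less_1: assumes "k < length (W a)" shows "P a k < 1"
proof -
  let ?b = "W a ! k"
  obtain a' where a': "a' \<noteq> a" using other_letter by blast
  have "exp (S a k) \<le> Aw $ a $ ?b"
    unfolding word_matrix_def using assms
    by (simp, intro member_le_sum) auto
  then have "lw $ a * exp (S a k) \<le> lw $ a * Aw $ a $ ?b" using pfA(2)[of a] by simp
  also have "\<dots> < lw $ a * Aw $ a $ ?b + lw $ a' * Aw $ a' $ ?b"
    using pfA(2)[of a'] word_matrix_pos[OF pos0, of w a' ?b] by simp
  also have "\<dots> = (\<Sum>c\<in>{a, a'}. lw $ c * Aw $ c $ ?b)" using a' by simp
  also have "\<dots> \<le> (\<Sum>c\<in>UNIV. lw $ c * Aw $ c $ ?b)"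
    using pfA(2) word_matrix_pos[OF pos0] by (intro sum_mono2) (auto simp: less_imp_le)
  also have "\<dots> = (lw v* Aw) $ ?b" by (simp add: vector_matrix_mult_def mult.commute)
  also have "\<dots> = rw * lw $ ?b" by (simp add: pfA(4))
  finally show ?thesis using pfA(1) pfA(2)[of ?b] by (simp add: P_def)
qed

private lemma word_nonempty: "W a \<noteq> []"
proof
  assume "W a = []"
  then show False using pos0[of a a] by (simp add: word_matrix_0_entry)
qed

lemma word_entropy_pos: "0 < word_entropy W w"
  unfolding entropy_P
proof (rule sum_pos)
  fix a
  show "0 < (\<Sum>k<length (W a). p a k * - ln (P a k))"
  proof (rule sum_pos)
    show "{..<length (W a)} \<noteq> {}" using word_nonempty[of a] by (auto simp: lessThan_empty_iff)
    fix k assume "k \<in> {..<length (W a)}"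
    then have "ln (P a k) < 0" using P_less_1[of k a] P_pos[of a k] by simp
    then show "0 < p a k * - ln (P a k)" using p_pos[of a k] by (intro mult_pos_pos) auto
  qed simp
qed auto

text \<open>The cross entropy does not depend on the twist: \<open>ln (Q a k)\<close> is the
  constant \<open>- ln r'\<close> plus a difference that averages to 0.\<close>

private lemma entropy_Q: "(\<Sum>a\<in>UNIV. \<Sum>k<length (W a). p a k * - ln (Q a k)) = ln r'"
proof -
  have "p a k * - ln (Q a k) = p a k * ln r' + (p a k * ln (l' $ (W a ! k)) - p a k * ln (l' $ a))" for a k
  proof -
    have e: "ln (Q a k) = ln (l' $ a) - (ln r' + ln (l' $ (W a ! k)))"
      using pfM(1) pfM(2)[of a] pfM(2)[of "W a ! k"] by (simp add: Q_def ln_div ln_mult)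
    show ?thesis unfolding e by (simp add: algebra_simps)
  qed
  then have "(\<Sum>a\<in>UNIV. \<Sum>k<length (W a). p a k * - ln (Q a k)) =
     (\<Sum>a\<in>UNIV. \<Sum>k<length (W a). p a k) * ln r'
     + ((\<Sum>a\<in>UNIV. \<Sum>k<length (W a). p a k * ln (l' $ (W a ! k))) - (\<Sum>a\<in>UNIV. \<Sum>k<length (W a). p a k * ln (l' $ a)))"
    by (simp add: sum.distrib sum_subtractf sum_distrib_right)
  then show ?thesis
    unfolding p_sum p_target[of "\<lambda>b. ln (l' $ b)"] p_source[of "\<lambda>b. ln (l' $ b)"] by simp
qed

text \<open>\<open>p / P\<close> is the stationary weight of the target, and the values of
  \<open>Q\<close> over the edges into a fixed target add up to 1.\<close>

private lemma p_ratio: "(\<Sum>a\<in>UNIV. \<Sum>k<length (W a). p a k * (Q a k / P a k)) = 1"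
proof -
  have "p a k * (Q a k / P a k) = l' $ a * (lw $ (W a ! k) * thw $ (W a ! k) / l' $ (W a ! k)) / r'" for a k
    using pfA(1) pfA(2)[of a] by (simp add: p_def P_def Q_def field_simps)
  then have "(\<Sum>a\<in>UNIV. \<Sum>k<length (W a). p a k * (Q a k / P a k)) = (l' \<bullet> (M *v (\<chi> b. lw $ b * thw $ b / l' $ b))) / r'"
    by (simp add: inner_vec_def word_matrix_mult sum_divide_distrib sum_distrib_left)
       (simp add: word_sum_def)
  also have "l' \<bullet> (M *v (\<chi> b. lw $ b * thw $ b / l' $ b)) = r' * (l' \<bullet> (\<chi> b. lw $ b * thw $ b / l' $ b))"
    by (simp add: dot_lmul_matrix[symmetric] pfM(4) scalar_mult_eq_scaleR)
  also have "l' \<bullet> (\<chi> b. lw $ b * thw $ b / l' $ b) = (\<Sum>b\<in>UNIV. lw $ b * thw $ b)"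
    unfolding inner_vec_def using pfM(2) by (intro sum.cong) (auto simp: less_imp_neq[symmetric])
  finally show ?thesis using pfA(7) pfM(1) by (simp add: inner_vec_def)
qed

private lemma word_entropy_gibbs:
  assumes "ln r' \<le> word_entropy W w" and k: "k < length (W a)"
  shows "P a k = Q a k"
proof (rule ccontr)
  assume ne: "P a k \<noteq> Q a k"
  \<comment> \<open>The terms of Gibbs' inequality, nonnegative by \<open>ln x <= x - 1\<close>.
    Their sum is \<open>ln r'\<close> minus the entropy, so the assumption forces each of them to be
    0.\<close>
  define f where "f a k = p a k * (Q a k / P a k) - p a k - (p a k * - ln (P a k) - p a k * - ln (Q a k))" for a k
  have f: "f a k = p a k * ((Q a k / P a k - 1) - ln (Q a k / P a k))" for a k
    using P_pos[of a k] Q_pos[of a k] by (simp add: f_def ln_div algebra_simps)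
  have f0: "0 \<le> f a k" for a k
    unfolding f using ln_le_minus_one[of "Q a k / P a k"] P_pos[of a k] Q_pos[of a k] p_pos[of a k]
    by (intro mult_nonneg_nonneg) auto
  have "ln (Q a k / P a k) \<noteq> Q a k / P a k - 1"
    using ln_eq_minus_one[of "Q a k / P a k"] P_pos[of a k] Q_pos[of a k] ne by auto
  then have "f a k \<noteq> 0" unfolding f using p_pos[of a k] by simp
  then have fk: "0 < f a k" using f0[of a k] by simp
  have "0 < (\<Sum>k<length (W a). f a k)" using fk f0 k by (intro sum_pos2[of _ k]) auto
  then have "0 < (\<Sum>a\<in>UNIV. \<Sum>k<length (W a). f a k)"
    using f0 by (intro sum_pos2[of _ a]) (auto intro: sum_nonneg)
  also have "(\<Sum>a\<in>UNIV. \<Sum>k<length (W a). f a k) = 1 - 1 - (word_entropy W w - ln r')"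
    unfolding f_def sum_subtractf p_ratio p_sum entropy_P[symmetric] entropy_Q by simp
  finally show False using assms(1) by simp
qed

text \<open>In the equality case of Gibbs' inequality the cocycle sums are the coboundary of
  \<open>h = ln lw - ln l'\<close> up to a constant drift; the drift vanishes and \<open>h\<close> is constant since iterating
  "first letter" ends in a single letter.\<close>

lemma word_entropy_less:
  assumes fixed: "M *v w = w" and nz: "w \<noteq> 0"
    and first: "\<And>a b. ((\<lambda>a. W a ! 0) ^^ n) a = ((\<lambda>a. W a ! 0) ^^ n) b"
  shows "word_entropy W w < ln r'"
proof (rule ccontr)
  assume "\<not> ?thesis"
  then have PQ: "P a k = Q a k" if "k < length (W a)" for a k
    using word_entropy_gibbs[OF _ that] by simp
  define h where "h a = ln (lw $ a) - ln (l' $ a)" for a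
  define c where "c = ln rw - ln r'"
  have S: "S a k = c + h (W a ! k) - h a" if "k < length (W a)" for a k
  proof -
    have "ln (P a k) = ln (lw $ a) + S a k - (ln rw + ln (lw $ (W a ! k)))"
      using pfA(1) pfA(2)[of a] pfA(2)[of "W a ! k"] by (simp add: P_def ln_div ln_mult)
    moreover have "ln (Q a k) = ln (l' $ a) - (ln r' + ln (l' $ (W a ! k)))"
      using pfM(1) pfM(2)[of a] pfM(2)[of "W a ! k"] by (simp add: Q_def ln_div ln_mult)
    ultimately show ?thesis using PQ[OF that] by (simp add: h_def c_def)
  qed
  let ?f = "\<lambda>a. W a ! 0"
  \<comment> \<open>At position 0 the partial sum is empty.\<close>
  have h1: "h a = c + h (?f a)" for a
    using S[of 0 a] word_nonempty[of a] by (simp add: word_sum_def)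
  have hn: "h a = real m * c + h ((?f ^^ m) a)" for a m
  proof (induction m)
    case (Suc m)
    then show ?case using h1[of "(?f ^^ m) a"] by (simp add: algebra_simps)
  qed simp
  have hc: "h a = h b" for a b using hn[of a n] hn[of b n] first[of a b] by simp
  then have c0: "c = 0" using h1[of undefined] hc[of undefined "?f undefined"] by simp
  have S0: "S a k = 0" if "k < length (W a)" for a k
    using S[OF that] c0 hc[of "W a ! k" a] by simp
  \<comment> \<open>All proper partial sums vanish, so \<open>w\<close> vanishes on every letter
    that is not the last of its word.\<close>
  have early: "w $ (W a ! k) = 0" if "Suc k < length (W a)" for a k
  proof -
    have "S a (Suc k) = S a k + w $ (W a ! k)" by (simp add: word_sum_def)
    then show ?thesis using S0[OF that] S0[of k a] that by simp
  qed
  have lastw: "w $ a = w $ (W a ! (length (W a) - 1))" for a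
  proof -
    obtain m where m: "length (W a) = Suc m" using word_nonempty[of a] by (cases "length (W a)") auto
    have "w $ a = S a (length (W a))" using word_matrix_0_mult[of W w a] fixed by simp
    also have "\<dots> = S a m + w $ (W a ! m)" by (simp add: m word_sum_def)
    finally show ?thesis using S0[of m a] m by simp
  qed
  \<comment> \<open>By positivity each letter occurs in every word, and one with a nonzero value of
    \<open>w\<close> can occur only at the end. As \<open>w\<close> then turns out nonzero
    everywhere, two letters would both end the same word.\<close>
  have pos_last: "W a ! (length (W a) - 1) = b" if "w $ b \<noteq> 0" for a b
  proof -
    have "{k. k < length (W a) \<and> W a ! k = b} \<noteq> {}"
    proof
      assume "{k. k < length (W a) \<and> W a ! k = b} = {}"
      then show False using pos0[of a b] by (simp only: word_matrix_0_entry card.empty of_nat_0 less_irrefl)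
    qed
    then obtain k where k: "k < length (W a)" "W a ! k = b" by blast
    then have "\<not> Suc k < length (W a)" using early[of k a] that by auto
    then have "k = length (W a) - 1" using k by simp
    then show ?thesis using k by simp
  qed
  obtain b where b: "w $ b \<noteq> 0" using nz by (auto simp: vec_eq_iff)
  have all: "w $ a \<noteq> 0" for a using lastw[of a] pos_last[OF b, of a] b by simp
  obtain b' where "b' \<noteq> b" using other_letter by blast
  then show False using pos_last[OF b, of b] pos_last[OF all[of b'], of b] by simp
qed

text \<open>The entries are positive integers, so each column sum weighted by \<open>l'\<close> is
  at least 1; hence \<open>r'\<close> is at least the number of letters.\<close>

lemma pf_word_gt_1: "1 < r'"
proof -
  have "r' * 1 = (\<Sum>b\<in>UNIV. (l' v* M) $ b)"
    unfolding pfM(4) using pfM(6) by (simp add: sum_distrib_left[symmetric])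
  also have "\<dots> = (\<Sum>b\<in>UNIV. \<Sum>a\<in>UNIV. M $ a $ b * l' $ a)"
    by (simp add: vector_matrix_mult_def mult.commute)
  also have "\<dots> \<ge> (\<Sum>b\<in>(UNIV::'a set). \<Sum>a\<in>UNIV. l' $ a)"
  proof (intro sum_mono)
    fix a b
    have "1 \<le> M $ a $ b" using pos0[of a b] unfolding word_matrix_0_entry
      by (metis One_nat_def Suc_leI of_nat_0_less_iff of_nat_1 of_nat_le_iff)
    then show "l' $ a \<le> M $ a $ b * l' $ a" using pfM(2)[of a] by simp
  qed
  finally have "real CARD('a) \<le> r'" using pfM(6) by simp
  then show ?thesis using card2 by linarith
qed

end

section \<open>Dimension of a measure from the masses of intervals at exponentially shrinking
  scales\<close>

section \<open>Hausdorff dimension from cylinder measures\<close>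

text \<open>Only two facts enter: level-\<open>n\<close> cylinders have length about
  \<open>exp (- n \<rho>)\<close>, and the sums of powers grow with rate \<open>(1 - s) H\<close> to
  first order at \<open>s = 1\<close>, on both sides of 1.\<close>

locale cylinder_system =
  fixes \<nu> :: "real measure" and I :: "nat \<Rightarrow> 'i set" and C :: "nat \<Rightarrow> 'i \<Rightarrow> real set"
    and \<rho> c1 c2 H :: real
  assumes sets_nu: "sets \<nu> = sets borel" and space1: "emeasure \<nu> UNIV = 1"
    and unit1: "emeasure \<nu> {0..<1} = 1"
    and finI: "\<And>n. finite (I n)"
    and interval: "\<And>n i. i \<in> I n \<Longrightarrow> \<exists>c len. C n i = {c..<c + len} \<and>
      c1 * exp (- real n * \<rho>) \<le> len \<and> len \<le> c2 * exp (- real n * \<rho>)"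
    and disj: "\<And>n i j x. i \<in> I n \<Longrightarrow> j \<in> I n \<Longrightarrow> x \<in> C n i \<Longrightarrow> x \<in> C n j \<Longrightarrow> i = j"
    and cover: "\<And>n x. x \<in> {0..<1} \<Longrightarrow> \<exists>i\<in>I n. x \<in> C n i"
    and \<rho>: "0 < \<rho>" and c1: "0 < c1" and H: "0 < H"
    and growth: "\<And>\<eta>. 0 < \<eta> \<Longrightarrow> \<exists>\<delta>>0. \<forall>s. 0 < s \<and> s \<noteq> 1 \<and> \<bar>s - 1\<bar> < \<delta> \<longrightarrow> (\<exists>K>0. \<forall>n.
      (\<Sum>i\<in>I n. measure \<nu> (C n i) powr s) \<le> K * exp (real n * ((1 - s) * H + \<eta> * \<bar>s - 1\<bar>)))"
begin

lemma finite_measure_nu: "finite_measure \<nu>"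
  using space1 sets_eq_imp_space_eq[OF sets_nu] by (intro finite_measureI) simp

interpretation finite_measure \<nu> by (rule finite_measure_nu)

lemma off_unit_null: "emeasure \<nu> (UNIV - {0..<1}) = 0"
proof -
  have "emeasure \<nu> (space \<nu> - {0..<1}) = emeasure \<nu> (space \<nu>) - emeasure \<nu> {0..<1}"
    using sets_nu unit1 by (intro emeasure_compl) auto
  then show ?thesis using space1 unit1 sets_eq_imp_space_eq[OF sets_nu] by simp
qed

lemma C_borel: "i \<in> I n \<Longrightarrow> C n i \<in> sets borel"
  using interval[of i n] by auto

lemma C_sets: "i \<in> I n \<Longrightarrow> C n i \<in> sets \<nu>"
  using C_borel sets_nu by simp

lemma C_diam: "i \<in> I n \<Longrightarrow> bounded (C n i) \<and> diameter (C n i) \<le> c2 * exp (- real n * \<rho>)"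
proof -
  assume "i \<in> I n"
  then obtain c len where c: "C n i = {c..<c + len}" "c1 * exp (- real n * \<rho>) \<le> len"
    "len \<le> c2 * exp (- real n * \<rho>)" using interval by blast
  have "0 < c1 * exp (- real n * \<rho>)" using c1 by simp
  then have "0 \<le> len" using c(2) by linarith
  then have "diameter (C n i) \<le> len" unfolding c(1) by (intro diameter_le) auto
  then show ?thesis using c by auto
qed

lemma c2_pos: "0 < c2"
proof -
  obtain i where "i \<in> I 0" using cover[of 0 0] by auto
  then show ?thesis using interval[of i 0] c1 by auto
qed

lemma sum_measure_le:
  assumes "J \<subseteq> I n" shows "(\<Sum>i\<in>J. measure \<nu> (C n i)) \<le> 1"
proof -
  have fin: "finite J" using assms finI by (rule finite_subset)
  have "disjoint_family_on (C n) J" using disj assms unfolding disjoint_family_on_def by blast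
  then have "measure \<nu> (\<Union>i\<in>J. C n i) = (\<Sum>i\<in>J. measure \<nu> (C n i))"
    using fin C_sets assms by (intro finite_measure_finite_Union) auto
  moreover have "measure \<nu> (\<Union>i\<in>J. C n i) \<le> 1"
  proof -
    have "measure \<nu> (\<Union>i\<in>J. C n i) \<le> measure \<nu> (space \<nu>)" by (rule bounded_measure)
    also have "\<dots> = 1" using space1 sets_eq_imp_space_eq[OF sets_nu] by (simp add: measure_def)
    finally show ?thesis .
  qed
  ultimately show ?thesis by simp
qed

lemma emeasure_Un_le:
  assumes "J \<subseteq> I n" shows "emeasure \<nu> (\<Union>i\<in>J. C n i) \<le> ennreal (\<Sum>i\<in>J. measure \<nu> (C n i))"
proof -
  have fin: "finite J" using assms finI by (rule finite_subset)
  have "emeasure \<nu> (\<Union>i\<in>J. C n i) \<le> (\<Sum>i\<in>J. emeasure \<nu> (C n i))"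
    using fin C_sets assms by (intro emeasure_subadditive_finite) auto
  also have "\<dots> = (\<Sum>i\<in>J. ennreal (measure \<nu> (C n i)))" by (simp add: emeasure_eq_measure)
  also have "\<dots> = ennreal (\<Sum>i\<in>J. measure \<nu> (C n i))" by (simp add: sum_ennreal)
  finally show ?thesis .
qed

subsection \<open>Exceptional cylinders\<close>

text \<open>Each mass is split into its powers \<open>s\<close> and \<open>1 - s\<close>. The
  absolute value covers an empty \<open>J\<close>, which says nothing about the sign of
  \<open>h\<close>.\<close>

lemma chernoff:
  assumes "J \<subseteq> I n" and h: "\<And>i. i \<in> J \<Longrightarrow> measure \<nu> (C n i) powr (1 - s) \<le> h"
    and B: "(\<Sum>i\<in>I n. measure \<nu> (C n i) powr s) \<le> B"
  shows "(\<Sum>i\<in>J. measure \<nu> (C n i)) \<le> B * \<bar>h\<bar>"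
proof -
  have "(\<Sum>i\<in>J. measure \<nu> (C n i)) \<le> (\<Sum>i\<in>J. measure \<nu> (C n i) powr s * \<bar>h\<bar>)"
  proof (rule sum_mono)
    fix i assume "i \<in> J"
    then have "measure \<nu> (C n i) powr s * measure \<nu> (C n i) powr (1 - s) \<le> measure \<nu> (C n i) powr s * \<bar>h\<bar>"
      using h[of i] by (intro mult_left_mono) auto
    then show "measure \<nu> (C n i) \<le> measure \<nu> (C n i) powr s * \<bar>h\<bar>" by (simp add: powr_add[symmetric])
  qed
  also have "\<dots> \<le> (\<Sum>i\<in>I n. measure \<nu> (C n i) powr s * \<bar>h\<bar>)"
    using finI assms(1) by (intro sum_mono2) auto
  also have "\<dots> \<le> B * \<bar>h\<bar>" using B by (simp add: sum_distrib_right[symmetric] mult_right_mono)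
  finally show ?thesis .
qed

lemma light_cylinders:
  assumes \<eta>: "0 < \<eta>"
  shows "\<exists>K q. 0 < K \<and> 0 < q \<and> q < 1 \<and>
    (\<forall>n. (\<Sum>i | i \<in> I n \<and> measure \<nu> (C n i) < exp (- real n * (H + 2 * \<eta>)). measure \<nu> (C n i)) \<le> K * q ^ n)"
proof -
  obtain \<delta> where \<delta>: "0 < \<delta>" "\<And>s. 0 < s \<Longrightarrow> s \<noteq> 1 \<Longrightarrow> \<bar>s - 1\<bar> < \<delta> \<Longrightarrow> (\<exists>K>0. \<forall>n.
      (\<Sum>i\<in>I n. measure \<nu> (C n i) powr s) \<le> K * exp (real n * ((1 - s) * H + \<eta> * \<bar>s - 1\<bar>)))"
    using growth[OF \<eta>] by blast
  \<comment> \<open>Below 1, so that light cylinders have small power \<open>1 - s\<close>; the cap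
    at 1 keeps \<open>s\<close> positive. The rate becomes
    \<open>(1 - s)(H + \<eta>) - (1 - s)(H + 2 \<eta>)\<close>, which is negative.\<close>
  define s where "s = 1 - min \<delta> 1 / 2"
  have s: "0 < s" "s < 1" "\<bar>s - 1\<bar> < \<delta>" using \<delta>(1) by (auto simp: s_def)
  obtain K where K: "0 < K" "\<And>n. (\<Sum>i\<in>I n. measure \<nu> (C n i) powr s) \<le> K * exp (real n * ((1 - s) * H + \<eta> * \<bar>s - 1\<bar>))"
    using \<delta>(2)[OF s(1) _ s(3)] s(2) by auto
  define q where "q = exp (- \<eta> * (1 - s))"
  have "(\<Sum>i | i \<in> I n \<and> measure \<nu> (C n i) < exp (- real n * (H + 2 * \<eta>)). measure \<nu> (C n i)) \<le> K * q ^ n" for n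
  proof -
    have "measure \<nu> (C n i) powr (1 - s) \<le> exp (- real n * ((H + 2 * \<eta>) * (1 - s)))"
      if "i \<in> {i. i \<in> I n \<and> measure \<nu> (C n i) < exp (- real n * (H + 2 * \<eta>))}" for i
      using powr_mono2[of "1 - s" "measure \<nu> (C n i)" "exp (- real n * (H + 2 * \<eta>))"] that s
      by (simp add: exp_powr_real mult.assoc)
    from chernoff[OF Collect_restrict this K(2)[of n], unfolded abs_exp_cancel]
    have "(\<Sum>i | i \<in> I n \<and> measure \<nu> (C n i) < exp (- real n * (H + 2 * \<eta>)). measure \<nu> (C n i)) \<le>
      K * exp (real n * ((1 - s) * H + \<eta> * \<bar>s - 1\<bar>)) * exp (- real n * ((H + 2 * \<eta>) * (1 - s)))" .
    also have "\<dots> = K * q ^ n"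
      using s unfolding q_def exp_of_nat_mult[symmetric] mult.assoc exp_add[symmetric]
      by (simp add: algebra_simps)
    finally show ?thesis .
  qed
  moreover have "0 < q" "q < 1" using \<eta> s by (auto simp: q_def)
  ultimately show ?thesis using K(1) by blast
qed

lemma heavy_cylinders:
  assumes \<eta>: "0 < \<eta>"
  shows "\<exists>K q. 0 < K \<and> 0 < q \<and> q < 1 \<and>
    (\<forall>n. (\<Sum>i | i \<in> I n \<and> exp (- real n * (H - 2 * \<eta>)) < measure \<nu> (C n i). measure \<nu> (C n i)) \<le> K * q ^ n)"
proof -
  obtain \<delta> where \<delta>: "0 < \<delta>" "\<And>s. 0 < s \<Longrightarrow> s \<noteq> 1 \<Longrightarrow> \<bar>s - 1\<bar> < \<delta> \<Longrightarrow> (\<exists>K>0. \<forall>n.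
      (\<Sum>i\<in>I n. measure \<nu> (C n i) powr s) \<le> K * exp (real n * ((1 - s) * H + \<eta> * \<bar>s - 1\<bar>)))"
    using growth[OF \<eta>] by blast
  \<comment> \<open>Above 1, where the exponent \<open>1 - s\<close> is negative and heavy cylinders
    are the ones with a small power.\<close>
  define s where "s = 1 + \<delta> / 2"
  have s: "0 < s" "1 < s" "\<bar>s - 1\<bar> < \<delta>" using \<delta>(1) by (auto simp: s_def)
  obtain K where K: "0 < K" "\<And>n. (\<Sum>i\<in>I n. measure \<nu> (C n i) powr s) \<le> K * exp (real n * ((1 - s) * H + \<eta> * \<bar>s - 1\<bar>))"
    using \<delta>(2)[OF s(1) _ s(3)] s(2) by auto
  define q where "q = exp (- \<eta> * (s - 1))"
  have "(\<Sum>i | i \<in> I n \<and> exp (- real n * (H - 2 * \<eta>)) < measure \<nu> (C n i). measure \<nu> (C n i)) \<le> K * q ^ n" for n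
  proof -
    have "measure \<nu> (C n i) powr (1 - s) \<le> exp (- real n * ((H - 2 * \<eta>) * (1 - s)))"
      if "i \<in> {i. i \<in> I n \<and> exp (- real n * (H - 2 * \<eta>)) < measure \<nu> (C n i)}" for i
      using powr_mono2'[of "1 - s" "exp (- real n * (H - 2 * \<eta>))" "measure \<nu> (C n i)"] that s
      by (simp add: exp_powr_real mult.assoc)
    from chernoff[OF Collect_restrict this K(2)[of n], unfolded abs_exp_cancel]
    have "(\<Sum>i | i \<in> I n \<and> exp (- real n * (H - 2 * \<eta>)) < measure \<nu> (C n i). measure \<nu> (C n i)) \<le>
      K * exp (real n * ((1 - s) * H + \<eta> * \<bar>s - 1\<bar>)) * exp (- real n * ((H - 2 * \<eta>) * (1 - s)))" .
    also have "\<dots> = K * q ^ n"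
      using s unfolding q_def exp_of_nat_mult[symmetric] mult.assoc exp_add[symmetric]
      by (simp add: algebra_simps)
    finally show ?thesis .
  qed
  moreover have "0 < q" "q < 1" using \<eta> s by (auto simp: q_def)
  ultimately show ?thesis using K(1) by blast
qed

subsection \<open>Upper bound\<close>

lemma hausdorff_measure_0I:
  assumes "\<And>\<delta> e. 0 < \<delta> \<Longrightarrow> 0 < e \<Longrightarrow> hausdorff_content d \<delta> E \<le> ennreal e"
  shows "hausdorff_measure d E = 0"
proof -
  have "hausdorff_content d \<delta> E = 0" if "0 < \<delta>" for \<delta>
    using assms[OF that] by (metis ennreal_le_epsilon add_0 le_zero_eq zero_less_one)
  then show ?thesis unfolding hausdorff_measure_def by simp
qed

lemma limsup_null:
  assumes G: "\<And>n. G n \<subseteq> I n" and d: "H' < d * \<rho>" "0 < d"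
    and card: "\<And>n. real (card (G n)) \<le> exp (real n * H')"
  shows "hausdorff_measure d (\<Inter>m. \<Union>n\<in>{m..}. \<Union>i\<in>G n. C n i) = 0" (is "hausdorff_measure d ?E = 0")
proof (rule hausdorff_measure_0I)
  fix \<delta> e :: real assume \<delta>: "0 < \<delta>" and e: "0 < e"
  \<comment> \<open>The square root of the ratio of the level sums: one factor \<open>q ^ n\<close>
    makes the series converge, the other is at most \<open>q ^ m\<close> and makes the tail
    small.\<close>
  define q where "q = exp ((H' - d * \<rho>) / 2)"
  have q: "0 < q" "q < 1" using d by (auto simp: q_def)
  define B where "B = c2 powr d"
  have B: "0 < B" using c2_pos by (simp add: B_def)
  have "(\<lambda>m. B * q ^ m * (1 / (1 - q))) \<longlonglongrightarrow> B * 0 * (1 / (1 - q))"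
    using q by (intro tendsto_intros LIMSEQ_power_zero) auto
  then have ev1: "eventually (\<lambda>m. B * q ^ m * (1 / (1 - q)) < e) sequentially"
    using e by (intro order_tendstoD(2)) auto
  have "(\<lambda>m. c2 * exp (- \<rho>) ^ m) \<longlonglongrightarrow> c2 * 0"
    using \<rho> by (intro tendsto_intros LIMSEQ_power_zero) auto
  then have ev2: "eventually (\<lambda>m. c2 * exp (- \<rho>) ^ m < \<delta>) sequentially"
    using \<delta> by (intro order_tendstoD(2)) auto
  obtain m where m: "B * q ^ m * (1 / (1 - q)) < e" "\<And>n. n \<ge> m \<Longrightarrow> c2 * exp (- \<rho>) ^ n < \<delta>"
    using eventually_conj[OF ev1 ev2] unfolding eventually_sequentially by (metis order_refl)
  have finG: "finite (G n)" for n using G finI by (rule finite_subset)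
  have "\<exists>h. bij_betw h {0..<card (G n)} (G n)" for n using ex_bij_betw_nat_finite[OF finG] .
  then obtain h where h: "\<And>n. bij_betw (h n) {0..<card (G n)} (G n)" by metis
  have hG: "h n j \<in> G n" if "j < card (G n)" for n j using bij_betwE[OF h[of n]] that by auto
  \<comment> \<open>Padding with empty sets, whose gauge is 0 even for exponent 0, turns the levels
    into one sequence.\<close>
  define V where "V = (\<lambda>(n, j). if m \<le> n \<and> j < card (G n) then C n (h n j) else {})"
  define U where "U i = V (prod_decode i)" for i
  have Ub: "bounded (U i) \<and> diameter (U i) \<le> \<delta>" for i
  proof -
    obtain n j where nj: "prod_decode i = (n, j)" by (metis surj_pair)
    show ?thesis
    proof (cases "m \<le> n \<and> j < card (G n)")
      case True
      then have "h n j \<in> I n" using hG G by blast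
      from C_diam[OF this] have "bounded (U i)" "diameter (U i) \<le> c2 * exp (- real n * \<rho>)"
        using True by (auto simp: U_def V_def nj)
      moreover have "c2 * exp (- real n * \<rho>) = c2 * exp (- \<rho>) ^ n"
        by (simp add: exp_of_nat_mult[symmetric])
      ultimately have "diameter (U i) \<le> \<delta>" using m(2)[of n] True by linarith
      with \<open>bounded (U i)\<close> show ?thesis by simp
    next
      case False then show ?thesis using \<delta> by (auto simp: U_def V_def nj)
    qed
  qed
  have cov: "?E \<subseteq> (\<Union>i. U i)"
  proof
    fix x assume "x \<in> ?E"
    then have "x \<in> (\<Union>n\<in>{m..}. \<Union>i\<in>G n. C n i)" by (rule INT_D) simp
    then obtain n i where n: "m \<le> n" "i \<in> G n" "x \<in> C n i" by auto
    then obtain j where j: "j < card (G n)" "h n j = i"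
      using bij_betw_imp_surj_on[OF h[of n]] by (metis atLeastLessThan_iff imageE)
    have "x \<in> U (prod_encode (n, j))" using n j by (simp add: U_def V_def)
    then show "x \<in> (\<Union>i. U i)" by blast
  qed
  define g where "g n = (\<Sum>j. diam_gauge d (V (n, j)))" for n
  have g: "g n \<le> ennreal (B * q ^ m * q ^ n)" for n
  proof (cases "m \<le> n")
    case False
    then show ?thesis by (simp add: g_def V_def diam_gauge_def)
  next
    case True
    have gauge: "diam_gauge d (V (n, j)) \<le> ennreal (B * exp (- real n * \<rho> * d))" if "j < card (G n)" for j
    proof -
      have V: "V (n, j) = C n (h n j)" using True that by (simp add: V_def)
      have b: "bounded (C n (h n j))" "diameter (C n (h n j)) \<le> c2 * exp (- real n * \<rho>)"
        using C_diam hG[OF that] G by blast+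
      have "diameter (C n (h n j)) powr d \<le> (c2 * exp (- real n * \<rho>)) powr d"
        using d b by (intro powr_mono2 diameter_ge_0) auto
      also have "\<dots> = B * exp (- real n * \<rho> * d)" using c2_pos by (simp add: powr_mult exp_powr_real B_def)
      finally show ?thesis unfolding V diam_gauge_def using d by (auto intro: ennreal_leI)
    qed
    have "g n = (\<Sum>j<card (G n). diam_gauge d (V (n, j)))"
      unfolding g_def by (rule suminf_finite) (auto simp: V_def diam_gauge_def)
    also have "\<dots> \<le> (\<Sum>j<card (G n). ennreal (B * exp (- real n * \<rho> * d)))"
      using gauge by (intro sum_mono) auto
    also have "\<dots> = ennreal (real (card (G n)) * (B * exp (- real n * \<rho> * d)))"
      using B by (simp add: ennreal_mult'' ennreal_of_nat_eq_real_of_nat)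
    also have "\<dots> \<le> ennreal (exp (real n * H') * (B * exp (- real n * \<rho> * d)))"
      using card B by (intro ennreal_leI mult_right_mono) auto
    also have "exp (real n * H') * (B * exp (- real n * \<rho> * d)) = B * (q ^ n * q ^ n)"
      unfolding q_def exp_of_nat_mult[symmetric] exp_add[symmetric]
      by (simp add: exp_add[symmetric] mult.left_commute algebra_simps)
    also have "ennreal (B * (q ^ n * q ^ n)) \<le> ennreal (B * (q ^ m * q ^ n))"
      using B q True by (intro ennreal_leI mult_left_mono mult_right_mono power_decreasing) auto
    finally show ?thesis by (simp add: mult.assoc)
  qed
  have "hausdorff_content d \<delta> ?E \<le> (\<Sum>i. diam_gauge d (U i))"
    unfolding hausdorff_content_def using cov Ub by (intro INF_lower) auto
  also have "\<dots> = (\<Sum>i. (\<lambda>p. diam_gauge d (V p)) (prod_decode i))" by (simp add: U_def)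
  also have "\<dots> = suminf g" by (rule suminf_ennreal_2dimen) (simp add: g_def)
  also have "\<dots> \<le> (\<Sum>n. ennreal (B * q ^ m * q ^ n))" using g by (intro suminf_le) auto
  also have "\<dots> = ennreal (B * q ^ m * (1 / (1 - q)))"
    using q B by (intro suminf_ennreal_eq sums_mult geometric_sums) auto
  also have "\<dots> \<le> ennreal e" using m(1) by (intro ennreal_leI) simp
  finally show "hausdorff_content d \<delta> ?E \<le> ennreal e" .
qed

lemma dim_le:
  assumes d: "H / \<rho> < d"
  shows "hausdorff_dim_measure \<nu> \<le> ereal d"
proof -
  \<comment> \<open>Makes \<open>H + 2 * \<eta>\<close> the midpoint of \<open>H\<close> and
    \<open>d * \<rho>\<close>.\<close>
  define \<eta> where "\<eta> = (d * \<rho> - H) / 4"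
  have dH: "H < d * \<rho>" using d \<rho> by (simp add: field_simps)
  then have \<eta>: "0 < \<eta>" by (simp add: \<eta>_def)
  have d0: "0 < d" using d H \<rho> by (meson divide_pos_pos less_trans)
  obtain K q where K: "0 < K" "0 < q" "q < 1" "\<And>n. (\<Sum>i | i \<in> I n \<and> measure \<nu> (C n i) < exp (- real n * (H + 2 * \<eta>)). measure \<nu> (C n i)) \<le> K * q ^ n"
    using light_cylinders[OF \<eta>] by blast
  define B where "B n = {i. i \<in> I n \<and> measure \<nu> (C n i) < exp (- real n * (H + 2 * \<eta>))}" for n
  define G where "G n = I n - B n" for n
  have card: "real (card (G n)) \<le> exp (real n * (H + 2 * \<eta>))" for n
  proof -
    have "real (card (G n)) * exp (- real n * (H + 2 * \<eta>)) = (\<Sum>i\<in>G n. exp (- real n * (H + 2 * \<eta>)))" by simp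
    also have "\<dots> \<le> (\<Sum>i\<in>G n. measure \<nu> (C n i))" by (intro sum_mono) (auto simp: G_def B_def)
    also have "\<dots> \<le> 1" by (rule sum_measure_le) (auto simp: G_def)
    finally have "real (card (G n)) * exp (- real n * (H + 2 * \<eta>)) * exp (real n * (H + 2 * \<eta>)) \<le> 1 * exp (real n * (H + 2 * \<eta>))"
      by (intro mult_right_mono) auto
    then show ?thesis by (simp add: mult.assoc exp_add[symmetric] algebra_simps)
  qed
  define E where "E = (\<Inter>m. \<Union>n\<in>{m..}. \<Union>i\<in>G n. C n i)"
  have "hausdorff_measure d E = 0"
    unfolding E_def
  proof (rule limsup_null[OF _ _ d0 card])
    show "H + 2 * \<eta> < d * \<rho>" using dH by (simp add: \<eta>_def field_simps)
  qed (auto simp: G_def)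
  then have dimE: "hausdorff_dim E \<le> ereal d"
    unfolding hausdorff_dim_def using d0 by (intro Inf_lower) auto
  have Gb: "(\<Union>i\<in>G n. C n i) \<in> sets borel" for n
    using finI C_borel by (intro sets.finite_UN) (auto simp: G_def)
  then have Eb: "E \<in> sets borel" unfolding E_def by (intro sets.countable_INT sets.countable_UN) auto
  have null: "UNIV - (\<Union>n\<in>{m..}. \<Union>i\<in>G n. C n i) \<in> null_sets \<nu>" for m
  proof -
    let ?N = "UNIV - (\<Union>n\<in>{m..}. \<Union>i\<in>G n. C n i)"
    have Ns: "?N \<in> sets \<nu>" unfolding sets_nu using Gb by (intro sets.Diff sets.countable_UN) auto
    \<comment> \<open>A point of the unit interval missed from level \<open>m\<close> on lies in a
      light cylinder at every later level, so the light mass of any single level bounds this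
      set.\<close>
    have le: "emeasure \<nu> ?N \<le> ennreal (K * q ^ n)" if "m \<le> n" for n
    proof -
      have Bs: "(\<Union>i\<in>B n. C n i) \<in> sets \<nu>"
        using finI C_sets by (intro sets.finite_UN) (auto simp: B_def)
      have "?N \<subseteq> (UNIV - {0..<1}) \<union> (\<Union>i\<in>B n. C n i)"
      proof
        fix x assume x: "x \<in> ?N"
        show "x \<in> (UNIV - {0..<1}) \<union> (\<Union>i\<in>B n. C n i)"
        proof (cases "x \<in> {0..<1}")
          case True
          then obtain i where i: "i \<in> I n" "x \<in> C n i" using cover by blast
          then have "i \<notin> G n" using x that by auto
          then show ?thesis using i by (auto simp: G_def)
        qed simp
      qed
      then have "emeasure \<nu> ?N \<le> emeasure \<nu> ((UNIV - {0..<1}) \<union> (\<Union>i\<in>B n. C n i))"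
        using Bs sets_nu by (intro emeasure_mono) auto
      also have "\<dots> \<le> emeasure \<nu> (UNIV - {0..<1}) + emeasure \<nu> (\<Union>i\<in>B n. C n i)"
        using Bs sets_nu by (intro emeasure_subadditive) auto
      also have "\<dots> \<le> ennreal (\<Sum>i\<in>B n. measure \<nu> (C n i))"
        unfolding off_unit_null using emeasure_Un_le[of "B n" n] by (auto simp: B_def)
      also have "\<dots> \<le> ennreal (K * q ^ n)" using K(4) by (intro ennreal_leI) (simp add: B_def)
      finally show ?thesis .
    qed
    have "(\<lambda>n. K * q ^ n) \<longlonglongrightarrow> K * 0" using K by (intro tendsto_intros LIMSEQ_power_zero) auto
    then have "(\<lambda>n. ennreal (K * q ^ n)) \<longlonglongrightarrow> ennreal (K * 0)" by (rule tendsto_ennrealI)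
    then have "emeasure \<nu> ?N \<le> ennreal (K * 0)"
      using le by (intro tendsto_lowerbound[of _ _ sequentially]) (auto simp: eventually_sequentially)
    then show ?thesis using Ns by (simp add: null_sets_def)
  qed
  have "UNIV - E = (\<Union>m. UNIV - (\<Union>n\<in>{m..}. \<Union>i\<in>G n. C n i))" unfolding E_def by blast
  moreover have "(\<Union>m. UNIV - (\<Union>n\<in>{m..}. \<Union>i\<in>G n. C n i)) \<in> null_sets \<nu>"
    using null by (rule null_sets_UN)
  ultimately have "UNIV - E \<in> null_sets \<nu>" by simp
  then have "emeasure \<nu> (UNIV - (UNIV - E)) = emeasure \<nu> UNIV"
    using sets_nu by (intro emeasure_Diff_null_set) auto
  then have "emeasure \<nu> E = 1" using space1 by (simp add: double_diff)
  then show ?thesis unfolding hausdorff_dim_measure_def using Eb dimE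
    by (intro INF_lower2[of E]) auto
qed

subsection \<open>Lower bound\<close>

text \<open>The cylinders lie in an interval of length \<open>2 * (a + b)\<close>, are disjoint and
  have length at least \<open>a\<close>; Lebesgue measure counts them.\<close>

lemma meeting_count:
  assumes J: "J \<subseteq> I n" and U: "bounded U" "diameter U \<le> c1 * exp (- real n * \<rho>)"
    and meet: "\<And>i. i \<in> J \<Longrightarrow> C n i \<inter> U \<noteq> {}"
  shows "real (card J) \<le> 2 * (c1 + c2) / c1"
proof (cases "J = {}")
  case True
  then show ?thesis using c1 c2_pos by simp
next
  case False
  define a where "a = c1 * exp (- real n * \<rho>)"
  define b where "b = c2 * exp (- real n * \<rho>)"
  have a: "0 < a" and b: "0 < b" using c1 c2_pos by (auto simp: a_def b_def)
  have fin: "finite J" using J finI by (rule finite_subset)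
  obtain x0 where x0: "x0 \<in> U" using False meet by blast
  have sub: "C n i \<subseteq> {x0 - (a + b)..x0 + (a + b)}" if i: "i \<in> J" for i
  proof
    fix x assume x: "x \<in> C n i"
    obtain y where y: "y \<in> C n i" "y \<in> U" using meet[OF i] by blast
    have "dist x y \<le> diameter (C n i)"
      using C_diam[of i n] J i x y by (intro diameter_bounded_bound) auto
    then have "dist x y \<le> b" using C_diam[of i n] J i unfolding b_def by force
    moreover have "dist y x0 \<le> a" using diameter_bounded_bound[OF U(1) y(2) x0] U(2) unfolding a_def by linarith
    ultimately show "x \<in> {x0 - (a + b)..x0 + (a + b)}" by (auto simp: dist_real_def abs_le_iff)
  qed
  have len: "ennreal a \<le> emeasure lborel (C n i)" if i: "i \<in> J" for i
  proof -
    obtain c len where c: "C n i = {c..<c + len}" "a \<le> len" using interval[of i n] i J unfolding a_def by blast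
    then show ?thesis using a by (auto intro: ennreal_leI)
  qed
  have "ennreal (real (card J) * a) = (\<Sum>i\<in>J. ennreal a)"
    using a by (simp add: ennreal_mult'' ennreal_of_nat_eq_real_of_nat)
  also have "\<dots> \<le> (\<Sum>i\<in>J. emeasure lborel (C n i))" using len by (intro sum_mono) auto
  also have "\<dots> = emeasure lborel (\<Union>i\<in>J. C n i)"
  proof (rule sum_emeasure)
    show "C n ` J \<subseteq> sets lborel" using C_borel J by auto
    show "disjoint_family_on (C n) J" using disj J unfolding disjoint_family_on_def by blast
  qed (rule fin)
  also have "\<dots> \<le> emeasure lborel {x0 - (a + b)..x0 + (a + b)}"
    using sub by (intro emeasure_mono UN_least) auto
  also have "\<dots> = ennreal (2 * (a + b))" using a b by simp
  finally have "real (card J) * a \<le> 2 * (a + b)" using a b by (subst (asm) ennreal_le_iff) auto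
  then have "(real (card J) * c1) * exp (- real n * \<rho>) \<le> (2 * (c1 + c2)) * exp (- real n * \<rho>)"
    by (simp add: a_def b_def algebra_simps)
  then have "real (card J) * c1 \<le> 2 * (c1 + c2)" by simp
  then show ?thesis using c1 by (simp add: field_simps)
qed

text \<open>For a cover of small sets, each set is replaced by the non-heavy cylinders of comparable size
  meeting it (the covering sets need not be measurable); \<open>e\<close> takes care of sets of diameter 0.\<close>

lemma covering_mass:
  assumes \<eta>: "0 < \<eta>" "2 * \<eta> < H"
  defines "dd \<equiv> (H - 2 * \<eta>) / \<rho>"
  shows "\<exists>K3>0. \<forall>n0 U e. bounded U \<and> diameter U \<le> c1 * exp (- real n0 * \<rho>) \<and> 0 < e \<longrightarrow>
    (\<exists>n\<ge>n0. \<exists>V\<in>sets borel. emeasure \<nu> V \<le> ennreal (K3 * diameter U powr dd + e) \<and>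
       (\<forall>i\<in>I n. measure \<nu> (C n i) \<le> exp (- real n * (H - 2 * \<eta>)) \<longrightarrow> U \<inter> C n i \<subseteq> V))"
proof -
  define Kc where "Kc = 2 * (c1 + c2) / c1"
  have Kc: "0 < Kc" using c1 c2_pos by (simp add: Kc_def)
  \<comment> \<open>\<open>Kc\<close> counts the cylinders meeting the set;
    \<open>exp \<rho>\<close> pays for rounding the matching scale to an integer level.\<close>
  define K3 where "K3 = Kc * (exp \<rho> / c1) powr dd"
  have K3: "0 < K3" using Kc c1 by (simp add: K3_def)
  have dd: "0 < dd" using \<eta> \<rho> by (simp add: dd_def)
  have ddr: "dd * \<rho> = H - 2 * \<eta>" using \<rho> by (simp add: dd_def)
  have "\<exists>n\<ge>n0. \<exists>V\<in>sets borel. emeasure \<nu> V \<le> ennreal (K3 * diameter U powr dd + e) \<and>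
       (\<forall>i\<in>I n. measure \<nu> (C n i) \<le> exp (- real n * (H - 2 * \<eta>)) \<longrightarrow> U \<inter> C n i \<subseteq> V)"
    if U: "bounded U" "diameter U \<le> c1 * exp (- real n0 * \<rho>)" and e: "0 < e" for n0 U e
  proof -
    have "\<exists>n\<ge>n0. diameter U \<le> c1 * exp (- real n * \<rho>) \<and>
       Kc * exp (- real n * (H - 2 * \<eta>)) \<le> K3 * diameter U powr dd + e"
    proof (cases "diameter U = 0")
      case True
      have "(\<lambda>n. Kc * exp (- (H - 2 * \<eta>)) ^ n) \<longlonglongrightarrow> Kc * 0"
        using \<eta> by (intro tendsto_intros LIMSEQ_power_zero) auto
      then have "eventually (\<lambda>n. Kc * exp (- (H - 2 * \<eta>)) ^ n < e) sequentially"
        using e by (intro order_tendstoD(2)) auto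
      then have "eventually (\<lambda>n. n0 \<le> n \<and> Kc * exp (- (H - 2 * \<eta>)) ^ n < e) sequentially"
        by (intro eventually_conj eventually_ge_at_top)
      then obtain n where n: "n0 \<le> n" "Kc * exp (- (H - 2 * \<eta>)) ^ n < e"
        by (auto dest: eventually_happens)
      have "exp (- (H - 2 * \<eta>)) ^ n = exp (- real n * (H - 2 * \<eta>))"
        by (simp add: exp_of_nat_mult[symmetric] algebra_simps)
      then show ?thesis using n True c1 by (intro exI[of _ n]) auto
    next
      case False
      then have D: "0 < diameter U" using diameter_ge_0[OF U(1)] by simp
      \<comment> \<open>The real level whose scale \<open>c1 * exp (- t * \<rho>)\<close> equals the
        diameter.\<close>
      define t where "t = ln (c1 / diameter U) / \<rho>"
      have et: "exp (t * \<rho>) = c1 / diameter U" using D c1 \<rho> by (simp add: t_def)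
      have "exp (real n0 * \<rho>) \<le> exp (t * \<rho>)"
        unfolding et using U(2) D by (simp add: exp_minus field_simps)
      then have t0: "real n0 \<le> t" using \<rho> by simp
      define n where "n = nat \<lfloor>t\<rfloor>"
      have n: "n0 \<le> n" "real n \<le> t" "t < real n + 1" using t0 unfolding n_def by linarith+
      have 1: "diameter U \<le> c1 * exp (- real n * \<rho>)"
      proof -
        have "exp (real n * \<rho>) \<le> c1 / diameter U" unfolding et[symmetric] using n \<rho> by simp
        then show ?thesis using D by (simp add: exp_minus field_simps)
      qed
      have "exp (- real n * \<rho>) \<le> exp \<rho> / c1 * diameter U"
      proof -
        have "c1 / diameter U \<le> exp ((real n + 1) * \<rho>)" unfolding et[symmetric] using n \<rho> by simp
        then show ?thesis using D c1 by (simp add: exp_minus exp_add algebra_simps field_simps)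
      qed
      then have "exp (- real n * \<rho>) powr dd \<le> (exp \<rho> / c1 * diameter U) powr dd"
        using dd by (intro powr_mono2) auto
      also have "\<dots> = (exp \<rho> / c1) powr dd * diameter U powr dd" by (rule powr_mult)
      also have "exp (- real n * \<rho>) powr dd = exp (- real n * (H - 2 * \<eta>))"
        unfolding ddr[symmetric] exp_powr_real by (simp add: mult_ac)
      finally have "exp (- real n * (H - 2 * \<eta>)) \<le> (exp \<rho> / c1) powr dd * diameter U powr dd" .
      then have "Kc * exp (- real n * (H - 2 * \<eta>)) \<le> K3 * diameter U powr dd"
        unfolding K3_def using Kc by (simp add: mult.assoc)
      then show ?thesis using n 1 e by (intro exI[of _ n]) auto
    qed
    then obtain n where n: "n0 \<le> n" "diameter U \<le> c1 * exp (- real n * \<rho>)"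
       "Kc * exp (- real n * (H - 2 * \<eta>)) \<le> K3 * diameter U powr dd + e" by blast
    define J where "J = {i \<in> I n. measure \<nu> (C n i) \<le> exp (- real n * (H - 2 * \<eta>)) \<and> C n i \<inter> U \<noteq> {}}"
    define V where "V = (\<Union>i\<in>J. C n i)"
    have J: "J \<subseteq> I n" by (auto simp: J_def)
    have fin: "finite J" using J finI by (rule finite_subset)
    have Vb: "V \<in> sets borel" unfolding V_def using fin C_borel J by (intro sets.finite_UN) auto
    have "real (card J) \<le> Kc" unfolding Kc_def
      by (rule meeting_count[OF J U(1) n(2)]) (auto simp: J_def)
    then have "(\<Sum>i\<in>J. measure \<nu> (C n i)) \<le> K3 * diameter U powr dd + e"
    proof -
      have "(\<Sum>i\<in>J. measure \<nu> (C n i)) \<le> (\<Sum>i\<in>J. exp (- real n * (H - 2 * \<eta>)))"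
        by (intro sum_mono) (auto simp: J_def)
      also have "\<dots> = real (card J) * exp (- real n * (H - 2 * \<eta>))" by simp
      also have "\<dots> \<le> Kc * exp (- real n * (H - 2 * \<eta>))"
        using \<open>real (card J) \<le> Kc\<close> by (intro mult_right_mono) auto
      finally show ?thesis using n(3) by linarith
    qed
    then have "emeasure \<nu> V \<le> ennreal (K3 * diameter U powr dd + e)"
      using emeasure_Un_le[OF J] unfolding V_def by (meson ennreal_leI order_trans)
    moreover have "\<forall>i\<in>I n. measure \<nu> (C n i) \<le> exp (- real n * (H - 2 * \<eta>)) \<longrightarrow> U \<inter> C n i \<subseteq> V"
      by (auto simp: V_def J_def)
    ultimately show ?thesis using n(1) Vb by blast
  qed
  then show ?thesis using K3 by blast
qed

text \<open>Mass distribution: if the content were small, the heavy cylinders from level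
  \<open>n0\<close> on (mass at most 1/4) and the masses charged to the covering sets (at most 3/8)
  could not carry total mass 1.\<close>

lemma dim_ge:
  assumes E: "E \<in> sets borel" "emeasure \<nu> E = 1" and s: "0 \<le> s" "hausdorff_measure s E = 0"
  shows "H / \<rho> \<le> s"
proof (rule ccontr)
  assume "\<not> H / \<rho> \<le> s"
  then have sH: "s * \<rho> < H" using \<rho> by (simp add: field_simps)
  \<comment> \<open>Puts \<open>dd\<close> halfway between \<open>s\<close> and
    \<open>H / \<rho>\<close>.\<close>
  define \<eta> where "\<eta> = (H - s * \<rho>) / 4"
  have "0 \<le> s * \<rho>" using s(1) \<rho> by simp
  then have "- (s * \<rho>) < H" using H by linarith
  then have \<eta>: "0 < \<eta>" "2 * \<eta> < H" using sH by (simp_all add: \<eta>_def field_simps)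
  define dd where "dd = (H - 2 * \<eta>) / \<rho>"
  have sdd: "s < dd" using sH \<rho> by (simp add: dd_def \<eta>_def field_simps)
  obtain K q where K: "0 < K" "0 < q" "q < 1" "\<And>n. (\<Sum>i | i \<in> I n \<and> exp (- real n * (H - 2 * \<eta>)) < measure \<nu> (C n i). measure \<nu> (C n i)) \<le> K * q ^ n"
    using heavy_cylinders[OF \<eta>(1)] by blast
  define B where "B n = {i. i \<in> I n \<and> exp (- real n * (H - 2 * \<eta>)) < measure \<nu> (C n i)}" for n
  obtain K3 where K3: "0 < K3" "\<forall>n0 U e. bounded U \<and> diameter U \<le> c1 * exp (- real n0 * \<rho>) \<and> 0 < e \<longrightarrow>
    (\<exists>n\<ge>n0. \<exists>V\<in>sets borel. emeasure \<nu> V \<le> ennreal (K3 * diameter U powr dd + e) \<and>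
       (\<forall>i\<in>I n. measure \<nu> (C n i) \<le> exp (- real n * (H - 2 * \<eta>)) \<longrightarrow> U \<inter> C n i \<subseteq> V))"
    using covering_mass[OF \<eta>, folded dd_def] by (elim exE conjE) (rule that)
  have "(\<lambda>n. K * q ^ n * (1 / (1 - q))) \<longlonglongrightarrow> K * 0 * (1 / (1 - q))"
    using K by (intro tendsto_intros LIMSEQ_power_zero) auto
  then have "eventually (\<lambda>n. K * q ^ n * (1 / (1 - q)) < 1 / 4) sequentially"
    by (intro order_tendstoD(2)) auto
  then obtain n0 where n0: "K * q ^ n0 * (1 / (1 - q)) < 1 / 4" by (auto dest: eventually_happens)
  define Bad where "Bad = (\<Union>m. \<Union>i\<in>B (n0 + m). C (n0 + m) i)"
  have BI: "B n \<subseteq> I n" for n by (auto simp: B_def)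
  have Bb: "(\<Union>i\<in>B n. C n i) \<in> sets \<nu>" for n
    using finite_subset[OF BI finI] by (intro sets.finite_UN C_sets) (auto dest: subsetD[OF BI])
  then have Badb: "Bad \<in> sets \<nu>" unfolding Bad_def by (intro sets.countable_UN) auto
  have Bad: "emeasure \<nu> Bad \<le> ennreal (1 / 4)"
  proof -
    have "emeasure \<nu> Bad \<le> (\<Sum>m. emeasure \<nu> (\<Union>i\<in>B (n0 + m). C (n0 + m) i))"
      unfolding Bad_def using Bb by (intro emeasure_subadditive_countably) auto
    also have "\<dots> \<le> (\<Sum>m. ennreal (K * q ^ n0 * q ^ m))"
    proof (intro suminf_le)
      fix m
      have "emeasure \<nu> (\<Union>i\<in>B (n0 + m). C (n0 + m) i) \<le> ennreal (\<Sum>i\<in>B (n0 + m). measure \<nu> (C (n0 + m) i))"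
        by (rule emeasure_Un_le[OF BI])
      also have "\<dots> \<le> ennreal (K * q ^ (n0 + m))" using K(4)[of "n0 + m"] unfolding B_def by (intro ennreal_leI)
      finally show "emeasure \<nu> (\<Union>i\<in>B (n0 + m). C (n0 + m) i) \<le> ennreal (K * q ^ n0 * q ^ m)"
        by (simp add: power_add mult.assoc)
    qed auto
    also have "\<dots> = ennreal (K * q ^ n0 * (1 / (1 - q)))"
      using K by (intro suminf_ennreal_eq sums_mult geometric_sums) auto
    also have "\<dots> \<le> ennreal (1 / 4)" using n0 by (intro ennreal_leI) simp
    finally show ?thesis .
  qed
  \<comment> \<open>The bound 1 lets the power \<open>dd\<close> be replaced by the smaller exponent
    \<open>s\<close>; the other bound forces the matching levels to be at least
    \<open>n0\<close>.\<close>
  define \<delta> where "\<delta> = min 1 (c1 * exp (- real n0 * \<rho>))"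
  have \<delta>: "0 < \<delta>" using c1 by (simp add: \<delta>_def)
  have "hausdorff_content s \<delta> E \<le> hausdorff_measure s E"
    unfolding hausdorff_measure_def using \<delta> by (intro SUP_upper) auto
  then have "hausdorff_content s \<delta> E < ennreal (1 / (8 * K3))" using s(2) K3(1) by simp
  then obtain U where U: "E \<subseteq> (\<Union>i. U i)" "\<And>i. bounded (U i) \<and> diameter (U i) \<le> \<delta>"
    "(\<Sum>i. diam_gauge s (U i)) < ennreal (1 / (8 * K3))"
    unfolding hausdorff_content_def INF_less_iff by blast
  \<comment> \<open>Total 1/4; the threshold \<open>1 / (8 * K3)\<close> contributes another
    1/8.\<close>
  define e :: "nat \<Rightarrow> real" where "e i = (1 / 8) * (1 / 2) ^ i" for i
  define P where "P i n V \<longleftrightarrow> n0 \<le> n \<and> V \<in> sets borel \<and> emeasure \<nu> V \<le> ennreal (K3 * diameter (U i) powr dd + e i) \<and>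
       (\<forall>j\<in>I n. measure \<nu> (C n j) \<le> exp (- real n * (H - 2 * \<eta>)) \<longrightarrow> U i \<inter> C n j \<subseteq> V)" for i n V
  have "\<exists>n V. P i n V" for i
  proof -
    have "bounded (U i) \<and> diameter (U i) \<le> c1 * exp (- real n0 * \<rho>) \<and> 0 < e i"
      using U(2)[of i] by (auto simp: \<delta>_def e_def)
    from K3(2)[rule_format, OF this] show ?thesis unfolding P_def by blast
  qed
  then obtain n V where P: "\<And>i. P i (n i) (V i)" by metis
  have nV: "\<And>i. n0 \<le> n i" "\<And>i. V i \<in> sets borel"
    "\<And>i. emeasure \<nu> (V i) \<le> ennreal (K3 * diameter (U i) powr dd + e i)"
    "\<And>i j. j \<in> I (n i) \<Longrightarrow> measure \<nu> (C (n i) j) \<le> exp (- real (n i) * (H - 2 * \<eta>)) \<Longrightarrow> U i \<inter> C (n i) j \<subseteq> V i"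
    using P unfolding P_def by blast+
  have "E \<subseteq> (UNIV - {0..<1}) \<union> Bad \<union> (\<Union>i. V i)"
  proof
    fix x assume "x \<in> E"
    then obtain i where i: "x \<in> U i" using U(1) by blast
    show "x \<in> (UNIV - {0..<1}) \<union> Bad \<union> (\<Union>i. V i)"
    proof (cases "x \<in> {0..<1}")
      case True
      then obtain j where j: "j \<in> I (n i)" "x \<in> C (n i) j" using cover by blast
      show ?thesis
      proof (cases "j \<in> B (n i)")
        case True
        then have "x \<in> (\<Union>j\<in>B (n0 + (n i - n0)). C (n0 + (n i - n0)) j)" using j nV(1)[of i] by auto
        then show ?thesis unfolding Bad_def by blast
      next
        case False
        then have "measure \<nu> (C (n i) j) \<le> exp (- real (n i) * (H - 2 * \<eta>))" using j(1) by (simp add: B_def not_less)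
        then show ?thesis using nV(4)[OF j(1)] i j(2) by blast
      qed
    qed simp
  qed
  moreover have Vs: "V i \<in> sets \<nu>" for i using nV(2) sets_nu by simp
  ultimately have E1: "1 \<le> emeasure \<nu> ((UNIV - {0..<1}) \<union> Bad \<union> (\<Union>i. V i))"
    unfolding E(2)[symmetric] using Badb sets_nu by (intro emeasure_mono) auto
  have V38: "emeasure \<nu> (\<Union>i. V i) \<le> ennreal (3 / 8)"
  proof -
    have "emeasure \<nu> (\<Union>i. V i) \<le> (\<Sum>i. emeasure \<nu> (V i))"
      using Vs by (intro emeasure_subadditive_countably) auto
    also have "\<dots> \<le> (\<Sum>i. ennreal K3 * diam_gauge s (U i) + ennreal (e i))"
    proof (intro suminf_le)
      fix i
      have D: "0 \<le> diameter (U i)" "diameter (U i) \<le> 1"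
        using U(2)[of i] diameter_ge_0[of "U i"] by (auto simp: \<delta>_def)
      have "ennreal (diameter (U i) powr dd) \<le> diam_gauge s (U i)"
      proof (cases "U i = {}")
        case True then show ?thesis by simp
      next
        case False
        have "diameter (U i) powr dd \<le> 1" using D s sdd by (intro powr_le1) auto
        moreover have "diameter (U i) powr dd \<le> diameter (U i) powr s"
          using D sdd by (intro powr_mono') auto
        ultimately show ?thesis using False by (auto simp: diam_gauge_def intro: ennreal_leI)
      qed
      then have "ennreal K3 * ennreal (diameter (U i) powr dd) + ennreal (e i)
         \<le> ennreal K3 * diam_gauge s (U i) + ennreal (e i)"
        by (intro add_right_mono mult_left_mono) auto
      moreover have "ennreal (K3 * diameter (U i) powr dd + e i) = ennreal K3 * ennreal (diameter (U i) powr dd) + ennreal (e i)"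
        using K3(1) by (simp add: e_def ennreal_plus ennreal_mult')
      ultimately show "emeasure \<nu> (V i) \<le> ennreal K3 * diam_gauge s (U i) + ennreal (e i)"
        using nV(3)[of i] by (metis order_trans)
    qed auto
    also have "\<dots> = ennreal K3 * (\<Sum>i. diam_gauge s (U i)) + (\<Sum>i. ennreal (e i))"
      by (simp add: suminf_add[symmetric])
    also have "\<dots> \<le> ennreal (1 / 8) + ennreal (1 / 4)"
    proof (rule add_mono)
      have "ennreal K3 * (\<Sum>i. diam_gauge s (U i)) \<le> ennreal K3 * ennreal (1 / (8 * K3))"
        using U(3) by (intro mult_left_mono) auto
      also have "\<dots> = ennreal (1 / 8)" using K3(1) by (simp add: ennreal_mult'[symmetric])
      finally show "ennreal K3 * (\<Sum>i. diam_gauge s (U i)) \<le> ennreal (1 / 8)" .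
      have "(\<Sum>i. ennreal (e i)) = ennreal ((1 / 8) * (1 / (1 - 1 / 2)))"
        unfolding e_def by (intro suminf_ennreal_eq sums_mult geometric_sums) auto
      then show "(\<Sum>i. ennreal (e i)) \<le> ennreal (1 / 4)" by simp
    qed
    also have "\<dots> = ennreal (3 / 8)" by (subst ennreal_plus[symmetric]) auto
    finally show ?thesis .
  qed
  have "emeasure \<nu> ((UNIV - {0..<1}) \<union> Bad) \<le> emeasure \<nu> (UNIV - {0..<1}) + emeasure \<nu> Bad"
    using Badb sets_nu by (intro emeasure_subadditive) auto
  then have B14: "emeasure \<nu> ((UNIV - {0..<1}) \<union> Bad) \<le> ennreal (1 / 4)" using Bad off_unit_null by simp
  note E1
  also have "emeasure \<nu> ((UNIV - {0..<1}) \<union> Bad \<union> (\<Union>i. V i)) \<le>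
     emeasure \<nu> ((UNIV - {0..<1}) \<union> Bad) + emeasure \<nu> (\<Union>i. V i)"
    using Badb Vs sets_nu by (intro emeasure_subadditive) auto
  also have "\<dots> \<le> ennreal (1 / 4) + emeasure \<nu> (\<Union>i. V i)" by (rule add_right_mono[OF B14])
  finally have "1 \<le> ennreal (1 / 4) + emeasure \<nu> (\<Union>i. V i)" .
  also have "\<dots> \<le> ennreal (1 / 4) + ennreal (3 / 8)" by (rule add_left_mono[OF V38])
  also have "\<dots> = ennreal (5 / 8)" by (subst ennreal_plus[symmetric]) auto
  finally have "ennreal 1 \<le> ennreal (5 / 8)" by simp
  then show False by (subst (asm) ennreal_le_iff) auto
qed

theorem dim_measure_eq: "hausdorff_dim_measure \<nu> = ereal (H / \<rho>)"
proof (rule antisym)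
  show "hausdorff_dim_measure \<nu> \<le> ereal (H / \<rho>)"
  proof (rule ereal_le_epsilon2)
    fix e :: real assume "0 < e"
    then show "hausdorff_dim_measure \<nu> \<le> ereal (H / \<rho>) + ereal e"
      using dim_le[of "H / \<rho> + e"] by simp
  qed
  show "ereal (H / \<rho>) \<le> hausdorff_dim_measure \<nu>"
    unfolding hausdorff_dim_measure_def
  proof (rule INF_greatest)
    fix E assume "E \<in> {E. E \<in> sets borel \<and> emeasure \<nu> E = 1}"
    then show "ereal (H / \<rho>) \<le> hausdorff_dim E"
      unfolding hausdorff_dim_def using dim_ge by (intro Inf_greatest) auto
  qed
qed

end

section \<open>Application to the sequence of exchanges induced after whole periods\<close>

section \<open>Hyperbolic periodic type\<close>

lemma measure_lborel_iet_interval: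
  assumes "is_iet T" shows "measure lborel (iet_interval T a) = len T $ a"
  using is_iet_D(5)[OF assms, of a] by (simp add: iet_interval_def)

lemma iter_vec_add: "iter_vec W n (v + w) = iter_vec W n v + iter_vec W n w"
  by (induction n) (auto simp: matrix_vector_right_distrib)

lemma iter_vec_fixed: "word_matrix W 0 *v v = v \<Longrightarrow> iter_vec W n v = v"
  by (induction n) auto

context iet_sequence
begin

abbreviation "\<rho>\<^sub>0 \<equiv> ln (pf_eigenvalue (word_matrix W 0))"

lemma card_ge_2: "CARD('a) \<ge> 2"
  using iet[of 0] by (simp add: is_iet_def)

lemma rho0_pos: "0 < \<rho>\<^sub>0"
  using pf_word_gt_1[OF pos card_ge_2] by simp

text \<open>Lebesgue measure scales with the vector 0, so the lengths obey a recursion with the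
  constant matrix \<open>word_matrix W 0\<close>, and \<open>constant_growth\<close>
  applies.\<close>

lemma length_growth:
  "\<exists>K>0. \<forall>n a. len (S n) $ a \<le> K * exp (- real n * \<rho>\<^sub>0) \<and> exp (- real n * \<rho>\<^sub>0) \<le> K * len (S n) $ a"
proof -
  have rec: "len (S n) = len (S (Suc n)) v* word_matrix W 0" for n
  proof -
    have "emeasure lborel (iet_interval (S (Suc n)) a) < \<infinity>" for a
      using is_iet_D(5)[OF iet, of "Suc n" a] by (simp add: iet_interval_def)
    from scales_partition[OF iet iet tow lborel_scales[OF iet] this]
    show ?thesis by (simp add: measure_lborel_iet_interval[OF iet])
  qed
  have nz: "len (S 0) \<noteq> 0" using is_iet_D(5)[OF iet, of 0] by (metis less_irrefl zero_index)
  note pf = pf_word[OF pos, where w = 0]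
  interpret left_recursion W "\<lambda>_. 0" 0 "snd (pf_vectors (word_matrix W 0))"
    "pf_eigenvalue (word_matrix W 0)" "\<lambda>n. len (S n)"
    by unfold_locales (rule pos tendsto_const pf nz rec less_imp_le[OF is_iet_D(5)[OF iet]])+
  show ?thesis by (rule constant_growth) simp
qed

lemma iter_word_first: "iter_word W n a ! 0 = ((\<lambda>a. W a ! 0) ^^ n) a"
proof (induction n arbitrary: a)
  case (Suc n)
  obtain x u where W: "W a = x # u" using tower_over_D(2)[OF tow] by (metis neq_Nil_conv)
  have "iter_word W n x \<noteq> []" using tower_over_D(2)[OF tower_iter] .
  then have "iter_word W (Suc n) a ! 0 = iter_word W n (W a ! 0) ! 0"
    by (simp add: W nth_append)
  also have "\<dots> = ((\<lambda>a. W a ! 0) ^^ Suc n) a" by (simp only: funpow_Suc_right comp_apply Suc)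
  finally show ?case .
qed simp

text \<open>All domains have the left endpoint 0 and they shrink, so eventually they lie in the first interval.\<close>

lemma first_letter_stabilizes: "\<exists>n. \<forall>a b. ((\<lambda>a. W a ! 0) ^^ n) a = ((\<lambda>a. W a ! 0) ^^ n) b"
proof -
  obtain K where K: "0 < K" "\<And>n a. len (S n) $ a \<le> K * exp (- real n * \<rho>\<^sub>0)"
    using length_growth by blast
  have "0 \<in> iet_dom (S 0)" unfolding iet_dom_def using is_iet_D(5)[OF iet] by (auto intro: sum_pos)
  then obtain a0 where a0: "0 \<in> iet_interval (S 0) a0" using iet_interval_cover[OF iet] by blast
  have "0 \<le> left_t (S 0) a0" unfolding left_t_left_end using is_iet_D(5)[OF iet] by (rule left_end_nonneg)
  then have I0: "iet_interval (S 0) a0 = {0..<len (S 0) $ a0}" using a0 by (auto simp: iet_interval_def)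
  have "(\<lambda>n. real CARD('a) * K * exp (- \<rho>\<^sub>0) ^ n) \<longlonglongrightarrow> real CARD('a) * K * 0"
    using rho0_pos by (intro tendsto_intros LIMSEQ_power_zero) auto
  then have "eventually (\<lambda>n. real CARD('a) * K * exp (- \<rho>\<^sub>0) ^ n < len (S 0) $ a0) sequentially"
    using is_iet_D(5)[OF iet, of 0 a0] by (intro order_tendstoD(2)) auto
  then obtain n where n: "real CARD('a) * K * exp (- \<rho>\<^sub>0) ^ n < len (S 0) $ a0"
    by (auto dest: eventually_happens)
  have "(\<Sum>a\<in>UNIV. len (S n) $ a) \<le> real CARD('a) * (K * exp (- real n * \<rho>\<^sub>0))"
    using K(2) by (intro sum_bounded_above) auto
  also have "\<dots> = real CARD('a) * K * exp (- \<rho>\<^sub>0) ^ n" by (simp add: exp_of_nat_mult[symmetric])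
  finally have sub: "iet_dom (S n) \<subseteq> iet_interval (S 0) a0"
    unfolding I0 iet_dom_def using n by auto
  have "iter_word W n a ! 0 = a0" for a
  proof -
    let ?x = "left_t (S n) a"
    have x: "?x \<in> iet_interval (S n) a" by (rule iet_interval_ne[OF iet])
    then have "?x \<in> iet_interval (S 0) a0" using sub iet_interval_subset[OF iet] by blast
    moreover have "?x \<in> iet_interval (S 0) (iter_word W n a ! 0)"
      using tower_over_D(4)[OF tower_iter x, of 0] tower_over_D(3)[OF tower_iter] by simp
    ultimately show ?thesis using iet_interval_unique[OF iet] by blast
  qed
  then show ?thesis unfolding iter_word_first by metis
qed

theorem conformal_dimension:
  assumes dom: "iet_dom (S 0) = {0..<1}" and conf: "conformal_measure (S 0) v \<nu>"
    and conv: "(\<lambda>n. iter_vec W n v) \<longlonglongrightarrow> w"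
  shows "hausdorff_dim_measure \<nu> = ereal (word_entropy W w / \<rho>\<^sub>0)"
proof -
  have sets: "sets \<nu> = sets borel" and U1: "emeasure \<nu> UNIV = 1" and I1: "emeasure \<nu> {0..<1} = 1"
    using conf by (auto simp: conformal_measure_def)
  have finite: "finite_measure \<nu>"
    using U1 sets_eq_imp_space_eq[OF sets] by (intro finite_measureI) simp
  have fin: "emeasure \<nu> A < \<infinity>" for A
    using finite_measure.emeasure_finite[OF finite] by (simp add: top.not_eq_extremum)
  have sc: "scales \<nu> (S 0) v" by (rule conformal_scales[OF iet conf])
  define L where "L n = (\<chi> a. measure \<nu> (iet_interval (S n) a))" for n
  have rec: "L n = L (Suc n) v* word_matrix W (iter_vec W n v)" for n
    unfolding L_def by (rule scales_partition[OF iet iet tow scales_iter[OF sc] fin])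
  \<comment> \<open>The level-0 intervals cover the unit interval, which has mass 1.\<close>
  have L0: "L 0 \<noteq> 0"
  proof
    assume "L 0 = 0"
    then have "measure \<nu> (iet_interval (S 0) a) = 0" for a by (simp add: L_def vec_eq_iff)
    then have "iet_interval (S 0) a \<in> null_sets \<nu>" for a
      using sets finite_measure.emeasure_eq_measure[OF finite] by (simp add: null_sets_def)
    then have "(\<Union>a\<in>UNIV. iet_interval (S 0) a) \<in> null_sets \<nu>" by (intro null_sets.finite_UN) auto
    moreover have "(\<Union>a\<in>UNIV. iet_interval (S 0) a) = {0..<1}"
      using iet_interval_cover[OF iet, of _ 0] iet_interval_subset[OF iet, of 0] unfolding dom by blast
    ultimately show False using I1 by (simp add: null_sets_def)
  qed
  define I where "I n = (SIGMA a:UNIV. {..<length (iter_word W n a)})" for n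
  define C where "C n = (\<lambda>(a, k). cyl n a k)" for n
  obtain K where K: "0 < K" "\<And>n a. len (S n) $ a \<le> K * exp (- real n * \<rho>\<^sub>0)"
    "\<And>n a. exp (- real n * \<rho>\<^sub>0) \<le> K * len (S n) $ a"
    using length_growth by blast
  have meas: "measure \<nu> (C n (a, k)) = exp (word_sum v (iter_word W n a) k) * L n $ a"
    if "k < length (iter_word W n a)" for n a k
    using cyl_measure(2)[OF sc that fin] by (simp add: C_def L_def measure_def)
  interpret cylinder_system \<nu> I C "\<rho>\<^sub>0" "1 / K" K "word_entropy W w"
  proof
    show "sets \<nu> = sets borel" "emeasure \<nu> UNIV = 1" "emeasure \<nu> {0..<1} = 1" by fact+
    show "finite (I n)" for n unfolding I_def by (intro finite_SigmaI) auto
    show "0 < \<rho>\<^sub>0" by (rule rho0_pos)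
    show "0 < 1 / K" using K(1) by simp
    show "0 < word_entropy W w" by (rule word_entropy_pos[OF pos card_ge_2])
  next
    fix n i assume "i \<in> I n"
    then obtain a k where i: "i = (a, k)" "k < length (iter_word W n a)" by (auto simp: I_def)
    obtain c where "cyl n a k = {c..<c + len (S n) $ a}" using cyl_interval[OF i(2)] by blast
    moreover have "1 / K * exp (- real n * \<rho>\<^sub>0) \<le> len (S n) $ a" using K(1) K(3)[of n a] by (simp add: field_simps)
    ultimately show "\<exists>c len. C n i = {c..<c + len} \<and> 1 / K * exp (- real n * \<rho>\<^sub>0) \<le> len \<and> len \<le> K * exp (- real n * \<rho>\<^sub>0)"
      using K(2)[of n a] unfolding C_def i(1) by auto
  next
    fix n i j x assume "i \<in> I n" "j \<in> I n" "x \<in> C n i" "x \<in> C n j"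
    then show "i = j" using cyl_disjoint[of _ n] by (auto simp: I_def C_def)
  next
    fix n x assume "x \<in> {0..<1::real}"
    then obtain a k where "k < length (iter_word W n a)" "x \<in> cyl n a k" using cyl_cover[of x n] dom by auto
    then show "\<exists>i\<in>I n. x \<in> C n i" by (intro bexI[of _ "(a, k)"]) (auto simp: I_def C_def)
  next
    fix \<eta> :: real assume \<eta>: "0 < \<eta>"
    have "(\<Sum>i\<in>I n. measure \<nu> (C n i) powr s) =
      (\<Sum>a\<in>UNIV. \<Sum>k<length (iter_word W n a). (exp (word_sum v (iter_word W n a) k) * L n $ a) powr s)" for n s
    proof -
      have "(\<Sum>i\<in>I n. measure \<nu> (C n i) powr s) =
        (\<Sum>a\<in>UNIV. \<Sum>k<length (iter_word W n a). measure \<nu> (C n (a, k)) powr s)"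
        unfolding I_def by (subst sum.Sigma) auto
      also have "\<dots> = (\<Sum>a\<in>UNIV. \<Sum>k<length (iter_word W n a). (exp (word_sum v (iter_word W n a) k) * L n $ a) powr s)"
        by (intro sum.cong refl) (simp add: meas)
      finally show ?thesis .
    qed
    then show "\<exists>\<delta>>0. \<forall>s. 0 < s \<and> s \<noteq> 1 \<and> \<bar>s - 1\<bar> < \<delta> \<longrightarrow> (\<exists>K>0. \<forall>n.
      (\<Sum>i\<in>I n. measure \<nu> (C n i) powr s) \<le> K * exp (real n * ((1 - s) * word_entropy W w + \<eta> * \<bar>s - 1\<bar>)))"
      using cylinder_sum_growth[OF pos conv \<eta> L0 _ rec] by (simp add: word_entropy_def L_def)
  qed
  show ?thesis by (rule dim_measure_eq)
qed

end

theorem theorem1p5: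
  fixes T :: "'a::finite iet" and N :: nat and \<omega> :: "real ^ 'a" and \<nu> :: "real measure"
  assumes "hyperbolic_periodic_type T N"
    and "central_stable_type T N \<omega>"
    and "conformal_measure T \<omega> \<nu>"
  shows "hausdorff_dim_measure \<nu> = ereal (entropy_H T N \<omega> / rho_T T N) \<and>
         entropy_H T N \<omega> / rho_T T N \<in> {0<..<1}"
proof -
  define W where "W = rv_word T N"
  define S where "S n = rv_iter T (n * N)" for n
  have T: "is_iet T" and dom: "iet_dom T = {0..<1}" and inf: "rv_infinite T" and per: "rv_period T N"
    and Mpos: "\<And>a b. 0 < self_sim_matrix T N $ a $ b"
    using assms(1) by (auto simp: hyperbolic_periodic_type_def self_similar_def)
  have iet: "is_iet (S n)" for n unfolding S_def by (rule rv_iter_is_iet(1)[OF T inf])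
  have tow: "tower_over (S n) (S (Suc n)) W" for n
    unfolding S_def W_def by (rule self_similar_towers[OF T inf per])
  have S0: "S 0 = T" by (simp add: S_def)
  have towN: "tower_over T (rv_iter T N) W" using tow[of 0] by (simp add: S_def)
  have ietN: "is_iet (rv_iter T N)" by (rule rv_iter_is_iet(1)[OF T inf])
  have M: "self_sim_matrix T N = word_matrix W 0"
    by (simp add: vec_eq_iff self_sim_matrix_word[OF T ietN towN] word_matrix_0_entry)
  have A: "twisted_matrix T N v = word_matrix W v" for v
    by (simp add: vec_eq_iff twisted_matrix_word[OF T ietN towN] word_matrix_def word_sum_def)
  have pos: "0 < word_matrix W 0 $ a $ b" for a b using Mpos M by simp
  interpret iet_sequence S W by unfold_locales (rule iet tow pos)+
  obtain wc ws where dec: "spectral_decomp (word_matrix W 0) \<omega> 0 wc ws" and wc: "wc \<noteq> 0"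
    using assms(2) unfolding central_stable_type_def M by blast
  have fixed: "word_matrix W 0 *v wc = wc" using dec by (simp add: spectral_decomp_def)
  \<comment> \<open>Type central-stable enters here: without an expanding part the renormalized
    vectors converge to the central part.\<close>
  have conv: "(\<lambda>n. iter_vec W n \<omega>) \<longlonglongrightarrow> wc"
  proof -
    have "(\<lambda>n. iter_vec W n ws) \<longlonglongrightarrow> 0"
      using dec by (intro contracting_tendsto_0) (simp add: spectral_decomp_def)
    then have "(\<lambda>n. wc + iter_vec W n ws) \<longlonglongrightarrow> wc + 0" by (intro tendsto_intros)
    moreover have "\<omega> = wc + ws" using dec by (simp add: spectral_decomp_def)
    ultimately show ?thesis by (simp add: iter_vec_add iter_vec_fixed[OF fixed])
  qed
  have H: "entropy_H T N \<omega> = word_entropy W wc"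
    unfolding entropy_H_def Let_def M central_part_eq[OF dec] A word_entropy_def pressure_slope_def
    by (auto simp: rv_time_word[OF T ietN towN] tower_letter_word[OF T ietN towN]
        tower_sum_word[OF T ietN towN] word_sum_def intro!: sum.cong)
  have R: "rho_T T N = \<rho>\<^sub>0" by (simp add: rho_T_def M)
  \<comment> \<open>Feeds the equality case of Gibbs' inequality, where the function
    \<open>h\<close> must be shown constant.\<close>
  obtain n where "\<And>a b. ((\<lambda>a. W a ! 0) ^^ n) a = ((\<lambda>a. W a ! 0) ^^ n) b"
    using first_letter_stabilizes by blast
  then have "word_entropy W wc < \<rho>\<^sub>0"
    by (rule word_entropy_less[OF pos card_ge_2 fixed wc])
  moreover have "0 < word_entropy W wc" by (rule word_entropy_pos[OF pos card_ge_2])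
  ultimately have "word_entropy W wc / \<rho>\<^sub>0 \<in> {0<..<1}" by simp
  moreover have "hausdorff_dim_measure \<nu> = ereal (word_entropy W wc / \<rho>\<^sub>0)"
    using conformal_dimension[of \<omega> \<nu> wc] dom assms(3) conv by (simp add: S0)
  ultimately show ?thesis by (simp only: H R)
qed

end
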